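(* Let $\mathscr{X}$ be a locally finite regular affine building of type $R$, and let $\mathscr{A}$ be the algebra of vertex set averaging operators of $\mathscr{X}$, that is, the linear span over $\mathbb{C}$ of $\{A_\lambda\mid\lambda\in P^+\}$. The algebra $\mathscr{A}$ is commutative.
   Context: Root data. $R$ is an irreducible, not necessarily reduced, root system in an $n$-dimensional real inner product space $E$, with base $\{\alpha_i\}_{i\in I_0}$, $I_0=\{1,\ldots,n\}$, and positive roots $R^+$; $\alpha^\vee=2\alpha/\langle\alpha,\alpha\rangle$; $\tilde\alpha=\sum_{i\in I_0}m_i\alpha_i$ is the highest root, $m_0=1$, and $I=I_0\cup\{0\}$. $\{\lambda_i\}_{i\in I_0}$ is the basis of $E$ with $\langle\lambda_i,\alpha_j\rangle=\delta_{i,j}$; $P=\bigoplus_i\mathbb{Z}\lambda_i$ (coweight lattice); $P^+=\{\sum a_i\lambda_i\mid a_i\in\mathbb{Z}_{\ge0}\}$. For $\alpha\in R$, $k\in\mathbb{Z}$: $H_{\alpha;k}=\{x\in E\mid\langle x,\alpha\rangle=k\}$ and $s_{\alpha;k}(x)=x-(\langle x,\alpha\rangle-k)\alpha^\vee$. Put $s_i=s_{\alpha_i;0}$ ($i\in I_0$), $s_0=s_{\tilde\alpha;1}$. $W_0$ is the Weyl group generated by $s_i$, $i\in I_0$, and $W$ is the affine Weyl group generated by all $s_{\alpha;k}$; it is a Coxeter group with generating set $S=\{s_i\mid i\in I\}$, and $D$ is its Coxeter graph with vertex set $I$. $\tilde W=W_0\ltimes P$ acts on $E$, with $\lambda\in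 P$ acting by $t_\lambda(x)=x+\lambda$. $\Sigma$ is $E$ with chambers the connected components of $E\setminus\bigcup H_{\alpha;k}$ and vertices the extreme points of closures of chambers; it is a realisation of the Coxeter complex of $W$. $C_0=\{x\mid\langle x,\alpha_i\rangle>0\ \forall i\in I_0,\ \langle x,\tilde\alpha\rangle<1\}$. The vertices of $\overline{C}_0$ are $0$ and $\lambda_i/m_i$ ($i\in I_0$); the type map $\tau$ from the vertices of $\Sigma$ to $I$ is the $W$-invariant map with $\tau(0)=0$, $\tau(\lambda_i/m_i)=i$. $I_P=\{\tau(\lambda)\mid\lambda\in P\}=\{i\in I\mid m_i=1\}$. $G$ is the stabiliser of $C_0$ in $\tilde W$; $G=\{g_i\mid i\in I_P\}$, where $g_i$ is the element of $G$ sending $0$ to the type $i$ vertex of $\overline{C}_0$. For $i\in I_P$, $\sigma_i$ is the automorphism of $D$ with $g_is_jg_i^{-1}=s_{\sigma_i(j)}$ for $j\in I$; $\mathrm{Aut}_{\mathrm{tr}}(D)=\{\sigma_i\mid i\in I_P\}$. Buildings. A building of type $W$ is a set $\mathcal{C}$ of chambers with equivalence relations $\sim_i$ ($i\in I$) such that every $\sim_i$-class has at least two elements, and with a $W$-distance $\delta:\mathcal{C}\times\mathcal{C}\to W$ such that for each reduced expression $w=s_{i_1}\cdots s_{i_m}$, $\delta(c,d)=w$ iff there are $c=c_0,\ldots,c_m=d$ with $c_{k-1}\sim_{i_k}c_k$, $c_{k-1}\neq c_k$. It is locally finite if all $\sim_i$-classes are finite and regular if $q_{s}=|\{b\mid\delta(a,b)=s\}|$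 is independent of $a\in\mathcal{C}$ for each $s\in S$ ($q_i=q_{s_i}$). A locally finite regular affine building of type $R$ is a locally finite regular building of type $W=W(R)$, with the convention that $q_{\sigma(i)}=q_i$ for all $\sigma\in\mathrm{Aut}_{\mathrm{tr}}(D)$ (automatic except that it means $q_0=q_1$ if $R=A_1$ and $q_0=q_n$ if $R=C_n$; general regular buildings with the diagrams $\tilde A_1$, $\tilde C_n$ are regarded as having $R=BC_1$, $BC_n$). The building is also regarded, as usual, as a labelled simplicial complex with vertex set $V$, type map $\tau:V\to I$, and apartments (subcomplexes isomorphic to $\Sigma$). $V_P=\{x\in V\mid\tau(x)\in I_P\}$ (good vertices). An isomorphism $\psi:\mathcal{A}\to\Sigma$ from an apartment is type-rotating if $\psi=w\circ\psi_1$ with $\psi_1:\mathcal{A}\to\Sigma$ a type preserving isomorphism and $w\in\tilde W$. For $x\in V_P$, $\lambda\in P^+$, $V_\lambda(x)$ is the set of $y\in V_P$ for which there exist an apartment $\mathcal{A}$ containing $x$ and $y$ and a type-rotating isomorphism $\psi:\mathcal{A}\to\Sigma$ with $\psi(x)=0$, $\psi(y)=\lambda$. The sets $V_\lambda(x)$ are finite and $N_\lambda=|V_\lambda(x)|$ is independent of $x\in V_P$. For $\lambda\in P^+$ the operator $A_\lambda$ on the space of all functions $f:V_P\to\mathbb{C}$ is $(A_\lambda f)(x)=\frac{1}{N_\lambda}\sum_{y\in V_\lambda(x)}f(y)$. The linear span $\mathscr{A}$ of these operators is closed under composition, hence an associative algebra. *)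

theory Defs
  imports "HOL-Analysis.Analysis"
begin

section \<open>Root systems\<close>

definition coroot :: "'a::euclidean_space \<Rightarrow> 'a" where
  "coroot \<alpha> = (2 / (\<alpha> \<bullet> \<alpha>)) *\<^sub>R \<alpha>"

definition hyperplane :: "'a::euclidean_space \<Rightarrow> int \<Rightarrow> 'a set" where
  "hyperplane \<alpha> k = {x. x \<bullet> \<alpha> = of_int k}"

definition aff_reflection :: "'a::euclidean_space \<Rightarrow> int \<Rightarrow> 'a \<Rightarrow> 'a" where
  "aff_reflection \<alpha> k x = x - (x \<bullet> \<alpha> - of_int k) *\<^sub>R coroot \<alpha>"

text \<open>Not necessarily reduced: \<^term>\<open>2 *\<^sub>R \<alpha>\<close> may be a root along with \<^term>\<open>\<alpha>\<close>.\<close>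

definition root_system :: "'a::euclidean_space set \<Rightarrow> bool" where
  "root_system R \<longleftrightarrow>
     finite R \<and> span R = UNIV \<and> 0 \<notin> R \<and>
     (\<forall>\<alpha>\<in>R. aff_reflection \<alpha> 0 ` R = R) \<and>
     (\<forall>\<alpha>\<in>R. \<forall>\<beta>\<in>R. \<beta> \<bullet> coroot \<alpha> \<in> \<int>)"

definition irreducible_root_system :: "'a::euclidean_space set \<Rightarrow> bool" where
  "irreducible_root_system R \<longleftrightarrow>
     root_system R \<and>
     \<not> (\<exists>A B. A \<noteq> {} \<and> B \<noteq> {} \<and> A \<inter> B = {} \<and> A \<union> B = R \<and>
            (\<forall>a\<in>A. \<forall>b\<in>B. a \<bullet> b = 0))"

text \<open>A base is indexed by \<open>{1..n}\<close>, where \<open>n\<close> is the dimension of the ambient space.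
  The index \<open>0\<close> is reserved for the affine node.\<close>

definition root_base :: "'a::euclidean_space set \<Rightarrow> (nat \<Rightarrow> 'a) \<Rightarrow> bool" where
  "root_base R \<alpha> \<longleftrightarrow>
     inj_on \<alpha> {1..DIM('a)} \<and> independent (\<alpha> ` {1..DIM('a)}) \<and> \<alpha> ` {1..DIM('a)} \<subseteq> R \<and>
     (\<forall>\<beta>\<in>R. \<exists>k::nat \<Rightarrow> int.
        \<beta> = (\<Sum>i=1..DIM('a). of_int (k i) *\<^sub>R \<alpha> i) \<and>
        ((\<forall>i\<in>{1..DIM('a)}. k i \<ge> 0) \<or> (\<forall>i\<in>{1..DIM('a)}. k i \<le> 0)))"

text \<open>The set of all compositions of elements of \<open>S\<close>.  It is only used for sets \<open>S\<close> of
  involutions, where it is the group generated by \<open>S\<close>.\<close>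

inductive_set generated :: "('a \<Rightarrow> 'a) set \<Rightarrow> ('a \<Rightarrow> 'a) set" for S where
  generated_id: "id \<in> generated S"
| generated_comp: "f \<in> S \<Longrightarrow> g \<in> generated S \<Longrightarrow> f \<circ> g \<in> generated S"

text \<open>An abstract simplicial complex is represented by its set of simplices, each simplex being a
  set of vertices; the vertex set of a complex \<open>K\<close> is \<open>\<Union>K\<close>.\<close>

definition simplicial_iso :: "'v set set \<Rightarrow> 'w set set \<Rightarrow> ('v \<Rightarrow> 'w) \<Rightarrow> bool" where
  "simplicial_iso K L f \<longleftrightarrow> bij_betw f (\<Union>K) (\<Union>L) \<and> (\<lambda>s. f ` s) ` K = L"

definition subcomplex :: "'v set set \<Rightarrow> 'v set set \<Rightarrow> bool" where
  "subcomplex K L \<longleftrightarrow> K \<subseteq> L \<and> (\<forall>s\<in>K. \<forall>t. t \<subseteq> s \<longrightarrow> t \<in> K)"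

locale root_datum =
  fixes R :: "'a::euclidean_space set" and \<alpha> :: "nat \<Rightarrow> 'a"
  assumes irreducible: "irreducible_root_system R"
    and base: "root_base R \<alpha>"
begin

definition I0 :: "nat set" where
  "I0 = {1..DIM('a)}"

definition I :: "nat set" where
  "I = insert 0 I0"

definition highest_root :: 'a where
  "highest_root = (THE \<beta>. \<beta> \<in> R \<and>
     (\<forall>\<gamma>\<in>R. \<exists>k::nat \<Rightarrow> nat. \<beta> - \<gamma> = (\<Sum>i\<in>I0. of_nat (k i) *\<^sub>R \<alpha> i)))"

definition mark :: "nat \<Rightarrow> real" where
  "mark i = (if i = 0 then 1 else representation (\<alpha> ` I0) highest_root (\<alpha> i))"

definition fund_coweight :: "nat \<Rightarrow> 'a" where
  "fund_coweight i = (THE v. \<forall>j\<in>I0. v \<bullet> \<alpha> j = (if i = j then 1 else 0))"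

definition P :: "'a set" where
  "P = {\<Sum>i\<in>I0. of_int (a i) *\<^sub>R fund_coweight i | a :: nat \<Rightarrow> int. True}"

definition P_plus :: "'a set" where
  "P_plus = {\<Sum>i\<in>I0. of_nat (a i) *\<^sub>R fund_coweight i | a :: nat \<Rightarrow> nat. True}"


section \<open>Weyl groups\<close>

definition s :: "nat \<Rightarrow> 'a \<Rightarrow> 'a" where
  "s i = (if i = 0 then aff_reflection highest_root 1 else aff_reflection (\<alpha> i) 0)"

definition W0 :: "('a \<Rightarrow> 'a) set" where
  "W0 = generated (s ` I0)"

definition W :: "('a \<Rightarrow> 'a) set" where
  "W = generated {aff_reflection \<beta> k | \<beta> k. \<beta> \<in> R}"

definition W_ext :: "('a \<Rightarrow> 'a) set" where
  "W_ext = {(\<lambda>x. x + v) \<circ> w | v w. v \<in> P \<and> w \<in> W0}"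

definition word :: "nat list \<Rightarrow> 'a \<Rightarrow> 'a" where
  "word js = foldr (\<circ>) (map s js) id"

definition reduced_word :: "nat list \<Rightarrow> bool" where
  "reduced_word js \<longleftrightarrow> js \<in> lists I \<and>
     (\<forall>ks\<in>lists I. word ks = word js \<longrightarrow> length js \<le> length ks)"


section \<open>The Coxeter complex\<close>

definition alcoves :: "'a set set" where
  "alcoves = components (UNIV - (\<Union>\<beta>\<in>R. \<Union>k. hyperplane \<beta> k))"

definition coxeter_complex :: "'a set set" where
  "coxeter_complex = {t. \<exists>K\<in>alcoves. t \<subseteq> {v. v extreme_point_of (closure K)}}"

definition fund_alcove :: "'a set" where
  "fund_alcove = {x. (\<forall>i\<in>I0. x \<bullet> \<alpha> i > 0) \<and> x \<bullet> highest_root < 1}"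

definition fund_vertex :: "nat \<Rightarrow> 'a" where
  "fund_vertex i = (if i = 0 then 0 else (1 / mark i) *\<^sub>R fund_coweight i)"

text \<open>Every vertex of the Coxeter complex is \<open>W\<close>-conjugate to exactly one vertex of the closure
  of the fundamental alcove.\<close>

definition vertex_type :: "'a \<Rightarrow> nat" where
  "vertex_type v = (THE i. i \<in> I \<and> (\<exists>w\<in>W. v = w (fund_vertex i)))"

definition I_P :: "nat set" where
  "I_P = vertex_type ` P"

definition G :: "('a \<Rightarrow> 'a) set" where
  "G = {g \<in> W_ext. g ` fund_alcove = fund_alcove}"

definition Aut_tr :: "(nat \<Rightarrow> nat) set" where
  "Aut_tr = {\<sigma>. \<sigma> permutes I \<and>
     (\<exists>i\<in>I_P. \<exists>g\<in>G. g 0 = fund_vertex i \<and> (\<forall>j\<in>I. g \<circ> s j \<circ> inv g = s (\<sigma> j)))}"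

end


section \<open>Affine buildings\<close>

locale building = root_datum R \<alpha>
  for R :: "'a::euclidean_space set" and \<alpha> :: "nat \<Rightarrow> 'a" +
  fixes C :: "'c set"
    and adj :: "nat \<Rightarrow> ('c \<times> 'c) set"
    and \<delta> :: "'c \<Rightarrow> 'c \<Rightarrow> 'a \<Rightarrow> 'a"
  assumes adj_equiv: "\<And>i. i \<in> I \<Longrightarrow> equiv C (adj i)"
    and panel: "\<And>i c. i \<in> I \<Longrightarrow> c \<in> C \<Longrightarrow> \<exists>d. (c, d) \<in> adj i \<and> d \<noteq> c"
    and dist_in_W: "\<And>c d. c \<in> C \<Longrightarrow> d \<in> C \<Longrightarrow> \<delta> c d \<in> W"
    and dist_iff_gallery: "\<And>js c d. reduced_word js \<Longrightarrow> c \<in> C \<Longrightarrow> d \<in> C \<Longrightarrow>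
      \<delta> c d = word js \<longleftrightarrow>
      (\<exists>p :: nat \<Rightarrow> 'c. p 0 = c \<and> p (length js) = d \<and>
         (\<forall>k<length js. (p k, p (Suc k)) \<in> adj (js ! k) \<and> p k \<noteq> p (Suc k)))"
begin

definition q :: "'c \<Rightarrow> nat \<Rightarrow> nat" where
  "q a i = card {b \<in> C. \<delta> a b = s i}"

text \<open>The vertex of type \<open>i\<close> of a chamber \<open>c\<close> is the residue of cotype \<open>i\<close> containing \<open>c\<close>,
  tagged with its type.\<close>

definition vertex_of :: "nat \<Rightarrow> 'c \<Rightarrow> nat \<times> 'c set" where
  "vertex_of i c = (i, (\<Union>j\<in>I - {i}. adj j)\<^sup>* `` {c})"

definition vertices :: "(nat \<times> 'c set) set" where
  "vertices = {vertex_of i c | i c. i \<in> I \<and> c \<in> C}"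

definition building_complex :: "(nat \<times> 'c set) set set" where
  "building_complex = {t. \<exists>c\<in>C. t \<subseteq> (\<lambda>i. vertex_of i c) ` I}"

abbreviation type_of :: "nat \<times> 'c set \<Rightarrow> nat" where
  "type_of \<equiv> fst"

definition good_vertices :: "(nat \<times> 'c set) set" where
  "good_vertices = {x \<in> vertices. type_of x \<in> I_P}"

definition type_preserving_iso ::
    "(nat \<times> 'c set) set set \<Rightarrow> (nat \<times> 'c set \<Rightarrow> 'a) \<Rightarrow> bool" where
  "type_preserving_iso A \<psi> \<longleftrightarrow>
     simplicial_iso A coxeter_complex \<psi> \<and> (\<forall>v\<in>\<Union>A. vertex_type (\<psi> v) = type_of v)"

definition apartment :: "(nat \<times> 'c set) set set \<Rightarrow> bool" where
  "apartment A \<longleftrightarrow> subcomplex A building_complex \<and> (\<exists>\<psi>. type_preserving_iso A \<psi>)"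

definition type_rotating_iso ::
    "(nat \<times> 'c set) set set \<Rightarrow> (nat \<times> 'c set \<Rightarrow> 'a) \<Rightarrow> bool" where
  "type_rotating_iso A \<psi> \<longleftrightarrow>
     simplicial_iso A coxeter_complex \<psi> \<and>
     (\<exists>w\<in>W_ext. \<exists>\<psi>1. type_preserving_iso A \<psi>1 \<and> (\<forall>v\<in>\<Union>A. \<psi> v = w (\<psi>1 v)))"

definition vertex_sphere :: "'a \<Rightarrow> nat \<times> 'c set \<Rightarrow> (nat \<times> 'c set) set" where
  "vertex_sphere l x = {y \<in> good_vertices. \<exists>A \<psi>. apartment A \<and> x \<in> \<Union>A \<and> y \<in> \<Union>A \<and>
     type_rotating_iso A \<psi> \<and> \<psi> x = 0 \<and> \<psi> y = l}"

text \<open>A function on the good vertices is represented by a total function whose values elsewhere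
  are irrelevant.  The operators below ignore those values and return functions vanishing there,
  so that equality of operators is equality as operators on functions on the good vertices.
  The cardinality of \<open>vertex_sphere l x\<close> does not depend on the good vertex \<open>x\<close>.\<close>

definition averaging :: "'a \<Rightarrow> (nat \<times> 'c set \<Rightarrow> complex) \<Rightarrow> (nat \<times> 'c set \<Rightarrow> complex)" where
  "averaging l f x =
     (if x \<in> good_vertices
      then (\<Sum>y\<in>vertex_sphere l x. f y) / of_nat (card (vertex_sphere l x)) else 0)"

definition averaging_algebra ::
    "((nat \<times> 'c set \<Rightarrow> complex) \<Rightarrow> (nat \<times> 'c set \<Rightarrow> complex)) set" where
  "averaging_algebra =
     {\<lambda>f x. \<Sum>l\<in>F. a l * averaging l f x | F (a :: 'a \<Rightarrow> complex). finite F \<and> F \<subseteq> P_plus}"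

end

locale locally_finite_regular_affine_building = building R \<alpha> C adj \<delta>
  for R :: "'a::euclidean_space set" and \<alpha> :: "nat \<Rightarrow> 'a"
    and C :: "'c set" and adj :: "nat \<Rightarrow> ('c \<times> 'c) set"
    and \<delta> :: "'c \<Rightarrow> 'c \<Rightarrow> 'a \<Rightarrow> 'a" +
  assumes locally_finite: "\<And>i c. i \<in> I \<Longrightarrow> c \<in> C \<Longrightarrow> finite (adj i `` {c})"
    and regular: "\<And>i a b. i \<in> I \<Longrightarrow> a \<in> C \<Longrightarrow> b \<in> C \<Longrightarrow> q a i = q b i"
    and parameters_invariant:
      "\<And>\<sigma> i a. \<sigma> \<in> Aut_tr \<Longrightarrow> i \<in> I \<Longrightarrow> a \<in> C \<Longrightarrow> q a (\<sigma> i) = q a i"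

end

theory Submission imports Defs begin

text \<open>The proof is Gelfand's trick, carried out on chambers. For a good vertex \<open>x\<close> of type
  \<open>i\<close> pair each chamber \<open>a\<close> containing it with \<open>g\<^sub>i \<in> G\<close>; the \<open>\<tilde>W\<close>-valued
  distance \<open>g\<^sub>i\<^sup>-\<^sup>1 \<delta>(a,b) g\<^sub>j\<close> then determines, through its \<open>W\<^sub>0\<close>-double coset, the
  \<open>\<lambda>\<close> for which the vertex \<open>y\<close> of \<open>b\<close> lies in \<open>V\<^sub>\<lambda>(x)\<close>. The number of chambers at
  prescribed distances from two given chambers depends only on the parameters \<open>q\<^sub>i\<close>, so it is
  unchanged when all distances are conjugated by an isometry of the fundamental alcove preserving the
  parameters: an element of \<open>G\<close>, or the opposition involution \<open>\<iota> = -w\<^sub>0\<close>. It is also unchanged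
  when all distances are inverted and the roles of the two chambers are exchanged. As
  \<open>w \<mapsto> \<iota> w\<^sup>-\<^sup>1 \<iota>\<close> reverses products and fixes every \<open>W\<^sub>0\<close>-double coset, the
  structure constants of the averaging operators are symmetric.\<close>

section \<open>Root systems and the highest root\<close>

text \<open>A building need not have enough automorphisms to exchange chambers, so Gelfand's trick
  cannot be run with a symmetry of the building. \<open>chamber_transport\<close> is the substitute:
  a bijection of the chambers that controls distances to two chosen chambers only, obtained by
  comparing sizes of fibres. The opposition involution is forced by inversion, which turns
  translation by \<lambda> into translation by -\<lambda>; a twist by \<open>opp_inv\<close> brings
  this back to the double coset of \<lambda>. The twist inverts \<open>G\<close>, so vertices whose
  types are given by \<open>g\<close> and \<open>k\<close> also need the factor
  \<open>g \<circ> k\<close>, and commutativity of \<open>G\<close> makes the induced map on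
  intermediate types an involution. Spheres of vertices are counted through chambers, each good
  vertex being met the same number \<open>residue_size\<close> of times. Two foundations have to be
  built first: length and the exchange condition are read off from the hyperplanes separating
  alcoves, and apartments through two chambers come from extending isometries of \<open>W\<close>
  one chamber at a time.\<close>

lemma coroot_inner_self: "\<beta> \<noteq> 0 \<Longrightarrow> \<beta> \<bullet> coroot \<beta> = 2"
  by (simp add: coroot_def)

lemma aff_reflection_self: "\<beta> \<noteq> 0 \<Longrightarrow> aff_reflection \<beta> 0 \<beta> = - \<beta>"
  by (simp add: aff_reflection_def coroot_def algebra_simps scaleR_2)

lemma inner_aff_reflection:
  "aff_reflection \<beta> k x \<bullet> \<gamma> = x \<bullet> \<gamma> - (x \<bullet> \<beta> - of_int k) * (\<gamma> \<bullet> coroot \<beta>)"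
  by (simp add: aff_reflection_def inner_diff_left inner_commute[of "coroot _"])

lemma inner_aff_reflection_0:
  "aff_reflection \<beta> 0 x \<bullet> \<gamma> = x \<bullet> aff_reflection \<beta> 0 \<gamma>"
  by (simp add: aff_reflection_def coroot_def inner_diff_left inner_diff_right inner_commute)

lemma aff_reflection_involution:
  assumes "\<beta> \<noteq> 0"
  shows "aff_reflection \<beta> k (aff_reflection \<beta> k x) = x"
proof -
  have "aff_reflection \<beta> k x \<bullet> \<beta> - of_int k = - (x \<bullet> \<beta> - of_int k)"
    using coroot_inner_self[OF assms] by (simp add: inner_aff_reflection algebra_simps)
  then have "aff_reflection \<beta> k (aff_reflection \<beta> k x)
      = aff_reflection \<beta> k x + (x \<bullet> \<beta> - of_int k) *\<^sub>R coroot \<beta>"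
    unfolding aff_reflection_def[of \<beta> k "aff_reflection \<beta> k x"] by (simp del: minus_diff_eq)
  also have "\<dots> = x" by (simp add: aff_reflection_def)
  finally show ?thesis .
qed

lemma aff_reflection_0_isometry:
  "aff_reflection \<beta> 0 x \<bullet> aff_reflection \<beta> 0 y = x \<bullet> y"
proof (cases "\<beta> = 0")
  case True then show ?thesis by (simp add: aff_reflection_def)
next
  case False
  then show ?thesis
    by (simp add: inner_aff_reflection_0 aff_reflection_involution)
qed

lemma linear_aff_reflection_0: "linear (aff_reflection \<beta> 0)"
  by (rule linearI) (simp_all add: aff_reflection_def inner_add_left algebra_simps)

lemma ex_max_if_finite:
  fixes f :: "'b \<Rightarrow> real"
  assumes "finite M" "M \<noteq> {}"
  shows "\<exists>x\<in>M. \<forall>y\<in>M. f y \<le> f x"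
proof -
  have "Max (f ` M) \<in> f ` M" using assms by simp
  then obtain x where "x \<in> M" "f x = Max (f ` M)" by auto
  then show ?thesis using assms by (intro bexI[of _ x]) auto
qed

text \<open>Riesz representation in finite dimension; it turns the coordinate functionals of the
  base into fundamental coweights.\<close>

lemma real_functional_inner:
  fixes g :: "'a::euclidean_space \<Rightarrow> real"
  assumes "linear g"
  shows "\<exists>w. \<forall>v. g v = w \<bullet> v"
proof (intro exI allI)
  fix v
  have "g v = g (\<Sum>b\<in>Basis. (v \<bullet> b) *\<^sub>R b)" by (simp add: euclidean_representation)
  also have "\<dots> = (\<Sum>b\<in>Basis. (v \<bullet> b) * g b)"
    by (simp add: linear_sum[OF assms] linear_cmul[OF assms])
  also have "\<dots> = (\<Sum>b\<in>Basis. g b *\<^sub>R b) \<bullet> v"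
    by (simp add: inner_sum_left inner_sum_right inner_commute mult.commute)
  finally show "g v = (\<Sum>b\<in>Basis. g b *\<^sub>R b) \<bullet> v" .
qed

section \<open>Simple roots, fundamental coweights and positive roots\<close>

context root_datum
begin

lemma finite_I0: "finite I0" by (simp add: I0_def)
lemma finite_I: "finite I" by (simp add: I_def finite_I0)
lemma zero_notin_I0 [simp]: "0 \<notin> I0" by (simp add: I0_def)
lemma zero_in_I [simp]: "0 \<in> I" by (simp add: I_def)
lemma I0_nonempty: "I0 \<noteq> {}" by (simp add: I0_def)

lemma finite_R: "finite R" and span_R: "span R = UNIV" and zero_notin_R: "0 \<notin> R"
  and reflection_image: "\<beta> \<in> R \<Longrightarrow> aff_reflection \<beta> 0 ` R = R"
  and integrality: "\<beta> \<in> R \<Longrightarrow> \<gamma> \<in> R \<Longrightarrow> \<gamma> \<bullet> coroot \<beta> \<in> \<int>"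
  using irreducible by (auto simp: irreducible_root_system_def root_system_def)

lemma root_nonzero: "\<beta> \<in> R \<Longrightarrow> \<beta> \<noteq> 0" using zero_notin_R by blast

lemma reflection_root: "\<beta> \<in> R \<Longrightarrow> \<gamma> \<in> R \<Longrightarrow> aff_reflection \<beta> 0 \<gamma> \<in> R"
  using reflection_image by blast

lemma uminus_root: "\<beta> \<in> R \<Longrightarrow> - \<beta> \<in> R"
  using reflection_root[of \<beta> \<beta>] aff_reflection_self[OF root_nonzero] by simp

lemma simple_root: "i \<in> I0 \<Longrightarrow> \<alpha> i \<in> R"
  using base by (auto simp: root_base_def I0_def)

lemma span_simple: "span (\<alpha> ` I0) = UNIV"
proof -
  have "card (\<alpha> ` I0) = DIM('a)"
    using base by (simp add: root_base_def I0_def card_image)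
  then have "UNIV \<subseteq> span (\<alpha> ` I0)"
    using base by (intro card_ge_dim_independent) (auto simp: root_base_def I0_def)
  then show ?thesis by auto
qed

lemma eq_if_inner_simple:
  assumes "\<And>i. i \<in> I0 \<Longrightarrow> x \<bullet> \<alpha> i = y \<bullet> \<alpha> i"
  shows "x = y"
proof -
  have "orthogonal (x - y) z" if "z \<in> \<alpha> ` I0" for z
    using that assms by (auto simp: orthogonal_def inner_diff_left)
  then have "orthogonal (x - y) (x - y)"
    using orthogonal_to_span[of "x - y" "\<alpha> ` I0" "x - y"] span_simple by auto
  then show ?thesis by (simp add: orthogonal_def)
qed

text \<open>The coweight is a definite description, so a dual basis has to be produced: the
  functional that is 1 at one simple root and 0 at the others extends linearly and is represented by
  a vector. Uniqueness holds because the simple roots span.\<close>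

lemma fund_coweight_inner:
  assumes "i \<in> I0" "j \<in> I0"
  shows "fund_coweight i \<bullet> \<alpha> j = (if i = j then 1 else 0)"
proof -
  have ind: "independent (\<alpha> ` I0)" and inj: "inj_on \<alpha> I0"
    using base by (auto simp: root_base_def I0_def)
  obtain g :: "'a \<Rightarrow> real" where g: "linear g" "\<forall>x\<in>\<alpha> ` I0. g x = (if x = \<alpha> i then 1 else 0)"
    using linear_independent_extend[OF ind, of "\<lambda>x. if x = \<alpha> i then 1 else (0::real)"] by auto
  obtain w where w: "\<And>v. g v = w \<bullet> v" using real_functional_inner[OF g(1)] by blast
  have w1: "\<forall>j\<in>I0. w \<bullet> \<alpha> j = (if i = j then 1 else 0)"
  proof
    fix j assume "j \<in> I0"
    then have "g (\<alpha> j) = (if i = j then 1 else 0)"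
      using g(2) inj_on_eq_iff[OF inj, of j i] assms(1) by auto
    then show "w \<bullet> \<alpha> j = (if i = j then 1 else 0)" using w by simp
  qed
  have "\<forall>j\<in>I0. fund_coweight i \<bullet> \<alpha> j = (if i = j then 1 else 0)"
    unfolding fund_coweight_def
    by (rule theI[of _ w]) (use w1 in \<open>auto intro: eq_if_inner_simple\<close>)
  then show ?thesis using assms(2) by blast
qed

lemma coweight_expansion: "x = (\<Sum>i\<in>I0. (x \<bullet> \<alpha> i) *\<^sub>R fund_coweight i)"
  by (rule eq_if_inner_simple)
    (simp add: inner_sum_left fund_coweight_inner finite_I0 if_distrib[of "\<lambda>z. _ * z"] cong: if_cong)

text \<open>The difference of the two sides is orthogonal to every fundamental coweight, and these
  span by \<open>coweight_expansion\<close>.\<close>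

lemma simple_expansion: "x = (\<Sum>i\<in>I0. (x \<bullet> fund_coweight i) *\<^sub>R \<alpha> i)"
proof -
  have "orthogonal (x - (\<Sum>i\<in>I0. (x \<bullet> fund_coweight i) *\<^sub>R \<alpha> i)) y" for y
  proof -
    have "fund_coweight j \<bullet> (\<Sum>i\<in>I0. (x \<bullet> fund_coweight i) *\<^sub>R \<alpha> i) = x \<bullet> fund_coweight j"
      if "j \<in> I0" for j
      using that by (simp add: inner_sum_right fund_coweight_inner finite_I0
          if_distrib[of "\<lambda>z. _ * z"] cong: if_cong)
    then have "fund_coweight j \<bullet> (x - (\<Sum>i\<in>I0. (x \<bullet> fund_coweight i) *\<^sub>R \<alpha> i)) = 0"
      if "j \<in> I0" for j
      using that by (simp add: inner_diff_right inner_commute)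
    then have "(\<Sum>j\<in>I0. (y \<bullet> \<alpha> j) *\<^sub>R fund_coweight j) \<bullet>
        (x - (\<Sum>i\<in>I0. (x \<bullet> fund_coweight i) *\<^sub>R \<alpha> i)) = 0"
      by (simp add: inner_sum_left[of _ I0] del: inner_sum_right)
    then have "(x - (\<Sum>i\<in>I0. (x \<bullet> fund_coweight i) *\<^sub>R \<alpha> i)) \<bullet>
        (\<Sum>j\<in>I0. (y \<bullet> \<alpha> j) *\<^sub>R fund_coweight j) = 0"
      by (simp add: inner_commute)
    then show ?thesis unfolding orthogonal_def coweight_expansion[of y, symmetric] .
  qed
  then have "orthogonal (x - (\<Sum>i\<in>I0. (x \<bullet> fund_coweight i) *\<^sub>R \<alpha> i))
     (x - (\<Sum>i\<in>I0. (x \<bullet> fund_coweight i) *\<^sub>R \<alpha> i))" .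
  then show ?thesis by (simp add: orthogonal_def)
qed

text \<open>Coordinates in two dual bases are paired, so signs of inner products follow from signs
  of coordinates. The positivity arguments for roots and alcoves below rest on this formula.\<close>

lemma inner_expansion: "x \<bullet> y = (\<Sum>i\<in>I0. (x \<bullet> \<alpha> i) * (y \<bullet> fund_coweight i))"
proof -
  have "x \<bullet> y = x \<bullet> (\<Sum>i\<in>I0. (y \<bullet> fund_coweight i) *\<^sub>R \<alpha> i)"
    using simple_expansion[of y] by simp
  then show ?thesis by (simp add: inner_sum_right mult.commute)
qed

lemma root_coefficients:
  assumes "\<beta> \<in> R"
  shows "\<And>i. i \<in> I0 \<Longrightarrow> \<beta> \<bullet> fund_coweight i \<in> \<int>"
    and "(\<forall>i\<in>I0. \<beta> \<bullet> fund_coweight i \<ge> 0) \<or> (\<forall>i\<in>I0. \<beta> \<bullet> fund_coweight i \<le> 0)"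
proof -
  obtain k :: "nat \<Rightarrow> int" where k: "\<beta> = (\<Sum>i\<in>I0. of_int (k i) *\<^sub>R \<alpha> i)"
    "(\<forall>i\<in>I0. k i \<ge> 0) \<or> (\<forall>i\<in>I0. k i \<le> 0)"
    using base assms unfolding root_base_def I0_def by blast
  have *: "\<beta> \<bullet> fund_coweight i = of_int (k i)" if "i \<in> I0" for i
    using that by (subst k(1)) (simp add: inner_sum_left inner_commute[of "\<alpha> _"] fund_coweight_inner
        finite_I0 if_distrib[of "\<lambda>z. _ * z"] cong: if_cong)
  show "\<And>i. i \<in> I0 \<Longrightarrow> \<beta> \<bullet> fund_coweight i \<in> \<int>" using * by simp
  show "(\<forall>i\<in>I0. \<beta> \<bullet> fund_coweight i \<ge> 0) \<or> (\<forall>i\<in>I0. \<beta> \<bullet> fund_coweight i \<le> 0)"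
    using k(2) * by auto
qed

definition pos :: "'a \<Rightarrow> bool" where
  "pos \<beta> \<longleftrightarrow> \<beta> \<in> R \<and> (\<forall>i\<in>I0. \<beta> \<bullet> fund_coweight i \<ge> 0)"

lemma root_cases: "\<beta> \<in> R \<Longrightarrow> pos \<beta> \<or> pos (- \<beta>)"
  using root_coefficients(2)[of \<beta>] uminus_root by (auto simp: pos_def)

text \<open>All coefficients of a root share one sign, so a single positive coefficient
  decides.\<close>

lemma posI_coefficient: "\<beta> \<in> R \<Longrightarrow> i \<in> I0 \<Longrightarrow> \<beta> \<bullet> fund_coweight i > 0 \<Longrightarrow> pos \<beta>"
  using root_coefficients(2)[of \<beta>] unfolding pos_def by force

lemma pos_coefficient: 
  assumes "pos \<beta>"
  obtains i where "i \<in> I0" "\<beta> \<bullet> fund_coweight i > 0"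
proof -
  have "\<exists>i\<in>I0. \<beta> \<bullet> fund_coweight i \<noteq> 0"
  proof (rule ccontr)
    assume "\<not> ?thesis"
    then have "\<beta> = 0" by (subst simple_expansion) simp
    then show False using assms root_nonzero[of \<beta>] by (simp add: pos_def)
  qed
  then show ?thesis using that assms by (force simp: pos_def)
qed

lemma simple_coefficient: "i \<in> I0 \<Longrightarrow> j \<in> I0 \<Longrightarrow> \<alpha> j \<bullet> fund_coweight i = (if i = j then 1 else 0)"
  by (simp add: inner_commute[of "\<alpha> j"] fund_coweight_inner)

lemma reflection_coefficient:
  assumes "i \<in> I0" "j \<in> I0" "i \<noteq> j"
  shows "aff_reflection (\<alpha> i) 0 \<beta> \<bullet> fund_coweight j = \<beta> \<bullet> fund_coweight j"
  using simple_coefficient[of j i] assms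
  by (simp add: aff_reflection_def coroot_def inner_diff_left)

text \<open>Otherwise reflecting \<open>\<alpha> j\<close> in \<open>\<alpha> i\<close> would give a
  root with coefficient 1 at \<open>j\<close> and a negative coefficient at
  \<open>i\<close>.\<close>

lemma simple_inner_nonpos:
  assumes "i \<in> I0" "j \<in> I0" "i \<noteq> j"
  shows "\<alpha> i \<bullet> \<alpha> j \<le> 0"
proof (rule ccontr)
  assume "\<not> ?thesis"
  then have p: "\<alpha> j \<bullet> coroot (\<alpha> i) > 0"
    using root_nonzero[OF simple_root[OF assms(1)]] by (simp add: coroot_def inner_commute)
  let ?g = "aff_reflection (\<alpha> i) 0 (\<alpha> j)"
  have g: "?g \<in> R" using assms simple_root reflection_root by blast
  have "?g \<bullet> fund_coweight j = 1" using reflection_coefficient[OF assms] assms(2) by (simp add: simple_coefficient)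
  then have "pos ?g" using posI_coefficient[OF g assms(2)] by simp
  moreover have "?g \<bullet> fund_coweight i = - (\<alpha> j \<bullet> coroot (\<alpha> i))"
    using assms by (simp add: aff_reflection_def coroot_def inner_diff_left simple_coefficient)
  ultimately show False using assms(1) p by (force simp: pos_def)
qed

section \<open>Height, dominance and the existence of the highest root\<close>

definition ht :: "'a \<Rightarrow> real" where "ht x = (\<Sum>i\<in>I0. x \<bullet> fund_coweight i)"

text \<open>On roots, whose coefficients are integers, this is the order in the definition of
  \<open>highest_root\<close>; with real coefficients it makes sense for all vectors.\<close>

definition dominates :: "'a \<Rightarrow> 'a \<Rightarrow> bool" where
  "dominates \<beta> \<gamma> \<longleftrightarrow> (\<forall>i\<in>I0. (\<beta> - \<gamma>) \<bullet> fund_coweight i \<ge> 0)"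

lemma ht_diff: "ht (x - y) = ht x - ht y" by (simp add: ht_def inner_diff_left sum_subtractf)
lemma ht_scale: "ht (c *\<^sub>R x) = c * ht x" by (simp add: ht_def sum_distrib_left)

lemma ht_simple: "i \<in> I0 \<Longrightarrow> ht (\<alpha> i) = 1"
  by (simp add: ht_def simple_coefficient finite_I0)

lemma ht_reflection:
  "i \<in> I0 \<Longrightarrow> ht (aff_reflection (\<alpha> i) 0 \<beta>) = ht \<beta> - 2 * (\<beta> \<bullet> \<alpha> i) / (\<alpha> i \<bullet> \<alpha> i)"
  by (simp add: aff_reflection_def coroot_def ht_diff ht_scale ht_simple)

lemma reflection_lowers:
  assumes "i \<in> I0" "\<beta> \<bullet> \<alpha> i > 0"
  shows "ht (aff_reflection (\<alpha> i) 0 \<beta>) < ht \<beta>"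
  using assms root_nonzero[OF simple_root[OF assms(1)]] by (simp add: ht_reflection)

lemma reflection_raises:
  assumes "i \<in> I0" "\<beta> \<bullet> \<alpha> i < 0"
  shows "ht (aff_reflection (\<alpha> i) 0 \<beta>) > ht \<beta>"
  using assms root_nonzero[OF simple_root[OF assms(1)]] by (simp add: ht_reflection divide_neg_pos)

lemma reflection_dominates:
  assumes "i \<in> I0" "\<beta> \<bullet> \<alpha> i < 0"
  shows "dominates (aff_reflection (\<alpha> i) 0 \<beta>) \<beta>"
proof -
  have "\<beta> \<bullet> \<alpha> i * (2 * (\<alpha> i \<bullet> fund_coweight j)) / (\<alpha> i \<bullet> \<alpha> i) \<le> 0" if "j \<in> I0" for j
    using assms that by (simp add: simple_coefficient divide_le_0_iff)
  then show ?thesis unfolding dominates_def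
    by (simp add: aff_reflection_def coroot_def inner_diff_left mult_ac)
qed

lemma dominates_trans: "dominates x y \<Longrightarrow> dominates y z \<Longrightarrow> dominates x z"
  by (force simp: dominates_def inner_diff_left)

lemma dominates_antisym: "dominates x y \<Longrightarrow> dominates y x \<Longrightarrow> x = y"
  unfolding dominates_def
  by (subst simple_expansion[of x], subst simple_expansion[of y], rule sum.cong)
    (force simp: inner_diff_left)+

lemma dominates_refl: "dominates x x" by (simp add: dominates_def)

lemma dominates_ht: "dominates x y \<Longrightarrow> ht y \<le> ht x"
  unfolding dominates_def ht_def by (intro sum_mono) (simp add: inner_diff_left)

definition split_at :: "nat set \<Rightarrow> 'a \<Rightarrow> 'a" where
  "split_at J x = (\<Sum>i\<in>J. (x \<bullet> fund_coweight i) *\<^sub>R \<alpha> i)"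

lemma split_at_Un: "J \<subseteq> I0 \<Longrightarrow> x = split_at J x + split_at (I0 - J) x"
  using sum.subset_diff[of J I0 "\<lambda>i. (x \<bullet> fund_coweight i) *\<^sub>R \<alpha> i"] finite_I0 simple_expansion[of x]
  by (simp add: split_at_def add.commute)

text \<open>A positive root of minimal height whose support meets both parts is lowered by some simple
  reflection \<open>s\<^sub>i\<close> to a root supported away from the part of \<open>i\<close>. Its component in that part is
  then \<open>c \<alpha>\<^sub>i\<close>, where \<open>c\<close> is also the coefficient \<open>2 c\<close> subtracted by \<open>s\<^sub>i\<close>.\<close>

lemma root_in_part:
  assumes J: "J \<subseteq> I0" and orth: "\<And>i j. i \<in> J \<Longrightarrow> j \<in> I0 - J \<Longrightarrow> \<alpha> i \<bullet> \<alpha> j = 0"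
    and p: "pos \<beta>"
  shows "split_at J \<beta> = 0 \<or> split_at (I0 - J) \<beta> = 0"
proof (rule ccontr)
  let ?M = "{\<beta>. pos \<beta> \<and> split_at J \<beta> \<noteq> 0 \<and> split_at (I0 - J) \<beta> \<noteq> 0}"
  assume "\<not> ?thesis"
  then have ne: "?M \<noteq> {}" using p by auto
  have fin: "finite ?M" by (rule finite_subset[OF _ finite_R]) (auto simp: pos_def)
  obtain g where g: "g \<in> ?M" and gmin: "\<And>x. x \<in> ?M \<Longrightarrow> ht g \<le> ht x"
    using ex_max_if_finite[OF fin ne, of "\<lambda>x. - ht x"] by auto
  have gR: "g \<in> R" and gp: "pos g" using g by (auto simp: pos_def)
  have "g \<bullet> g > 0" using root_nonzero[OF gR] by simp
  \<comment> \<open>\<open>g \<bullet> g\<close> is the sum of these products, so one of them is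
    positive; its second factor is nonnegative because \<open>g\<close> is positive.\<close>
  then have "\<exists>i\<in>I0. (g \<bullet> \<alpha> i) * (g \<bullet> fund_coweight i) > 0"
    unfolding inner_expansion[of g g]
    by (metis (no_types, lifting) not_less sum_nonpos)
  then obtain i where i: "i \<in> I0" "g \<bullet> \<alpha> i > 0"
    using gp by (force simp: pos_def zero_less_mult_iff)
  let ?h = "aff_reflection (\<alpha> i) 0 g"
  have hR: "?h \<in> R" using reflection_root simple_root i gR by blast
  \<comment> \<open>The two parts play symmetric roles, so the contradiction is derived for
    whichever part \<open>K\<close> contains \<open>i\<close>.\<close>
  have key: False if K: "K \<subseteq> I0" "i \<in> K" and orthK: "\<And>i j. i \<in> K \<Longrightarrow> j \<in> I0 - K \<Longrightarrow> \<alpha> i \<bullet> \<alpha> j = 0"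
    and nz: "split_at K g \<noteq> 0" "split_at (I0 - K) g \<noteq> 0"
    and mn: "\<And>x. pos x \<Longrightarrow> split_at K x \<noteq> 0 \<Longrightarrow> split_at (I0 - K) x \<noteq> 0 \<Longrightarrow> ht g \<le> ht x" for K
  proof -
    have other: "split_at (I0 - K) ?h = split_at (I0 - K) g"
      unfolding split_at_def
    proof (rule sum.cong)
      fix j assume "j \<in> I0 - K"
      then have "j \<in> I0" "i \<noteq> j" using K by auto
      then show "(?h \<bullet> fund_coweight j) *\<^sub>R \<alpha> j = (g \<bullet> fund_coweight j) *\<^sub>R \<alpha> j"
        using reflection_coefficient[OF i(1)] by simp
    qed simp
    obtain j where j: "j \<in> I0 - K" "g \<bullet> fund_coweight j \<noteq> 0"
      using nz(2) unfolding split_at_def by (metis (no_types, lifting) scale_zero_left sum.neutral)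
    then have "?h \<bullet> fund_coweight j > 0" using gp K i reflection_coefficient[of i j g] 
      by (force simp: pos_def)
    then have "pos ?h" using posI_coefficient[OF hR] j by blast
    then have "split_at K ?h = 0" using mn[of ?h] reflection_lowers[OF i] other nz(2) by force
    moreover have "?h = g - (2 * (g \<bullet> \<alpha> i) / (\<alpha> i \<bullet> \<alpha> i)) *\<^sub>R \<alpha> i" by (simp add: aff_reflection_def coroot_def)
    moreover have "split_at K (g - c *\<^sub>R \<alpha> i) = split_at K g - c *\<^sub>R \<alpha> i" for c
    proof -
      have "split_at K (c *\<^sub>R \<alpha> i) = (\<Sum>j\<in>K. if j = i then c *\<^sub>R \<alpha> i else 0)"
        unfolding split_at_def using K by (intro sum.cong) (auto simp: simple_coefficient subset_iff)
      also have "\<dots> = c *\<^sub>R \<alpha> i" using K finite_subset[OF K(1) finite_I0] by simp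
      finally show ?thesis
        by (simp add: split_at_def inner_diff_left scaleR_diff_left sum_subtractf)
    qed
    ultimately have 1: "split_at K g = (2 * (g \<bullet> \<alpha> i) / (\<alpha> i \<bullet> \<alpha> i)) *\<^sub>R \<alpha> i" by simp
    have "split_at (I0 - K) g \<bullet> \<alpha> i = 0"
      unfolding split_at_def inner_sum_left using orthK[OF K(2)] by (intro sum.neutral) (auto simp: inner_commute)
    then have "g \<bullet> \<alpha> i = split_at K g \<bullet> \<alpha> i" using split_at_Un[OF K(1), of g] by (metis add.right_neutral inner_add_left)
    \<comment> \<open>Pairing the formula for the component with \<open>\<alpha> i\<close> doubles
      \<open>g \<bullet> \<alpha> i\<close>, which is positive.\<close>
    then show False using 1 i root_nonzero[OF simple_root[OF i(1)]] by (simp add: inner_commute)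
  qed
  show False
  proof (cases "i \<in> J")
    case True
    show False using g gmin orth by (intro key[OF J True]) auto
  next
    case False
    have "I0 - (I0 - J) = J" using J by auto
    moreover have "\<alpha> a \<bullet> \<alpha> b = 0" if "a \<in> I0 - J" "b \<in> J" for a b
      using orth[OF that(2,1)] by (simp add: inner_commute)
    ultimately show False using g gmin False i by (intro key[of "I0 - J"]) auto
  qed
qed

text \<open>For a negative dominant root every term in the expansion of its squared length would be
  nonpositive.\<close>

lemma dominant_root_positive:
  assumes "\<theta> \<in> R" "\<And>i. i \<in> I0 \<Longrightarrow> \<theta> \<bullet> \<alpha> i \<ge> 0"
  shows "pos \<theta>"
proof (rule ccontr)
  assume "\<not> pos \<theta>"
  then have "pos (- \<theta>)" using root_cases assms by blast
  then have "\<theta> \<bullet> \<theta> \<le> 0" unfolding inner_expansion[of \<theta> \<theta>]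
    using assms(2) by (intro sum_nonpos) (simp add: pos_def mult_nonneg_nonpos)
  then show False using root_nonzero[OF assms(1)] by (simp add: inner_gt_zero_iff[symmetric] not_less[symmetric] del: inner_gt_zero_iff)
qed

text \<open>Let \<open>J\<close> be the support. For \<open>b\<close> outside \<open>J\<close> the
  inner product of \<theta> with \<open>\<alpha> b\<close> is a sum of nonpositive terms, yet
  dominance makes it nonnegative, so every term vanishes and \<open>\<alpha> b\<close> is orthogonal
  to the simple roots of \<open>J\<close>. By \<open>root_in_part\<close> this splits
  \<open>R\<close> into two nonempty orthogonal parts, against irreducibility.\<close>

lemma dominant_root_full_support:
  assumes "\<theta> \<in> R" and dom: "\<And>i. i \<in> I0 \<Longrightarrow> \<theta> \<bullet> \<alpha> i \<ge> 0"
    and i: "i \<in> I0"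
  shows "\<theta> \<bullet> fund_coweight i > 0"
proof (rule ccontr)
  have p: "pos \<theta>" by (rule dominant_root_positive) fact+
  assume "\<not> ?thesis"
  define J where "J = {i\<in>I0. \<theta> \<bullet> fund_coweight i > 0}"
  have JI: "J \<subseteq> I0" and iJ: "i \<in> I0 - J" using \<open>\<not> _\<close> i by (auto simp: J_def)
  have z: "\<theta> \<bullet> fund_coweight k = 0" if "k \<in> I0 - J" for k
    using that p by (force simp: J_def pos_def)
  have orth: "\<alpha> a \<bullet> \<alpha> b = 0" if a: "a \<in> J" and b: "b \<in> I0 - J" for a b
  proof -
    have eq: "\<theta> \<bullet> \<alpha> b = (\<Sum>k\<in>I0. (\<alpha> b \<bullet> \<alpha> k) * (\<theta> \<bullet> fund_coweight k))"
      using inner_expansion[of "\<alpha> b" \<theta>] by (simp add: inner_commute)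
    have le: "(\<alpha> b \<bullet> \<alpha> k) * (\<theta> \<bullet> fund_coweight k) \<le> 0" if k: "k \<in> I0" for k
    proof (cases "k \<in> J")
      case True
      then have "\<alpha> b \<bullet> \<alpha> k \<le> 0" using simple_inner_nonpos[of b k] b k by auto
      then show ?thesis using True by (simp add: J_def mult_nonpos_nonneg)
    qed (use z k in auto)
    have "(\<Sum>k\<in>I0. - ((\<alpha> b \<bullet> \<alpha> k) * (\<theta> \<bullet> fund_coweight k))) = 0"
    proof (rule antisym)
      show "(\<Sum>k\<in>I0. - ((\<alpha> b \<bullet> \<alpha> k) * (\<theta> \<bullet> fund_coweight k))) \<le> 0"
        using dom[of b] b eq by (simp add: sum_negf)
      show "0 \<le> (\<Sum>k\<in>I0. - ((\<alpha> b \<bullet> \<alpha> k) * (\<theta> \<bullet> fund_coweight k)))"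
        using le by (intro sum_nonneg) force
    qed
    then have "\<forall>k\<in>I0. - ((\<alpha> b \<bullet> \<alpha> k) * (\<theta> \<bullet> fund_coweight k)) = 0"
      using le finite_I0 by (subst (asm) sum_nonneg_eq_0_iff) auto
    then have "(\<alpha> b \<bullet> \<alpha> a) * (\<theta> \<bullet> fund_coweight a) = 0" using a JI by auto
    then show ?thesis using a by (auto simp: J_def inner_commute)
  qed
  define A where "A = {\<beta>\<in>R. split_at (I0 - J) \<beta> = 0}"
  define B where "B = {\<beta>\<in>R. split_at J \<beta> = 0}"
  have minus: "split_at K (- x) = - split_at K x" for K x by (simp add: split_at_def sum_negf)
  have "split_at J \<beta> = 0 \<or> split_at (I0 - J) \<beta> = 0" if "\<beta> \<in> R" for \<beta>
    using root_cases[OF that] root_in_part[OF JI orth, of \<beta>] root_in_part[OF JI orth, of "- \<beta>"]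
    by (auto simp: minus)
  then have "A \<union> B = R" by (auto simp: A_def B_def)
  moreover have "A \<inter> B = {}"
  proof -
    have "x = 0" if "x \<in> A" "x \<in> B" for x
      using that split_at_Un[OF JI, of x] by (simp add: A_def B_def)
    then show ?thesis using zero_notin_R by (auto simp: A_def)
  qed
  moreover have "\<theta> \<in> A" using assms(1) z by (simp add: A_def split_at_def)
  moreover have "\<alpha> i \<in> B" using iJ simple_root JI
    by (auto simp: B_def split_at_def simple_coefficient subset_iff intro!: sum.neutral)
  moreover have "a \<bullet> b = 0" if "a \<in> A" "b \<in> B" for a b
  proof -
    have "a = split_at J a" "b = split_at (I0 - J) b"
      using that split_at_Un[OF JI, of a] split_at_Un[OF JI, of b] by (simp_all add: A_def B_def)
    then have "a \<bullet> b = split_at J a \<bullet> split_at (I0 - J) b" by metis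
    also have "\<dots> = 0" unfolding split_at_def inner_sum_left inner_sum_right
      using orth by (intro sum.neutral ballI) auto
    finally show ?thesis .
  qed
  moreover have "\<not> (\<exists>A B. A \<noteq> {} \<and> B \<noteq> {} \<and> A \<inter> B = {} \<and> A \<union> B = R \<and>
            (\<forall>a\<in>A. \<forall>b\<in>B. a \<bullet> b = 0))"
    using irreducible by (simp add: irreducible_root_system_def)
  ultimately show False by (metis empty_iff)
qed

text \<open>If one of the integers \<open>m\<close>, \<open>n\<close> is 1, a reflection shows that
  the difference is a root up to sign, and its coefficients have one sign. Otherwise
  \<open>m * n\<close> is at least 4, which is equality in the Cauchy-Schwarz inequality; the roots
  are then positive multiples of each other.\<close>

lemma comparable_roots:
  assumes "\<beta> \<in> R" "\<gamma> \<in> R" "\<beta> \<bullet> \<gamma> > 0"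
  shows "dominates \<beta> \<gamma> \<or> dominates \<gamma> \<beta>"
proof -
  have sub: "dominates \<beta> \<gamma> \<or> dominates \<gamma> \<beta>" if "\<beta> - \<gamma> \<in> R" for \<beta> \<gamma>
    using root_coefficients(2)[OF that] by (force simp: dominates_def inner_diff_left)
  define m where "m = \<beta> \<bullet> coroot \<gamma>"
  define n where "n = \<gamma> \<bullet> coroot \<beta>"
  have nz: "\<beta> \<bullet> \<beta> > 0" "\<gamma> \<bullet> \<gamma> > 0" using assms root_nonzero by auto
  have mn: "m \<in> \<int>" "n \<in> \<int>" using integrality assms by (auto simp: m_def n_def)
  have mp: "m > 0" "n > 0" using assms nz by (auto simp: m_def n_def coroot_def inner_commute)
  have m1: "m \<ge> 1" "n \<ge> 1" using mn mp by (auto elim!: Ints_cases)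
  show ?thesis
  proof (cases "m = 1 \<or> n = 1")
    case True
    then show ?thesis
    proof
      assume "m = 1"
      moreover have "(\<beta> \<bullet> \<gamma> - of_int 0) *\<^sub>R coroot \<gamma> = m *\<^sub>R \<gamma>"
        by (simp add: m_def coroot_def mult.commute)
      ultimately have "aff_reflection \<gamma> 0 \<beta> = \<beta> - \<gamma>"
        by (simp add: aff_reflection_def)
      then show ?thesis using reflection_root[OF assms(2,1)] sub by metis
    next
      assume "n = 1"
      moreover have "(\<gamma> \<bullet> \<beta> - of_int 0) *\<^sub>R coroot \<beta> = n *\<^sub>R \<beta>"
        by (simp add: n_def coroot_def mult.commute)
      ultimately have "aff_reflection \<beta> 0 \<gamma> = \<gamma> - \<beta>"
        by (simp add: aff_reflection_def)
      then show ?thesis using reflection_root[OF assms(1,2)] sub by metis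
    qed
  next
    case False
    then have "m \<ge> 2" "n \<ge> 2" using mn m1 by (auto elim!: Ints_cases)
    then have "m * n \<ge> 4" using mult_mono[of 2 m 2 n] by simp
    moreover have "m * n = 4 * (\<beta> \<bullet> \<gamma>)\<^sup>2 / ((\<beta> \<bullet> \<beta>) * (\<gamma> \<bullet> \<gamma>))"
      by (simp add: m_def n_def coroot_def inner_commute power2_eq_square)
    ultimately have "(\<beta> \<bullet> \<gamma>)\<^sup>2 \<ge> (\<beta> \<bullet> \<beta>) * (\<gamma> \<bullet> \<gamma>)" using nz by (simp add: divide_simps mult_ac split: if_splits)
    then have "(\<beta> \<bullet> \<gamma>)\<^sup>2 = (norm \<beta> * norm \<gamma>)\<^sup>2" using Cauchy_Schwarz_ineq[of \<beta> \<gamma>]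
      by (simp add: power_mult_distrib dot_square_norm)
    then have "\<beta> \<bullet> \<gamma> = norm \<beta> * norm \<gamma>" using assms(3) by (simp add: power2_eq_iff_nonneg)
    then have "norm \<beta> *\<^sub>R \<gamma> = norm \<gamma> *\<^sub>R \<beta>" using norm_cauchy_schwarz_eq by blast
    then have g: "\<gamma> = (norm \<gamma> / norm \<beta>) *\<^sub>R \<beta>" using root_nonzero[OF assms(1)]
      by (metis divide_inverse_commute left_inverse norm_eq_zero scaleR_one scaleR_scaleR)
    define t where "t = norm \<gamma> / norm \<beta>"
    have g: "\<gamma> = t *\<^sub>R \<beta>" using g by (simp add: t_def)
    have "(\<forall>i\<in>I0. (1 - t) * (\<beta> \<bullet> fund_coweight i) \<ge> 0) \<or> (\<forall>i\<in>I0. (1 - t) * (\<beta> \<bullet> fund_coweight i) \<le> 0)"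
      using root_coefficients(2)[OF assms(1)] by (smt (verit) mult_nonneg_nonneg mult_nonneg_nonpos mult_nonpos_nonneg mult_nonpos_nonpos)
    then show ?thesis unfolding dominates_def g by (force simp: inner_diff_left algebra_simps)
  qed
qed

text \<open>A root maximal for dominance is dominant, since a simple reflection would raise it
  otherwise, and hence has full support. Two maximal roots have positive inner product, because one
  is dominant and nonzero and the other has full support. So they are comparable and coincide, and
  the maximal root above any given root is always the same.\<close>

lemma highest_root_exists:
  "\<exists>\<theta>\<in>R. (\<forall>\<gamma>\<in>R. dominates \<theta> \<gamma>) \<and> (\<forall>i\<in>I0. \<theta> \<bullet> fund_coweight i > 0)"
proof -
  have maxi: "\<exists>\<theta>\<in>R. dominates \<theta> \<gamma> \<and> (\<forall>i\<in>I0. \<theta> \<bullet> \<alpha> i \<ge> 0) \<and> (\<forall>\<beta>\<in>R. dominates \<beta> \<theta> \<longrightarrow> \<beta> = \<theta>)"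
    if "\<gamma> \<in> R" for \<gamma>
  proof -
    let ?M = "{\<beta>\<in>R. dominates \<beta> \<gamma>}"
    have "finite ?M" "?M \<noteq> {}" using finite_R that dominates_refl by auto
    then obtain \<theta> where t: "\<theta> \<in> ?M" "\<And>x. x \<in> ?M \<Longrightarrow> ht x \<le> ht \<theta>"
      using ex_max_if_finite[of ?M ht] by blast
    have up: "\<beta> \<in> ?M" if "\<beta> \<in> R" "dominates \<beta> \<theta>" for \<beta> using that t dominates_trans by blast
    have "\<theta> \<bullet> \<alpha> i \<ge> 0" if i: "i \<in> I0" for i
    proof (rule ccontr)
      assume "\<not> ?thesis"
      then have n: "\<theta> \<bullet> \<alpha> i < 0" by simp
      have "\<theta> \<in> R" using t(1) by simp
      then have "aff_reflection (\<alpha> i) 0 \<theta> \<in> ?M"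
        by (intro up reflection_dominates[OF i n] reflection_root[OF simple_root[OF i]])
      from t(2)[OF this] show False using reflection_raises[OF i n] by simp
    qed
    moreover have "\<beta> = \<theta>" if b: "\<beta> \<in> R" "dominates \<beta> \<theta>" for \<beta>
    proof -
      have "ht \<beta> \<le> ht \<theta>" by (intro t(2) up b)
      then have "(\<Sum>i\<in>I0. (\<beta> - \<theta>) \<bullet> fund_coweight i) = 0"
        using dominates_ht[OF b(2)] by (simp add: ht_def inner_diff_left sum_subtractf)
      then have "\<forall>i\<in>I0. (\<beta> - \<theta>) \<bullet> fund_coweight i = 0"
        using b(2) finite_I0 unfolding dominates_def by (subst (asm) sum_nonneg_eq_0_iff) auto
      then have "dominates \<theta> \<beta>" by (auto simp: dominates_def inner_diff_left)
      then show ?thesis using b(2) dominates_antisym by blast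
    qed
    ultimately show ?thesis using t(1) by (intro bexI[of _ \<theta>] conjI ballI impI) simp_all
  qed
  obtain i where "i \<in> I0" using I0_nonempty by blast
  then have "\<alpha> i \<in> R" by (rule simple_root)
  from maxi[OF this] obtain \<theta> where t: "\<theta> \<in> R" "\<And>i. i \<in> I0 \<Longrightarrow> \<theta> \<bullet> \<alpha> i \<ge> 0"
    "\<And>\<beta>. \<beta> \<in> R \<Longrightarrow> dominates \<beta> \<theta> \<Longrightarrow> \<beta> = \<theta>"
    by auto
  have full: "\<theta> \<bullet> fund_coweight i > 0" if "i \<in> I0" for i
    by (rule dominant_root_full_support) (use t that in auto)
  have "dominates \<theta> \<gamma>" if g: "\<gamma> \<in> R" for \<gamma>
  proof -
    from maxi[OF g] obtain \<eta> where e: "\<eta> \<in> R" "dominates \<eta> \<gamma>" "\<And>i. i \<in> I0 \<Longrightarrow> \<eta> \<bullet> \<alpha> i \<ge> 0"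
      "\<And>\<beta>. \<beta> \<in> R \<Longrightarrow> dominates \<beta> \<eta> \<Longrightarrow> \<beta> = \<eta>"
      by auto
    have "\<exists>i\<in>I0. \<eta> \<bullet> \<alpha> i \<noteq> 0" using eq_if_inner_simple[of \<eta> 0] root_nonzero[OF e(1)] by auto
    then obtain i where i: "i \<in> I0" "\<eta> \<bullet> \<alpha> i > 0" using e(3) by force
    have "\<eta> \<bullet> \<theta> > 0" unfolding inner_expansion[of \<eta> \<theta>]
      using i full e(3) finite_I0
      by (intro sum_pos2[of _ i] mult_pos_pos mult_nonneg_nonneg) (auto intro: less_imp_le)
    then have "\<eta> = \<theta>" using comparable_roots[OF e(1) t(1)] t(3)[OF e(1)] e(4)[OF t(1)] by auto
    then show ?thesis using e(2) by simp
  qed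
  then show ?thesis using t(1) full by (intro bexI[of _ \<theta>] conjI ballI) simp_all
qed

lemma highest_root_in_R: "highest_root \<in> R"
  and highest_root_dominates: "\<And>\<gamma>. \<gamma> \<in> R \<Longrightarrow> dominates highest_root \<gamma>"
proof -
  let ?Q = "\<lambda>\<beta>. \<beta> \<in> R \<and> (\<forall>\<gamma>\<in>R. \<exists>k::nat \<Rightarrow> nat. \<beta> - \<gamma> = (\<Sum>i\<in>I0. of_nat (k i) *\<^sub>R \<alpha> i))"
  have domI: "dominates \<beta> \<gamma>" if "\<beta> - \<gamma> = (\<Sum>i\<in>I0. of_nat (k i) *\<^sub>R \<alpha> i)" for \<beta> \<gamma> and k :: "nat \<Rightarrow> nat"
    unfolding dominates_def that
    by (simp add: inner_sum_left simple_coefficient finite_I0 if_distrib[of "\<lambda>z. _ * z"] cong: if_cong)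
  obtain \<theta> where t: "\<theta> \<in> R" "\<And>\<gamma>. \<gamma> \<in> R \<Longrightarrow> dominates \<theta> \<gamma>" using highest_root_exists by blast
  have "?Q \<theta>"
  proof (intro conjI ballI)
    fix \<gamma> assume g: "\<gamma> \<in> R"
    \<comment> \<open>The coefficients of the difference are nonnegative integers, so the floor
      loses nothing.\<close>
    define k where "k i = nat \<lfloor>(\<theta> - \<gamma>) \<bullet> fund_coweight i\<rfloor>" for i
    have "real (k i) = (\<theta> - \<gamma>) \<bullet> fund_coweight i" if i: "i \<in> I0" for i
    proof -
      have "(\<theta> - \<gamma>) \<bullet> fund_coweight i \<in> \<int>" "(\<theta> - \<gamma>) \<bullet> fund_coweight i \<ge> 0"
        using root_coefficients(1)[OF t(1) i] root_coefficients(1)[OF g i] t(2)[OF g] i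
        by (auto simp: inner_diff_left dominates_def)
      then show ?thesis by (auto simp: k_def elim!: Ints_cases)
    qed
    then show "\<exists>k::nat \<Rightarrow> nat. \<theta> - \<gamma> = (\<Sum>i\<in>I0. of_nat (k i) *\<^sub>R \<alpha> i)"
      by (intro exI[of _ k], subst simple_expansion) (auto intro!: sum.cong)
  qed (fact t)
  moreover have "\<beta> = \<theta>" if "?Q \<beta>" for \<beta>
  proof (rule dominates_antisym)
    have "\<exists>k::nat \<Rightarrow> nat. \<beta> - \<theta> = (\<Sum>i\<in>I0. of_nat (k i) *\<^sub>R \<alpha> i)"
      using that t(1) by blast
    then show "dominates \<beta> \<theta>" using domI by (elim exE)
    show "dominates \<theta> \<beta>" using that by (intro t(2)) simp
  qed
  ultimately have q: "?Q highest_root" unfolding highest_root_def by (rule theI)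
  then show "highest_root \<in> R" by blast
  show "dominates highest_root \<gamma>" if "\<gamma> \<in> R" for \<gamma>
  proof -
    have "\<exists>k::nat \<Rightarrow> nat. highest_root - \<gamma> = (\<Sum>i\<in>I0. of_nat (k i) *\<^sub>R \<alpha> i)"
      using that q by blast
    then show ?thesis using domI by (elim exE)
  qed
qed

section \<open>Marks, and the pairing of positive roots with the highest root\<close>

lemma highest_root_coefficient: "i \<in> I0 \<Longrightarrow> highest_root \<bullet> fund_coweight i > 0"
proof -
  assume i: "i \<in> I0"
  obtain \<theta> where t: "\<theta> \<in> R" "\<And>\<gamma>. \<gamma> \<in> R \<Longrightarrow> dominates \<theta> \<gamma>"
    "\<And>i. i \<in> I0 \<Longrightarrow> \<theta> \<bullet> fund_coweight i > 0"
    using highest_root_exists by blast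
  have "\<theta> = highest_root"
    using t highest_root_in_R highest_root_dominates by (intro dominates_antisym) simp_all
  then show ?thesis using t(3) i by simp
qed

lemma mark_inner: "i \<in> I0 \<Longrightarrow> mark i = highest_root \<bullet> fund_coweight i"
proof -
  assume i: "i \<in> I0"
  have ind: "independent (\<alpha> ` I0)" and inj: "inj_on \<alpha> I0"
    using base by (auto simp: root_base_def I0_def)
  let ?r = "representation (\<alpha> ` I0) highest_root"
  have "highest_root = (\<Sum>b\<in>\<alpha> ` I0. ?r b *\<^sub>R b)"
    using sum_representation_eq[OF ind, of highest_root "\<alpha> ` I0"] span_simple finite_I0 by simp
  also have "\<dots> = (\<Sum>j\<in>I0. ?r (\<alpha> j) *\<^sub>R \<alpha> j)" by (simp add: sum.reindex[OF inj])
  finally have "highest_root \<bullet> fund_coweight i = (\<Sum>j\<in>I0. ?r (\<alpha> j) *\<^sub>R \<alpha> j) \<bullet> fund_coweight i" by simp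
  also have "\<dots> = ?r (\<alpha> i)" using i
    by (simp add: inner_sum_left simple_coefficient finite_I0 if_distrib[of "\<lambda>z. _ * z"] cong: if_cong)
  finally show ?thesis using i by (auto simp: mark_def)
qed

lemma mark_pos: "i \<in> I \<Longrightarrow> mark i > 0"
  using mark_inner[of i] highest_root_coefficient[of i] by (cases "i = 0") (simp_all add: mark_def I_def)

text \<open>With \<open>n\<close> the pairing, the reflected root is \<beta> minus \<open>n\<close>
  times the highest root. If \<open>n\<close> is at most -1 it exceeds the highest root in some
  coefficient; if \<open>n\<close> is at least 2, dominance over its negative forces \<beta> to
  dominate the highest root. This is what lets the reflection \<open>s 0\<close> cross a single
  hyperplane in \<open>seps_s\<close>.\<close>

lemma coroot_highest_root:
  assumes "pos \<beta>" "\<beta> \<noteq> highest_root"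
  shows "\<beta> \<bullet> coroot highest_root = 0 \<or>
    \<beta> \<bullet> coroot highest_root = 1 \<and> pos (highest_root - \<beta>)"
proof -
  let ?t = highest_root
  define n where "n = \<beta> \<bullet> coroot ?t"
  have b: "\<beta> \<in> R" using assms by (simp add: pos_def)
  have tz: "?t \<bullet> ?t > 0" using root_nonzero[OF highest_root_in_R] by simp
  have nZ: "n \<in> \<int>" using integrality[OF highest_root_in_R b] by (simp add: n_def)
  have r: "aff_reflection ?t 0 \<beta> = \<beta> - n *\<^sub>R ?t"
    by (simp add: aff_reflection_def n_def coroot_def mult.commute)
  have rR: "\<beta> - n *\<^sub>R ?t \<in> R" using reflection_root[OF highest_root_in_R b] r by simp
  obtain i where i: "i \<in> I0" using I0_nonempty by blast
  let ?b = "\<lambda>i. \<beta> \<bullet> fund_coweight i" and ?c = "\<lambda>i. ?t \<bullet> fund_coweight i"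
  have "n \<ge> 0"
  proof (rule ccontr)
    assume "\<not> ?thesis"
    then have n1: "n \<le> -1" using nZ by (auto elim!: Ints_cases)
    obtain j where j: "j \<in> I0" "?b j > 0" using pos_coefficient assms(1) by blast
    have "?b j - n * ?c j \<le> ?c j" using highest_root_dominates[OF rR] j by (auto simp: dominates_def inner_diff_left)
    moreover have "- n * ?c j \<ge> 1 * ?c j" using n1 highest_root_coefficient[OF j(1)] by (intro mult_right_mono) auto
    ultimately show False using j by simp
  qed
  moreover have "n \<le> 1"
  proof (rule ccontr)
    assume "\<not> ?thesis"
    then have n1: "n \<ge> 2" using nZ by (auto elim!: Ints_cases)
    have "?b j \<ge> ?c j" if j: "j \<in> I0" for j
    proof -
      have "n * ?c j - ?b j \<le> ?c j" using highest_root_dominates[OF uminus_root[OF rR]] j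
        by (auto simp: dominates_def inner_diff_left)
      moreover have "n * ?c j \<ge> 2 * ?c j" using n1 highest_root_coefficient[OF j(1)] by (intro mult_right_mono) auto
      ultimately show ?thesis by simp
    qed
    then have "dominates \<beta> ?t" by (simp add: dominates_def inner_diff_left)
    then show False using highest_root_dominates[OF b] dominates_antisym assms(2) by blast
  qed
  ultimately have "n = 0 \<or> n = 1" using nZ by (auto elim!: Ints_cases)
  moreover have "pos (?t - \<beta>)" if "n = 1"
    using uminus_root[OF rR] that highest_root_dominates[OF b] by (auto simp: pos_def dominates_def)
  ultimately show ?thesis unfolding n_def by blast
qed

end

section \<open>The affine Weyl group acting on alcoves\<close>

lemma separating_hyperplane_iff:
  "x \<notin> hyperplane \<beta> k \<and> y \<notin> hyperplane \<beta> k \<and> hyperplane \<beta> k \<inter> closed_segment x y \<noteq> {} \<longleftrightarrow>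
     (x \<bullet> \<beta> - of_int k) * (y \<bullet> \<beta> - of_int k) < 0" (is "?L \<longleftrightarrow> ?a * ?b < 0")
proof
  have comb: "((1 - u) *\<^sub>R x + u *\<^sub>R y) \<bullet> \<beta> - of_int k = (1 - u) * ?a + u * ?b" for u :: real
    by (simp add: inner_add_left algebra_simps)
  show "?a * ?b < 0" if L: ?L
  proof -
    have nz: "?a \<noteq> 0" "?b \<noteq> 0" using L by (auto simp: hyperplane_def)
    obtain u where u: "0 \<le> u" "u \<le> 1" "((1 - u) *\<^sub>R x + u *\<^sub>R y) \<bullet> \<beta> = of_int k"
      using L by (auto simp: closed_segment_def hyperplane_def)
    have u: "0 \<le> u" "u \<le> 1" "(1 - u) * ?a + u * ?b = 0" using u comb[of u] by auto
    show ?thesis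
    proof (rule ccontr)
      assume "\<not> ?thesis"
      then have "?a > 0 \<and> ?b > 0 \<or> ?a < 0 \<and> ?b < 0"
        using nz by (auto simp: mult_less_0_iff)
      moreover have "u = 0 \<or> u > 0" using u by auto
      ultimately show False using u nz
        by (smt (verit) mult_nonneg_nonneg mult_pos_pos mult_pos_neg mult_nonneg_nonpos)
    qed
  qed
  show ?L if ab: "?a * ?b < 0"
  proof -
    have d: "?a - ?b \<noteq> 0" using ab by (auto simp: mult_less_0_iff)
    \<comment> \<open>The zero of the affine function with values \<open>?a\<close> and
      \<open>?b\<close> at the two ends of the segment.\<close>
    define u where "u = ?a / (?a - ?b)"
    have "0 \<le> u" "u \<le> 1" using ab by (auto simp: u_def mult_less_0_iff divide_simps)
    moreover have "(1 - u) * ?a + u * ?b = ?a - u * (?a - ?b)" by (simp add: algebra_simps)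
    then have "(1 - u) * ?a + u * ?b = 0" using d by (simp add: u_def)
    ultimately have "(1 - u) *\<^sub>R x + u *\<^sub>R y \<in> hyperplane \<beta> k \<inter> closed_segment x y"
      using comb[of u] by (auto simp: closed_segment_def hyperplane_def)
    then show ?L using ab by (auto simp: hyperplane_def)
  qed
qed

lemma no_integer_between_fractions:
  fixes a b :: real
  assumes "0 < a" "a < 1" "0 < b" "b < 1"
  shows "\<not> (a - of_int k) * (b - of_int k) < 0"
proof (cases "k \<le> 0")
  case True then have "of_int k \<le> (0::real)" by simp
  then show ?thesis using assms by (simp add: mult_less_0_iff)
next
  case False then have "of_int k \<ge> (1::real)" by simp
  then show ?thesis using assms by (auto simp: mult_less_0_iff)
qed

lemma hyperplane_uminus: "hyperplane (- \<beta>) (- k) = hyperplane \<beta> k"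
  by (simp add: hyperplane_def)

text \<open>One hyperplane can come from several pairs of root and level, by a change of sign or
  from proportional roots in a nonreduced system. The normals are proportional, and the reflection
  depends only on the plane.\<close>

lemma hyperplane_eq_reflection_eq:
  assumes "\<beta> \<noteq> 0" "\<gamma> \<noteq> 0" "hyperplane \<beta> k = hyperplane \<gamma> m"
  shows "aff_reflection \<beta> k = aff_reflection \<gamma> m"
proof -
  \<comment> \<open>The foot of the perpendicular from the origin to the hyperplane.\<close>
  define p where "p = (of_int k / (\<beta> \<bullet> \<beta>)) *\<^sub>R \<beta>"
  have pb: "p \<bullet> \<beta> = of_int k" using assms by (simp add: p_def)
  then have pg: "p \<bullet> \<gamma> = of_int m" using assms(3) by (auto simp: hyperplane_def)
  define t where "t = (\<gamma> \<bullet> \<beta>) / (\<beta> \<bullet> \<beta>)"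
  have orth: "v \<bullet> \<gamma> = 0" if "v \<bullet> \<beta> = 0" for v
  proof -
    have "p + v \<in> hyperplane \<beta> k" using pb that by (simp add: hyperplane_def inner_add_left)
    then have "p + v \<in> hyperplane \<gamma> m" using assms(3) by simp
    then show ?thesis using pg by (simp add: hyperplane_def inner_add_left)
  qed
  define d where "d = \<gamma> - t *\<^sub>R \<beta>"
  have db: "d \<bullet> \<beta> = 0" using assms(1) by (simp add: d_def t_def inner_diff_left)
  have "d \<bullet> d = d \<bullet> \<gamma> - t * (d \<bullet> \<beta>)" by (simp add: d_def inner_diff_right)
  then have "d = 0" using orth[OF db] db by simp
  then have g: "\<gamma> = t *\<^sub>R \<beta>" by (simp add: d_def)
  then have "t \<noteq> 0" using assms(2) by auto
  show ?thesis
  proof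
    fix x
    have "x \<bullet> \<beta> - of_int k = (x - p) \<bullet> \<beta>" "x \<bullet> \<gamma> - of_int m = (x - p) \<bullet> \<gamma>"
      using pb pg by (simp_all add: inner_diff_left)
    then show "aff_reflection \<beta> k x = aff_reflection \<gamma> m x"
      using \<open>t \<noteq> 0\<close> assms(1) by (simp add: aff_reflection_def g coroot_def)
  qed
qed

section \<open>Hyperplanes separating two points, and isometries of the arrangement\<close>

context root_datum
begin

text \<open>Collected as sets of points, so that proportional roots with a common hyperplane count
  once when \<open>card\<close> of \<open>seps\<close> becomes the length function.\<close>

definition hyperplanes :: "'a set set" where
  "hyperplanes = {hyperplane \<beta> k | \<beta> k. \<beta> \<in> R}"

definition regular_points :: "'a set" where
  "regular_points = UNIV - \<Union>hyperplanes"

definition seps :: "'a \<Rightarrow> 'a \<Rightarrow> 'a set set" where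
  "seps x y = {H\<in>hyperplanes. x \<notin> H \<and> y \<notin> H \<and> H \<inter> closed_segment x y \<noteq> {}}"

lemma hyperplanesE:
  assumes "H \<in> hyperplanes"
  obtains \<beta> k where "\<beta> \<in> R" "H = hyperplane \<beta> k"
  using assms by (auto simp: hyperplanes_def)

lemma hyperplanesE_pos:
  assumes "H \<in> hyperplanes"
  obtains \<beta> k where "pos \<beta>" "H = hyperplane \<beta> k"
proof -
  obtain \<beta> k where b: "\<beta> \<in> R" "H = hyperplane \<beta> k" using assms by (rule hyperplanesE)
  show ?thesis
  proof (cases "pos \<beta>")
    case True then show ?thesis using that b by blast
  next
    case False
    then have "pos (- \<beta>)" using root_cases b by blast
    then show ?thesis using that[of "- \<beta>" "- k"] b by (simp add: hyperplane_uminus)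
  qed
qed

lemma hyperplane_in_hyperplanes: "\<beta> \<in> R \<Longrightarrow> hyperplane \<beta> k \<in> hyperplanes"
  by (auto simp: hyperplanes_def)

lemma seps_iff:
  "\<beta> \<in> R \<Longrightarrow> hyperplane \<beta> k \<in> seps x y \<longleftrightarrow> (x \<bullet> \<beta> - of_int k) * (y \<bullet> \<beta> - of_int k) < 0"
  unfolding seps_def using separating_hyperplane_iff[of x \<beta> k y] hyperplane_in_hyperplanes by blast

lemma seps_subset: "seps x y \<subseteq> hyperplanes" by (auto simp: seps_def)

lemma regular_iff: "x \<in> regular_points \<longleftrightarrow> (\<forall>\<beta>\<in>R. \<forall>k. x \<bullet> \<beta> \<noteq> of_int k)"
  by (auto simp: regular_points_def hyperplanes_def hyperplane_def)

lemma finite_seps: "finite (seps x y)"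
proof -
  have "seps x y \<subseteq> (\<Union>\<beta>\<in>R. hyperplane \<beta> ` {\<lfloor>min (x \<bullet> \<beta>) (y \<bullet> \<beta>)\<rfloor>..\<lceil>max (x \<bullet> \<beta>) (y \<bullet> \<beta>)\<rceil>})"
  proof
    fix H assume H: "H \<in> seps x y"
    then obtain \<beta> k where b: "\<beta> \<in> R" "H = hyperplane \<beta> k" using seps_subset by (blast elim: hyperplanesE)
    then have "(x \<bullet> \<beta> - of_int k) * (y \<bullet> \<beta> - of_int k) < 0" using H seps_iff by simp
    then have "k \<in> {\<lfloor>min (x \<bullet> \<beta>) (y \<bullet> \<beta>)\<rfloor>..\<lceil>max (x \<bullet> \<beta>) (y \<bullet> \<beta>)\<rceil>}"
      by (auto simp: mult_less_0_iff floor_le_iff le_ceiling_iff min_def max_def)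
    then show "H \<in> (\<Union>\<beta>\<in>R. hyperplane \<beta> ` {\<lfloor>min (x \<bullet> \<beta>) (y \<bullet> \<beta>)\<rfloor>..\<lceil>max (x \<bullet> \<beta>) (y \<bullet> \<beta>)\<rceil>})"
      using b by blast
  qed
  then show ?thesis by (rule finite_subset) (simp add: finite_R)
qed

text \<open>A regular point lies strictly on one side of each hyperplane, so a hyperplane separates
  the outer two points exactly when it separates one of the two intermediate pairs and not the
  other.\<close>

lemma seps_triangle:
  assumes "x \<in> regular_points" "y \<in> regular_points" "z \<in> regular_points"
  shows "seps x z = (seps x y - seps y z) \<union> (seps y z - seps x y)"
proof -
  have "H \<in> seps x z \<longleftrightarrow> (H \<in> seps x y \<longleftrightarrow> H \<notin> seps y z)" if H: "H \<in> hyperplanes" for H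
  proof -
    obtain \<beta> k where b: "\<beta> \<in> R" "H = hyperplane \<beta> k" using H by (rule hyperplanesE)
    have "x \<bullet> \<beta> \<noteq> of_int k" "y \<bullet> \<beta> \<noteq> of_int k" "z \<bullet> \<beta> \<noteq> of_int k"
      using assms b by (auto simp: regular_iff)
    then show ?thesis unfolding b(2) seps_iff[OF b(1)] by (auto simp: mult_less_0_iff)
  qed
  then show ?thesis using seps_subset by blast
qed

text \<open>A group of isometries preserving the hyperplane arrangement, large enough to contain both the
  extended affine Weyl group and \<open>-1\<close>.\<close>

definition aff_auts :: "('a \<Rightarrow> 'a) set" where
  "aff_auts = {f. \<exists>A b. linear A \<and> (\<forall>x y. A x \<bullet> A y = x \<bullet> y) \<and> A ` R = R \<and>
     (\<forall>\<beta>\<in>R. b \<bullet> \<beta> \<in> \<int>) \<and> f = (\<lambda>x. A x + b)}"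

lemma aff_autsE:
  assumes "f \<in> aff_auts"
  obtains A b where "linear A" "\<And>x y. A x \<bullet> A y = x \<bullet> y" "A ` R = R" "\<And>\<beta>. \<beta> \<in> R \<Longrightarrow> b \<bullet> \<beta> \<in> \<int>"
    "\<And>x. f x = A x + b"
proof -
  from assms obtain A b where "linear A" "\<forall>x y. A x \<bullet> A y = x \<bullet> y" "A ` R = R" "\<forall>\<beta>\<in>R. b \<bullet> \<beta> \<in> \<int>"
    "f = (\<lambda>x. A x + b)" unfolding aff_auts_def by blast
  then show ?thesis by (intro that[of A b]) simp_all
qed

lemma aff_autsI:
  assumes "linear A" "\<And>x y. A x \<bullet> A y = x \<bullet> y" "\<And>\<beta>. \<beta> \<in> R \<Longrightarrow> A \<beta> \<in> R" "\<And>\<beta>. \<beta> \<in> R \<Longrightarrow> b \<bullet> \<beta> \<in> \<int>"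
    "\<And>x. f x = A x + b"
  shows "f \<in> aff_auts"
proof -
  have "inj A"
  proof (rule injI)
    fix x y assume "A x = A y"
    then have "A (x - y) \<bullet> A (x - y) = 0" by (simp add: linear_diff[OF assms(1)])
    then have "(x - y) \<bullet> (x - y) = 0" unfolding assms(2) .
    then show "x = y" by simp
  qed
  then have "A ` R = R" using assms(3) finite_R by (intro endo_inj_surj) (auto simp: inj_on_def)
  then show ?thesis using assms unfolding aff_auts_def by (intro CollectI exI[of _ A] exI[of _ b]) auto
qed

lemma id_aff_auts: "id \<in> aff_auts"
  by (rule aff_autsI[of id 0]) (auto simp: linear_id)

lemma comp_aff_auts:
  assumes "f \<in> aff_auts" "g \<in> aff_auts"
  shows "f \<circ> g \<in> aff_auts"
proof -
  from assms(1) obtain A b where f: "linear A" "\<And>x y. A x \<bullet> A y = x \<bullet> y" "A ` R = R" "\<And>\<beta>. \<beta> \<in> R \<Longrightarrow> b \<bullet> \<beta> \<in> \<int>"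
    "\<And>x. f x = A x + b" by (rule aff_autsE) blast
  from assms(2) obtain B c where g: "linear B" "\<And>x y. B x \<bullet> B y = x \<bullet> y" "B ` R = R" "\<And>\<beta>. \<beta> \<in> R \<Longrightarrow> c \<bullet> \<beta> \<in> \<int>"
    "\<And>x. g x = B x + c" by (rule aff_autsE) blast
  show ?thesis
  proof (rule aff_autsI[of "A \<circ> B" "A c + b"])
    fix \<beta> assume b: "\<beta> \<in> R"
    then obtain \<gamma> where c: "\<gamma> \<in> R" "\<beta> = A \<gamma>" using f(3) by blast
    have "A c \<bullet> \<beta> \<in> \<int>" using c f(2) g(4) by simp
    then show "(A c + b) \<bullet> \<beta> \<in> \<int>" using f(4)[OF b] by (simp add: inner_add_left)
  next
    show "linear (A \<circ> B)" using f(1) g(1) by (rule linear_compose[rotated])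
  next
    fix \<beta> assume b: "\<beta> \<in> R"
    then have "B \<beta> \<in> R" using g(3) by blast
    then show "(A \<circ> B) \<beta> \<in> R" using f(3) by auto
  qed (simp_all add: f(2,5) g(2,5) linear_add[OF f(1)])
qed

lemma aff_auts_linear_part_bij:
  fixes A :: "'a \<Rightarrow> 'a"
  assumes "linear A" "\<And>x y. A x \<bullet> A y = x \<bullet> y"
  shows "bij A"
proof -
  have "orthogonal_transformation A" using assms by (simp add: orthogonal_transformation_def)
  then show ?thesis by (rule orthogonal_transformation_bij)
qed

lemma aff_auts_bij:
  assumes "f \<in> aff_auts" shows "bij f"
proof -
  from assms obtain A b where f: "linear A" "\<And>x y. A x \<bullet> A y = x \<bullet> y" "\<And>x. f x = A x + b"
    by (rule aff_autsE) blast
  have "f = (\<lambda>x. x + b) \<circ> A" using f(3) by auto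
  moreover have "bij (\<lambda>x. x + b)" by (rule bij_plus_right)
  ultimately show ?thesis using aff_auts_linear_part_bij[OF f(1,2)] by (simp add: bij_comp)
qed

lemma inv_aff_auts:
  assumes "f \<in> aff_auts" shows "inv f \<in> aff_auts"
proof -
  from assms obtain A b where f: "linear A" "\<And>x y. A x \<bullet> A y = x \<bullet> y" "A ` R = R" "\<And>\<beta>. \<beta> \<in> R \<Longrightarrow> b \<bullet> \<beta> \<in> \<int>"
    "\<And>x. f x = A x + b" by (rule aff_autsE) blast
  have bij: "bij A" by (rule aff_auts_linear_part_bij[OF f(1,2)])
  have AB: "A (inv A x) = x" for x by (simp add: bij bij_is_surj surj_f_inv_f)
  have BA: "inv A (A x) = x" for x by (simp add: bij bij_is_inj)
  have orthB: "inv A x \<bullet> inv A y = x \<bullet> y" for x y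
    using f(2)[of "inv A x" "inv A y"] by (simp add: AB)
  have lin: "linear (inv A)"
    by (rule linearI) (metis AB BA linear_add[OF f(1)], metis AB BA linear_cmul[OF f(1)])
  show ?thesis
  proof (rule aff_autsI[of "inv A" "- inv A b"])
    fix \<beta> assume b: "\<beta> \<in> R"
    have "\<beta> \<in> A ` R" using b f(3) by simp
    then show "inv A \<beta> \<in> R" using BA by auto
    have "inv A b \<bullet> \<beta> = b \<bullet> A \<beta>" using orthB[of b "A \<beta>"] by (simp add: BA)
    then show "- inv A b \<bullet> \<beta> \<in> \<int>" using f(3,4) b by auto
  next
    fix x
    have "f (inv A x - inv A b) = x"
      by (simp add: f(5) AB linear_diff[OF f(1)])
    then show "inv f x = inv A x + - inv A b"
      using aff_auts_bij[OF assms] by (metis bij_inv_eq_iff add_uminus_conv_diff)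
  qed (fact lin orthB)+
qed

text \<open>The linear part \<open>A\<close> is an isometry permuting the roots, so the level of
  \<beta> is carried to the level of \<open>A \<beta>\<close>, shifted by the integer that the
  translation part pairs to with \<open>A \<beta>\<close>.\<close>

lemma aff_auts_hyperplane:
  assumes "f \<in> aff_auts" "\<beta> \<in> R"
  obtains \<gamma> m where "\<gamma> \<in> R" "f ` hyperplane \<beta> k = hyperplane \<gamma> m"
    "\<And>x. f (aff_reflection \<beta> k x) = aff_reflection \<gamma> m (f x)"
proof -
  from assms(1) obtain A b where f: "linear A" "\<And>x y. A x \<bullet> A y = x \<bullet> y" "A ` R = R" "\<And>\<beta>. \<beta> \<in> R \<Longrightarrow> b \<bullet> \<beta> \<in> \<int>"
    "\<And>x. f x = A x + b" by (rule aff_autsE) blast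
  have AR: "A \<beta> \<in> R" using assms f(3) by auto
  then obtain l where l: "b \<bullet> A \<beta> = of_int l" using f(4) Ints_cases by metis
  have lev: "f x \<bullet> A \<beta> - of_int (k + l) = x \<bullet> \<beta> - of_int k" for x
    using f(2) l by (simp add: f(5) inner_add_left)
  show ?thesis
  proof (rule that[OF AR, of "k + l"])
    have mem: "f x \<in> hyperplane (A \<beta>) (k + l) \<longleftrightarrow> x \<in> hyperplane \<beta> k" for x
      using lev[of x] by (simp add: hyperplane_def del: of_int_add) linarith
    show "f ` hyperplane \<beta> k = hyperplane (A \<beta>) (k + l)"
    proof (intro equalityI subsetI)
      fix y assume y: "y \<in> hyperplane (A \<beta>) (k + l)"
      obtain x where "y = f x" using bij_is_surj[OF aff_auts_bij[OF assms(1)]] by blast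
      then show "y \<in> f ` hyperplane \<beta> k" using y mem by blast
    qed (use mem in blast)
    fix x
    have "coroot (A \<beta>) = A (coroot \<beta>)" by (simp add: coroot_def f(2) linear_cmul[OF f(1)])
    then show "f (aff_reflection \<beta> k x) = aff_reflection (A \<beta>) (k + l) (f x)"
      unfolding aff_reflection_def lev
      by (simp add: f(5) linear_diff[OF f(1)] linear_cmul[OF f(1)])
  qed
qed

lemma aff_auts_image_hyperplanes:
  assumes "f \<in> aff_auts" "H \<in> hyperplanes" shows "f ` H \<in> hyperplanes"
proof -
  obtain \<beta> k where b: "\<beta> \<in> R" "H = hyperplane \<beta> k" using assms(2) by (rule hyperplanesE)
  obtain \<gamma> m where "\<gamma> \<in> R" "f ` hyperplane \<beta> k = hyperplane \<gamma> m"
    by (rule aff_auts_hyperplane[OF assms(1) b(1)])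
  then show ?thesis using b by (simp add: hyperplane_in_hyperplanes)
qed

lemma aff_auts_convex_comb:
  "f \<in> aff_auts \<Longrightarrow> f ((1 - t) *\<^sub>R x + t *\<^sub>R y) = (1 - t) *\<^sub>R f x + t *\<^sub>R f y"
proof -
  assume "f \<in> aff_auts"
  then obtain A b where f: "linear A" "\<And>x. f x = A x + b" by (rule aff_autsE) blast
  show ?thesis by (simp add: f(2) linear_add[OF f(1)] linear_cmul[OF f(1)]) (simp add: algebra_simps)
qed

lemma aff_auts_segment:
  "f \<in> aff_auts \<Longrightarrow> f ` closed_segment x y = closed_segment (f x) (f y)"
  unfolding closed_segment_def by (auto simp: aff_auts_convex_comb[symmetric])

lemma aff_auts_inv_f [simp]: "f \<in> aff_auts \<Longrightarrow> inv f (f x) = x"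
  by (simp add: aff_auts_bij bij_is_inj)

lemma aff_auts_f_inv [simp]: "f \<in> aff_auts \<Longrightarrow> f (inv f x) = x"
  by (simp add: aff_auts_bij bij_is_surj surj_f_inv_f)

lemma aff_auts_image_seps: "f \<in> aff_auts \<Longrightarrow> (\<lambda>H. f ` H) ` seps x y \<subseteq> seps (f x) (f y)"
proof -
  assume f: "f \<in> aff_auts"
  have inj: "inj f" using aff_auts_bij[OF f] by (rule bij_is_inj)
  show ?thesis
    unfolding seps_def aff_auts_segment[OF f, symmetric]
  proof (intro image_subsetI CollectI conjI, goal_cases)
    case (1 H)
    then show ?case by (simp add: aff_auts_image_hyperplanes[OF f])
  next
    case (4 H)
    then show ?case using image_Int[OF inj, of H "closed_segment x y"] by auto
  qed (simp_all add: inj_image_mem_iff[OF inj])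
qed

lemma aff_auts_seps:
  assumes f: "f \<in> aff_auts"
  shows "seps (f x) (f y) = (\<lambda>H. f ` H) ` seps x y"
proof
  show "seps (f x) (f y) \<subseteq> (\<lambda>H. f ` H) ` seps x y"
  proof
    fix H assume H: "H \<in> seps (f x) (f y)"
    then have "inv f ` H \<in> seps x y"
      using aff_auts_image_seps[OF inv_aff_auts[OF f], of "f x" "f y"] f by auto
    moreover have "f ` inv f ` H = H" using f by (simp add: image_image)
    ultimately show "H \<in> (\<lambda>H. f ` H) ` seps x y" by (metis imageI)
  qed
qed (rule aff_auts_image_seps[OF f])

lemma aff_auts_seps_mem:
  assumes f: "f \<in> aff_auts"
  shows "f ` H \<in> seps (f x) (f y) \<longleftrightarrow> H \<in> seps x y"
  using aff_auts_seps[OF f] inj_image_eq_iff[OF bij_is_inj[OF aff_auts_bij[OF f]]] by auto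

lemma aff_auts_regular:
  assumes f: "f \<in> aff_auts" and "x \<in> regular_points" shows "f x \<in> regular_points"
proof -
  have False if "H \<in> hyperplanes" "f x \<in> H" for H
  proof -
    have "inv f ` H \<in> hyperplanes" using aff_auts_image_hyperplanes[OF inv_aff_auts[OF f] that(1)] .
    moreover have "x \<in> inv f ` H" using that(2) f by (metis aff_auts_inv_f imageI)
    ultimately show False using assms(2) by (auto simp: regular_points_def)
  qed
  then show ?thesis by (auto simp: regular_points_def)
qed

lemma aff_reflection_aff_auts:
  assumes "\<beta> \<in> R" shows "aff_reflection \<beta> k \<in> aff_auts"
proof (rule aff_autsI[of "aff_reflection \<beta> 0" "of_int k *\<^sub>R coroot \<beta>"])
  fix \<gamma> assume "\<gamma> \<in> R"
  then show "aff_reflection \<beta> 0 \<gamma> \<in> R" using reflection_root assms by blast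
  have "coroot \<beta> \<bullet> \<gamma> \<in> \<int>" using integrality[OF assms \<open>\<gamma> \<in> R\<close>] by (simp add: inner_commute)
  then show "(of_int k *\<^sub>R coroot \<beta>) \<bullet> \<gamma> \<in> \<int>" by simp
qed (simp_all add: linear_aff_reflection_0 aff_reflection_0_isometry, simp add: aff_reflection_def algebra_simps)

section \<open>The walls of the fundamental alcove\<close>

definition wall_root :: "nat \<Rightarrow> 'a" where "wall_root i = (if i = 0 then highest_root else \<alpha> i)"

definition wall_plane :: "nat \<Rightarrow> 'a set" where
  "wall_plane i = hyperplane (wall_root i) (if i = 0 then 1 else 0)"

text \<open>Signed so that the open alcove is where all these affine functions are positive, which
  treats the affine node like the others.\<close>

definition wall :: "nat \<Rightarrow> 'a \<Rightarrow> real" where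
  "wall i x = (if i = 0 then 1 - x \<bullet> highest_root else x \<bullet> \<alpha> i)"

lemma I_cases: "i \<in> I \<Longrightarrow> i = 0 \<or> (i \<noteq> 0 \<and> i \<in> I0)" by (auto simp: I_def)

lemma wall_root_in_R: "i \<in> I \<Longrightarrow> wall_root i \<in> R"
  using simple_root highest_root_in_R by (auto simp: wall_root_def I_def)

lemma s_reflection: "s i = aff_reflection (wall_root i) (if i = 0 then 1 else 0)"
  by (simp add: s_def wall_root_def)

lemma wall_plane_iff: "x \<in> wall_plane i \<longleftrightarrow> wall i x = 0"
  by (auto simp: wall_plane_def hyperplane_def wall_root_def wall_def)

lemma wall_plane_in: "i \<in> I \<Longrightarrow> wall_plane i \<in> hyperplanes"
  by (simp add: wall_plane_def hyperplane_in_hyperplanes wall_root_in_R)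

lemma wall_plane_seps: "i \<in> I \<Longrightarrow> wall_plane i \<in> seps x y \<longleftrightarrow> wall i x * wall i y < 0"
  unfolding wall_plane_def seps_iff[OF wall_root_in_R]
  by (auto simp: wall_root_def wall_def mult_less_0_iff)

lemma wall_s: "i \<in> I \<Longrightarrow> wall i (s i x) = - wall i x"
  using coroot_inner_self[OF root_nonzero[OF wall_root_in_R], of i]
  by (auto simp: wall_def s_reflection inner_aff_reflection wall_root_def)

lemma s_fixes: "i \<in> I \<Longrightarrow> x \<in> wall_plane i \<Longrightarrow> s i x = x"
  by (simp add: s_reflection wall_plane_def hyperplane_def aff_reflection_def)

lemma s_involution [simp]: "i \<in> I \<Longrightarrow> s i (s i x) = x"
  by (simp add: s_reflection aff_reflection_involution root_nonzero[OF wall_root_in_R])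

lemma s_comp_s [simp]: "i \<in> I \<Longrightarrow> s i \<circ> s i = id" by (simp add: fun_eq_iff)

lemma s_comp_s_comp [simp]: "i \<in> I \<Longrightarrow> s i \<circ> (s i \<circ> f) = f" by (simp add: fun_eq_iff)

lemma s_aff_auts: "i \<in> I \<Longrightarrow> s i \<in> aff_auts"
  by (simp add: s_reflection aff_reflection_aff_auts wall_root_in_R)


lemma fund_alcove_iff: "x \<in> fund_alcove \<longleftrightarrow> (\<forall>i\<in>I. wall i x > 0)"
proof -
  have "(\<forall>i\<in>I0. wall i x > 0) \<longleftrightarrow> (\<forall>i\<in>I0. x \<bullet> \<alpha> i > 0)"
    by (intro ball_cong) (auto simp: wall_def)
  then show ?thesis by (auto simp: fund_alcove_def I_def) (simp_all add: wall_def)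
qed

text \<open>Values on simple roots are positive, and \<beta> is dominated by
  \<open>highest_root\<close>, whose value is below 1. Hence no hyperplane meets the alcove.\<close>

lemma pos_root_bounds:
  assumes "pos \<beta>" "x \<in> fund_alcove"
  shows "0 < x \<bullet> \<beta>" "x \<bullet> \<beta> < 1"
proof -
  have xa: "x \<bullet> \<alpha> i > 0" if "i \<in> I0" for i using assms(2) that by (simp add: fund_alcove_def)
  obtain i where i: "i \<in> I0" "\<beta> \<bullet> fund_coweight i > 0" using assms(1) by (rule pos_coefficient)
  show "0 < x \<bullet> \<beta>" unfolding inner_expansion[of x \<beta>]
  proof (rule sum_pos2[OF finite_I0 i(1)])
    show "0 < x \<bullet> \<alpha> i * (\<beta> \<bullet> fund_coweight i)" using xa[OF i(1)] i(2) by simp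
    fix j assume j: "j \<in> I0"
    then have "\<beta> \<bullet> fund_coweight j \<ge> 0" using assms(1) by (simp add: pos_def)
    then show "0 \<le> x \<bullet> \<alpha> j * (\<beta> \<bullet> fund_coweight j)" using xa[OF j] by simp
  qed
  have "dominates highest_root \<beta>" using assms(1) highest_root_dominates by (simp add: pos_def)
  have "x \<bullet> (highest_root - \<beta>) \<ge> 0" unfolding inner_expansion[of x "highest_root - \<beta>"]
  proof (rule sum_nonneg)
    fix j assume j: "j \<in> I0"
    then have "(highest_root - \<beta>) \<bullet> fund_coweight j \<ge> 0"
      using \<open>dominates highest_root \<beta>\<close> unfolding dominates_def by blast
    then show "0 \<le> x \<bullet> \<alpha> j * ((highest_root - \<beta>) \<bullet> fund_coweight j)" using xa[OF j] by simp
  qed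
  then show "x \<bullet> \<beta> < 1" using assms(2) by (simp add: fund_alcove_def inner_diff_right)
qed

lemma fund_alcove_regular: "fund_alcove \<subseteq> regular_points"
proof
  fix x assume x: "x \<in> fund_alcove"
  have False if H: "H \<in> hyperplanes" "x \<in> H" for H
  proof -
    obtain \<beta> k where b: "pos \<beta>" "H = hyperplane \<beta> k" using H(1) by (rule hyperplanesE_pos)
    then have "0 < (of_int k::real)" "(of_int k::real) < 1"
      using pos_root_bounds[OF b(1) x] H(2) by (auto simp: hyperplane_def)
    then show False by simp
  qed
  then show "x \<in> regular_points" by (auto simp: regular_points_def)
qed

lemma fund_alcove_not_separated:
  assumes "x \<in> fund_alcove" "y \<in> fund_alcove" shows "seps x y = {}"
proof -
  have False if H: "H \<in> seps x y" for H
  proof -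
    obtain \<beta> k where b: "pos \<beta>" "H = hyperplane \<beta> k"
      using H seps_subset by (blast elim: hyperplanesE_pos)
    then show False using no_integer_between_fractions[of "x \<bullet> \<beta>" "y \<bullet> \<beta>" k] H pos_root_bounds[OF b(1)] assms
      by (simp add: seps_iff pos_def)
  qed
  then show ?thesis by blast
qed

lemma not_fund_alcove_separated:
  assumes "x \<in> fund_alcove" "y \<in> regular_points" "y \<notin> fund_alcove"
  obtains i where "i \<in> I" "wall_plane i \<in> seps x y"
proof -
  obtain i where i: "i \<in> I" "\<not> wall i y > 0" using assms(3) by (auto simp: fund_alcove_iff)
  moreover have "wall i y \<noteq> 0"
    using assms(2) wall_plane_in[OF i(1)] wall_plane_iff by (auto simp: regular_points_def)
  ultimately have "wall i x * wall i y < 0" using assms(1) by (auto simp: fund_alcove_iff mult_less_0_iff)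
  then show ?thesis using that i wall_plane_seps by blast
qed

text \<open>For a node other than 0, the reflection keeps a positive root positive unless the root
  is a multiple of that simple root; both values then lie between 0 and 1 and no integer separates
  them. For the node 0, \<open>coroot_highest_root\<close> shows that a positive root other than the
  highest one keeps its value or takes the value 1 minus that of another positive root, again
  between 0 and 1.\<close>

lemma seps_s:
  assumes x: "x \<in> fund_alcove" and i: "i \<in> I"
  shows "seps x (s i x) = {wall_plane i}"
proof
  have "wall i x > 0" using assms by (simp add: fund_alcove_iff)
  then show "{wall_plane i} \<subseteq> seps x (s i x)"
    using i by (simp add: wall_plane_seps wall_s)
  show "seps x (s i x) \<subseteq> {wall_plane i}"
  proof
    fix H assume H: "H \<in> seps x (s i x)"
    then obtain \<beta> k where b: "pos \<beta>" "H = hyperplane \<beta> k"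
      using seps_subset by (blast elim: hyperplanesE_pos)
    have bR: "\<beta> \<in> R" using b by (simp add: pos_def)
    have sep: "(x \<bullet> \<beta> - of_int k) * (s i x \<bullet> \<beta> - of_int k) < 0" using H b seps_iff[OF bR] by simp
    have bx: "0 < x \<bullet> \<beta>" "x \<bullet> \<beta> < 1" using pos_root_bounds[OF b(1) x] by auto
    consider "i = 0" | "i \<noteq> 0" "i \<in> I0" using I_cases[OF i] by blast
    then show "H \<in> {wall_plane i}"
    proof cases
      case 1
      have sx: "s i x \<bullet> \<beta> = x \<bullet> \<beta> - (x \<bullet> highest_root - 1) * (\<beta> \<bullet> coroot highest_root)"
        using 1 by (simp add: s_reflection wall_root_def inner_aff_reflection)
      show ?thesis
      proof (cases "\<beta> = highest_root")
        case True
        then have e: "s i x \<bullet> \<beta> = 2 - x \<bullet> \<beta>"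
          using sx coroot_inner_self[OF root_nonzero[OF highest_root_in_R]] by simp
        have "k = 1"
        proof (rule ccontr)
          assume "k \<noteq> 1"
          then have "k \<le> 0 \<or> k \<ge> 2" by auto
          then have "(of_int k :: real) \<le> 0 \<or> (of_int k :: real) \<ge> 2" by auto
          then show False using sep bx unfolding e by (auto simp: mult_less_0_iff)
        qed
        then show ?thesis using 1 True b by (simp add: wall_plane_def wall_root_def)
      next
        case False
        from coroot_highest_root[OF b(1) False] show ?thesis
        proof
          assume "\<beta> \<bullet> coroot highest_root = 0"
          then show ?thesis using sep bx sx no_integer_between_fractions[of "x \<bullet> \<beta>" "x \<bullet> \<beta>" k] by simp
        next
          assume a: "\<beta> \<bullet> coroot highest_root = 1 \<and> pos (highest_root - \<beta>)"
          then have "s i x \<bullet> \<beta> = 1 - x \<bullet> (highest_root - \<beta>)" using sx by (simp add: inner_diff_right)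
          then show ?thesis using sep bx pos_root_bounds[OF conjunct2[OF a] x]
              no_integer_between_fractions[of "x \<bullet> \<beta>" "s i x \<bullet> \<beta>" k] by simp
        qed
      qed
    next
      case 2
      have sx: "s i x \<bullet> \<beta> = x \<bullet> aff_reflection (\<alpha> i) 0 \<beta>"
        using 2 by (simp add: s_def inner_aff_reflection_0)
      show ?thesis
      proof (cases "\<exists>j\<in>I0. j \<noteq> i \<and> \<beta> \<bullet> fund_coweight j > 0")
        case True
        then obtain j where j: "j \<in> I0" "j \<noteq> i" "\<beta> \<bullet> fund_coweight j > 0" by blast
        then have "pos (aff_reflection (\<alpha> i) 0 \<beta>)"
          using reflection_coefficient[of i j \<beta>] 2 reflection_root[OF simple_root[OF 2(2)] bR]
          by (intro posI_coefficient[OF _ j(1)]) auto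
        then show ?thesis using sep bx pos_root_bounds[OF _ x]
              no_integer_between_fractions[of "x \<bullet> \<beta>" "s i x \<bullet> \<beta>" k] sx by simp
      next
        case False
        \<comment> \<open>Here \<beta> is a multiple of \<open>\<alpha> i\<close>, possibly a proper
          one when \<open>R\<close> is not reduced; its hyperplane of level 0 is still the
          wall.\<close>
        define c where "c = \<beta> \<bullet> fund_coweight i"
        have z: "\<beta> \<bullet> fund_coweight j = 0" if "j \<in> I0" "j \<noteq> i" for j
          using that False b(1) by (force simp: pos_def)
        have "\<beta> = (\<Sum>j\<in>I0. if j = i then c *\<^sub>R \<alpha> i else 0)"
          by (subst simple_expansion) (use z in \<open>auto simp: c_def intro!: sum.cong\<close>)
        then have bc: "\<beta> = c *\<^sub>R \<alpha> i" using 2 finite_I0 by simp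
        have "s i x \<bullet> \<beta> = - (x \<bullet> \<beta>)" using wall_s[OF i, of x] 2 by (simp add: bc wall_def)
        moreover have "k = 0"
        proof (rule ccontr)
          assume "k \<noteq> 0"
          then have "k \<le> -1 \<or> k \<ge> 1" by auto
          then have "(of_int k :: real) \<le> -1 \<or> (of_int k :: real) \<ge> 1" by auto
          then show False using sep bx \<open>s i x \<bullet> \<beta> = - (x \<bullet> \<beta>)\<close> by (auto simp: mult_less_0_iff)
        qed
        moreover have "c \<noteq> 0" using bc root_nonzero[OF bR] by auto
        ultimately show ?thesis using 2 b bc by (simp add: wall_plane_def wall_root_def hyperplane_def)
      qed
    qed
  qed
qed

lemma fund_alcove_nonempty: "fund_alcove \<noteq> {}"
proof -
  define m where "m = (\<Sum>i\<in>I0. highest_root \<bullet> fund_coweight i)"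
  have m: "m > 0" unfolding m_def using highest_root_coefficient finite_I0 I0_nonempty by (intro sum_pos) auto
  \<comment> \<open>All simple roots get the value 1 / (1 + m), which gives the highest root the
    value m / (1 + m), below 1.\<close>
  define x where "x = (1 / (1 + m)) *\<^sub>R (\<Sum>i\<in>I0. fund_coweight i)"
  have "x \<bullet> \<alpha> j = 1 / (1 + m)" if "j \<in> I0" for j
    using that by (simp add: x_def inner_sum_left fund_coweight_inner finite_I0)
  moreover have "x \<bullet> highest_root = m / (1 + m)"
    by (simp add: x_def m_def inner_sum_left inner_commute[of highest_root])
  ultimately have "x \<in> fund_alcove" using m by (simp add: fund_alcove_def)
  then show ?thesis by blast
qed

definition base_point :: 'a where "base_point = (SOME x. x \<in> fund_alcove)"

lemma base_point_in: "base_point \<in> fund_alcove"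
  unfolding base_point_def using fund_alcove_nonempty by (auto intro: someI)

lemma base_point_regular: "base_point \<in> regular_points"
  using base_point_in fund_alcove_regular by blast

text \<open>Applying \<open>s i\<close> identifies the hyperplanes between \<open>base_point\<close>
  and \<open>s i y\<close> with those between \<open>s i base_point\<close> and \<open>y\<close>. By
  \<open>seps_s\<close> moving the first endpoint back to \<open>base_point\<close> toggles the
  membership of one wall only.\<close>

lemma seps_step:
  assumes i: "i \<in> I" and y: "y \<in> regular_points"
  shows "wall_plane i \<in> seps base_point (s i y) \<longleftrightarrow> wall_plane i \<notin> seps base_point y"
    and "wall_plane i \<notin> seps base_point y \<Longrightarrow> card (seps base_point (s i y)) = Suc (card (seps base_point y))"
    and "wall_plane i \<in> seps base_point y \<Longrightarrow> Suc (card (seps base_point (s i y))) = card (seps base_point y)"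
proof -
  have r: "s i base_point \<in> regular_points" using aff_auts_regular s_aff_auts i base_point_regular by blast
  have "wall i base_point \<noteq> 0" "wall i y \<noteq> 0"
    using y base_point_regular wall_plane_in[OF i] wall_plane_iff by (auto simp: regular_points_def)
  then show w: "wall_plane i \<in> seps base_point (s i y) \<longleftrightarrow> wall_plane i \<notin> seps base_point y"
    using i by (simp add: wall_plane_seps wall_s) (simp add: linorder_not_less order_le_less)
  have sym: "seps x y = seps y x" for x y by (simp add: seps_def closed_segment_commute conj_commute conj_left_commute)
  have eq: "card (seps base_point (s i y)) = card (seps (s i base_point) y)"
  proof -
    have "seps base_point (s i y) = (\<lambda>H. s i ` H) ` seps (s i base_point) y"
      using aff_auts_seps[OF s_aff_auts[OF i], of "s i base_point" y] i by simp
    moreover have "inj (\<lambda>H. s i ` H)"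
      using bij_is_inj[OF aff_auts_bij[OF s_aff_auts[OF i]]] by (simp add: inj_image_eq_iff inj_def)
    ultimately show ?thesis by (metis card_image subset_UNIV inj_on_subset)
  qed
  have tri: "seps (s i base_point) y = ({wall_plane i} - seps base_point y) \<union> (seps base_point y - {wall_plane i})"
    using seps_triangle[OF r base_point_regular y] seps_s[OF base_point_in i] sym by metis
  show "card (seps base_point (s i y)) = Suc (card (seps base_point y))" if "wall_plane i \<notin> seps base_point y"
  proof -
    have "seps (s i base_point) y = insert (wall_plane i) (seps base_point y)" using tri that by auto
    then show ?thesis using eq that finite_seps by simp
  qed
  show "Suc (card (seps base_point (s i y))) = card (seps base_point y)" if "wall_plane i \<in> seps base_point y"
  proof -
    have "seps (s i base_point) y = seps base_point y - {wall_plane i}" using tri that by auto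
    then show ?thesis using eq card_Suc_Diff1[OF finite_seps that] by simp
  qed
qed

section \<open>Words, length, exchange and deletion\<close>

lemma word_Nil [simp]: "word [] = id" by (simp add: word_def)
lemma word_Cons [simp]: "word (i # js) = s i \<circ> word js" by (simp add: word_def)
lemma word_append: "word (xs @ ys) = word xs \<circ> word ys" by (induction xs) (simp_all add: comp_assoc)

lemma word_aff_auts: "js \<in> lists I \<Longrightarrow> word js \<in> aff_auts"
  by (induction js) (auto intro: comp_aff_auts id_aff_auts s_aff_auts)

lemma word_rev: "js \<in> lists I \<Longrightarrow> word (rev js) = inv (word js)"
proof -
  assume js: "js \<in> lists I"
  have "word js \<circ> word (rev js) = id" using js
    by (induction js) (simp_all add: word_append, simp add: fun_eq_iff)
  then have "inv (word js) \<circ> (word js \<circ> word (rev js)) = inv (word js)" by simp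
  then show ?thesis using word_aff_auts[OF js] by (simp add: fun_eq_iff)
qed

text \<open>While the point lies outside the alcove, some wall of the alcove separates it from
  \<open>base_point\<close>, and reflecting in that wall lowers the number of separating
  hyperplanes.\<close>

lemma regular_in_word_alcove:
  assumes "y \<in> regular_points"
  shows "\<exists>js\<in>lists I. word js y \<in> fund_alcove"
  using assms
proof (induction "card (seps base_point y)" arbitrary: y rule: less_induct)
  case less
  show ?case
  proof (cases "y \<in> fund_alcove")
    case True then show ?thesis by (intro bexI[of _ "[]"]) auto
  next
    case False
    obtain i where i: "i \<in> I" "wall_plane i \<in> seps base_point y"
      using not_fund_alcove_separated[OF base_point_in less.prems False] by blast
    have "card (seps base_point (s i y)) < card (seps base_point y)" using seps_step(3)[OF i(1) less.prems i(2)] by simp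
    then obtain js where "js \<in> lists I" "word js (s i y) \<in> fund_alcove"
      using less.hyps aff_auts_regular[OF s_aff_auts[OF i(1)] less.prems] by blast
    then show ?thesis using i by (intro bexI[of _ "js @ [i]"]) (auto simp: word_append)
  qed
qed

text \<open>The word describes a path of adjacent alcoves whose step at letter \<open>j\<close>
  after the prefix \<open>xs\<close> crosses the image of wall \<open>j\<close> under
  \<open>word xs\<close>. A hyperplane separating the ends must be crossed by some step.\<close>

lemma seps_word:
  assumes "ks \<in> lists I" "H \<in> seps base_point (word ks base_point)"
  shows "\<exists>xs j ys. ks = xs @ j # ys \<and> H = word xs ` wall_plane j"
  using assms
proof (induction ks arbitrary: H)
  case Nil
  then show ?case using fund_alcove_not_separated base_point_in by auto
next
  case (Cons i ks)
  then have i: "i \<in> I" and ks: "ks \<in> lists I" by auto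
  let ?b = base_point
  have r: "s i ?b \<in> regular_points" "s i (word ks ?b) \<in> regular_points"
    using aff_auts_regular s_aff_auts word_aff_auts base_point_regular i ks by auto
  have "H \<in> seps ?b (s i ?b) \<or> H \<in> seps (s i ?b) (s i (word ks ?b))"
    using Cons.prems seps_triangle[OF base_point_regular r(1) r(2)] by auto
  then show ?case
  proof
    assume "H \<in> seps ?b (s i ?b)"
    then show ?thesis using seps_s[OF base_point_in i] by (intro exI[of _ "[]"]) auto
  next
    assume "H \<in> seps (s i ?b) (s i (word ks ?b))"
    then obtain H' where H': "H' \<in> seps ?b (word ks ?b)" "H = s i ` H'"
      using aff_auts_seps[OF s_aff_auts[OF i]] by auto
    then obtain xs j ys where "ks = xs @ j # ys" "H' = word xs ` wall_plane j" using Cons.IH ks by blast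
    then show ?thesis using H'(2) by (intro exI[of _ "i # xs"] exI[of _ j] exI[of _ ys]) (simp add: image_comp)
  qed
qed

lemma reflection_conj:
  assumes f: "f \<in> aff_auts" and i: "i \<in> I" and b: "\<beta> \<in> R" and H: "hyperplane \<beta> k = f ` wall_plane i"
  shows "aff_reflection \<beta> k \<circ> f = f \<circ> s i"
proof -
  obtain \<gamma> m where g: "\<gamma> \<in> R" "f ` wall_plane i = hyperplane \<gamma> m" "\<And>x. f (s i x) = aff_reflection \<gamma> m (f x)"
    unfolding wall_plane_def s_reflection
    by (rule aff_auts_hyperplane[OF f wall_root_in_R[OF i], of "if i = 0 then 1 else 0"]) blast
  have "aff_reflection \<beta> k = aff_reflection \<gamma> m"
    using hyperplane_eq_reflection_eq root_nonzero b g(1,2) H by metis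
  then show ?thesis using g(3) by (simp add: fun_eq_iff)
qed

text \<open>The path of the word crosses wall \<open>i\<close> at some letter \<open>j\<close> after
  a prefix \<open>xs\<close>. The reflections in this common hyperplane agree, so \<open>s i\<close>
  passes through \<open>word xs\<close>, becomes \<open>s j\<close> and cancels the letter.\<close>

lemma exchange:
  assumes "ks \<in> lists I" "i \<in> I" "wall_plane i \<in> seps base_point (word ks base_point)"
  shows "\<exists>xs j ys. ks = xs @ j # ys \<and> s i \<circ> word ks = word (xs @ ys)"
proof -
  obtain xs j ys where k: "ks = xs @ j # ys" "wall_plane i = word xs ` wall_plane j"
    using seps_word[OF assms(1,3)] by blast
  have j: "j \<in> I" "xs \<in> lists I" using assms(1) k by auto
  have "s i \<circ> word xs = word xs \<circ> s j"
    unfolding s_reflection[of i]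
    by (rule reflection_conj[OF word_aff_auts[OF j(2)] j(1) wall_root_in_R[OF assms(2)]])
      (use k in \<open>simp add: wall_plane_def\<close>)
  then have "s i \<circ> word ks = word xs \<circ> s j \<circ> (s j \<circ> word ys)" unfolding k(1) by (simp add: word_append comp_assoc[symmetric])
  also have "\<dots> = word (xs @ ys)" using j by (simp add: word_append comp_assoc)
  finally show ?thesis using k by blast
qed

text \<open>The length of a Weyl group element as a number of separating hyperplanes;
  \<open>reduced_word_iff\<close> identifies it with word length.\<close>

definition len :: "('a \<Rightarrow> 'a) \<Rightarrow> nat" where "len w = card (seps base_point (w base_point))"

lemma len_id [simp]: "len id = 0"
  by (simp add: len_def fund_alcove_not_separated base_point_in)

definition descent :: "nat \<Rightarrow> ('a \<Rightarrow> 'a) \<Rightarrow> bool" where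
  "descent i w \<longleftrightarrow> wall_plane i \<in> seps base_point (w base_point)"

lemma descent_iff: "i \<in> I \<Longrightarrow> descent i w \<longleftrightarrow> wall i (w base_point) < 0"
  using base_point_in by (force simp: descent_def wall_plane_seps fund_alcove_iff mult_less_0_iff)

lemma len_step:
  assumes "i \<in> I" "w \<in> aff_auts"
  shows "descent i (s i \<circ> w) \<longleftrightarrow> \<not> descent i w"
    and "\<not> descent i w \<Longrightarrow> len (s i \<circ> w) = Suc (len w)"
    and "descent i w \<Longrightarrow> len w = Suc (len (s i \<circ> w))"
  using seps_step[OF assms(1) aff_auts_regular[OF assms(2) base_point_regular]]
  by (auto simp: descent_def len_def)

lemma len_word_le: "js \<in> lists I \<Longrightarrow> len (word js) \<le> length js"
proof (induction js)
  case (Cons i js)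
  then have "i \<in> I" "word js \<in> aff_auts" "len (word js) \<le> length js" using word_aff_auts[of js] by auto
  moreover have "len (word (i # js)) \<le> Suc (len (word js))"
    unfolding word_Cons using len_step(2,3)[of i "word js"] calculation by linarith
  ultimately show ?case by (simp del: word_Cons)
qed simp

text \<open>If the tail already has length equal to its geometric length but the whole word has not,
  the first letter is a descent of the tail, and \<open>exchange\<close> removes a letter while
  absorbing that first one.\<close>

lemma deletion:
  "js \<in> lists I \<Longrightarrow> len (word js) \<noteq> length js \<Longrightarrow> \<exists>ks\<in>lists I. word ks = word js \<and> length ks < length js"
proof (induction js)
  case (Cons i js)
  then have i: "i \<in> I" "js \<in> lists I" by auto
  show ?case
  proof (cases "len (word js) = length js")
    case True
    then have d: "descent i (word js)"
      using Cons.prems(2) len_step(2)[OF i(1) word_aff_auts[OF i(2)]] by (metis length_Cons word_Cons)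
    then obtain xs j ys where "js = xs @ j # ys" "s i \<circ> word js = word (xs @ ys)"
      using exchange[OF i(2,1)] unfolding descent_def by blast
    then show ?thesis using i by (intro bexI[of _ "xs @ ys"]) auto
  next
    case False
    then obtain ks where "ks \<in> lists I" "word ks = word js" "length ks < length js" using Cons.IH i by blast
    then show ?thesis using i by (intro bexI[of _ "i # ks"]) auto
  qed
qed simp

lemma ex_len_word:
  assumes "js \<in> lists I"
  obtains ks where "ks \<in> lists I" "word ks = word js" "length ks = len (word js)"
proof -
  obtain ks where k: "ks \<in> lists I" "word ks = word js"
    "\<And>ls. ls \<in> lists I \<Longrightarrow> word ls = word js \<Longrightarrow> length ks \<le> length ls"
    using ex_has_least_nat[of "\<lambda>ks. ks \<in> lists I \<and> word ks = word js" js length] assms by blast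
  then have "len (word ks) = length ks" using deletion[OF k(1)] by (metis not_le)
  then show ?thesis using that k by metis
qed

lemma reduced_word_iff: "reduced_word js \<longleftrightarrow> js \<in> lists I \<and> len (word js) = length js"
proof
  assume r: "reduced_word js"
  then have js: "js \<in> lists I" by (simp add: reduced_word_def)
  then obtain ks where "ks \<in> lists I" "word ks = word js" "length ks = len (word js)" by (rule ex_len_word)
  then show "js \<in> lists I \<and> len (word js) = length js"
    using r len_word_le[OF js] unfolding reduced_word_def by fastforce
next
  assume "js \<in> lists I \<and> len (word js) = length js"
  then show "reduced_word js" unfolding reduced_word_def using len_word_le by metis
qed

text \<open>Take a word returning the reflected base point to the alcove. The path of the inverse
  word ends in the alcove of the reflected base point, so it crosses the mirror. At that crossing
  the reflection is a conjugate of a simple reflection by a prefix of the word.\<close>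

lemma reflection_word:
  assumes "\<beta> \<in> R" shows "aff_reflection \<beta> k \<in> word ` lists I"
proof -
  let ?r = "aff_reflection \<beta> k" and ?b = base_point
  have rA: "?r \<in> aff_auts" by (rule aff_reflection_aff_auts[OF assms])
  have rr: "?r ?b \<in> regular_points" by (rule aff_auts_regular[OF rA base_point_regular])
  obtain js where js: "js \<in> lists I" "word js (?r ?b) \<in> fund_alcove" using regular_in_word_alcove[OF rr] by blast
  let ?w = "word (rev js)"
  have rj: "rev js \<in> lists I" using js by auto
  have wA: "?w \<in> aff_auts" using rj by (rule word_aff_auts)
  have "?w (word js (?r ?b)) = ?r ?b" using js by (simp add: word_rev word_aff_auts)
  then have "seps (?r ?b) (?w ?b) = {}"
    using aff_auts_seps[OF wA, of "word js (?r ?b)" ?b] fund_alcove_not_separated[OF js(2) base_point_in] by simp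
  then have "seps ?b (?w ?b) = seps ?b (?r ?b)"
    using seps_triangle[OF base_point_regular rr aff_auts_regular[OF wA base_point_regular]] by simp
  moreover have "hyperplane \<beta> k \<in> seps ?b (?r ?b)"
  proof -
    have "?b \<bullet> \<beta> - of_int k \<noteq> 0" using base_point_regular assms by (simp add: regular_iff)
    moreover have "?r ?b \<bullet> \<beta> - of_int k = - (?b \<bullet> \<beta> - of_int k)"
      using coroot_inner_self[OF root_nonzero[OF assms]] by (simp add: inner_aff_reflection)
    ultimately show ?thesis unfolding seps_iff[OF assms]
      by (auto simp: mult_less_0_iff)
  qed
  ultimately obtain xs j ys where k: "rev js = xs @ j # ys" "hyperplane \<beta> k = word xs ` wall_plane j"
    using seps_word[OF rj, of "hyperplane \<beta> k"] by auto
  have j: "j \<in> I" "xs \<in> lists I" using rj k(1) by auto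
  have "?r \<circ> word xs = word xs \<circ> s j" by (rule reflection_conj[OF word_aff_auts[OF j(2)] j(1) assms k(2)])
  then have "?r \<circ> word xs \<circ> inv (word xs) = word xs \<circ> s j \<circ> inv (word xs)" by simp
  then have "?r = word (xs @ j # rev xs)"
    using word_aff_auts[OF j(2)] by (simp add: word_append word_rev[OF j(2)] fun_eq_iff)
  moreover have "xs @ j # rev xs \<in> lists I" using j by auto
  ultimately show ?thesis by (metis imageI)
qed

section \<open>The affine Weyl group as the set of words\<close>

lemma s_in_W: "i \<in> I \<Longrightarrow> s i \<in> W"
proof -
  assume i: "i \<in> I"
  have "s i \<in> {aff_reflection \<beta> k | \<beta> k. \<beta> \<in> R}"
    using wall_root_in_R[OF i] by (auto simp: s_reflection)
  then have "s i \<circ> id \<in> W" unfolding W_def by (intro generated.intros)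
  then show ?thesis by simp
qed

lemma generated_mono_comp: "f \<in> generated S \<Longrightarrow> g \<in> generated S \<Longrightarrow> f \<circ> g \<in> generated S"
  by (induction f rule: generated.induct) (auto simp: comp_assoc intro: generated.intros)

lemma W_eq_words: "W = word ` lists I"
proof
  show "W \<subseteq> word ` lists I"
  proof
    fix w assume "w \<in> W"
    then show "w \<in> word ` lists I" unfolding W_def
    proof (induction w rule: generated.induct)
      case generated_id
      show ?case by (rule image_eqI[of _ _ "[]"]) simp_all
    next
      case (generated_comp f g)
      then have "f \<in> word ` lists I" using reflection_word by auto
      then obtain js where js: "js \<in> lists I" "f = word js" by blast
      obtain ks where ks: "ks \<in> lists I" "g = word ks" using generated_comp by blast
      have "f \<circ> g = word (js @ ks)" "js @ ks \<in> lists I" using js ks by (simp_all add: word_append)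
      then show ?case by (intro image_eqI)
    qed
  qed
  have "word js \<in> W" if "js \<in> lists I" for js
    using that
  proof (induction js)
    case Nil
    show ?case unfolding W_def word_Nil by (rule generated_id)
  next
    case (Cons i js)
    then have "s i \<in> W" "word js \<in> W" using s_in_W by auto
    then show ?case unfolding word_Cons W_def by (rule generated_mono_comp)
  qed
  then show "word ` lists I \<subseteq> W" by blast
qed

lemma WE:
  assumes "w \<in> W"
  obtains js where "reduced_word js" "word js = w" "length js = len w"
proof -
  obtain ls where ls: "ls \<in> lists I" and "w = word ls" using assms W_eq_words by blast
  obtain ks where ks: "ks \<in> lists I" "word ks = word ls" "length ks = len (word ls)"
    using ls by (rule ex_len_word)
  show ?thesis by (rule that[of ks]) (use ks \<open>w = word ls\<close> in \<open>simp_all add: reduced_word_iff\<close>)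
qed

lemma W_aff_auts: "w \<in> W \<Longrightarrow> w \<in> aff_auts"
  unfolding W_eq_words by (elim imageE) (simp add: word_aff_auts)
lemma id_in_W: "id \<in> W" by (simp add: W_def generated_id)
lemma comp_in_W: "u \<in> W \<Longrightarrow> v \<in> W \<Longrightarrow> u \<circ> v \<in> W" unfolding W_def by (rule generated_mono_comp)
lemma word_in_W: "js \<in> lists I \<Longrightarrow> word js \<in> W" unfolding W_eq_words by (rule imageI)
lemma inv_in_W: "w \<in> W \<Longrightarrow> inv w \<in> W"
proof -
  assume "w \<in> W"
  then obtain js where js: "js \<in> lists I" "w = word js" using W_eq_words by blast
  have "rev js \<in> lists I" using js(1) by auto
  then have "word (rev js) \<in> W" by (rule word_in_W)
  then show ?thesis using word_rev[OF js(1)] js(2) by simp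
qed

lemma len_0_id: "w \<in> W \<Longrightarrow> len w = 0 \<Longrightarrow> w = id"
proof -
  assume w: "w \<in> W" "len w = 0"
  obtain js where "word js = w" "length js = len w" using w(1) by (rule WE)
  then show ?thesis using w(2) by simp
qed

text \<open>No hyperplane then separates \<open>base_point\<close> from its image, so the length is
  0.\<close>

lemma W_alcove_id: "w \<in> W \<Longrightarrow> w x \<in> fund_alcove \<Longrightarrow> x \<in> fund_alcove \<Longrightarrow> w = id"
proof -
  assume w: "w \<in> W" and x: "w x \<in> fund_alcove" "x \<in> fund_alcove"
  have A: "w \<in> aff_auts" using w by (rule W_aff_auts)
  have "seps (w x) (w base_point) = {}"
    using aff_auts_seps[OF A, of x base_point] fund_alcove_not_separated[OF x(2) base_point_in] by simp
  moreover have "seps base_point (w x) = {}" using fund_alcove_not_separated[OF base_point_in x(1)] .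
  ultimately have "seps base_point (w base_point) = {}"
    using seps_triangle[OF base_point_regular aff_auts_regular[OF A] aff_auts_regular[OF A base_point_regular], of x]
      x(2) fund_alcove_regular by auto
  then show ?thesis using len_0_id[OF w] by (simp add: len_def)
qed

section \<open>The closed alcove as a strict fundamental domain\<close>

definition closed_alcove :: "'a set" where
  "closed_alcove = {x. \<forall>i\<in>I. wall i x \<ge> 0}"

lemma ex_descent:
  assumes "w \<in> W" "w \<noteq> id"
  obtains i where "i \<in> I" "descent i w"
proof -
  have "w base_point \<notin> fund_alcove" using W_alcove_id[OF assms(1) _ base_point_in] assms(2) by blast
  then show ?thesis
    using not_fund_alcove_separated[OF base_point_in aff_auts_regular[OF W_aff_auts[OF assms(1)] base_point_regular]]
      that unfolding descent_def by blast
qed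

lemma wall_convex_comb: "wall i ((1 - t) *\<^sub>R x + t *\<^sub>R y) = (1 - t) * wall i x + t * wall i y"
  by (simp add: wall_def inner_add_left algebra_simps)

lemma closed_alcove_comb:
  assumes "p \<in> closed_alcove" "0 < t" "t \<le> 1" "x \<in> fund_alcove"
  shows "(1 - t) *\<^sub>R p + t *\<^sub>R x \<in> fund_alcove"
  using assms by (auto simp: closed_alcove_def fund_alcove_iff wall_convex_comb intro!: add_nonneg_pos)

text \<open>Apart from \<open>p\<close> itself, the segment from \<open>p\<close> to
  \<open>base_point\<close> lies in the open alcove, so its image consists of regular points. A
  change from positive to negative of \<open>wall i\<close> along the image would put one of them on
  a hyperplane.\<close>

lemma descent_wall_nonpos:
  assumes w: "w \<in> aff_auts" and i: "i \<in> I" and d: "descent i w" and p: "p \<in> closed_alcove"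
  shows "wall i (w p) \<le> 0"
proof (rule ccontr)
  let ?b = base_point
  assume "\<not> ?thesis"
  then have a: "wall i (w p) > 0" by simp
  have b: "wall i (w ?b) < 0" using d i by (simp add: descent_iff)
  define t where "t = wall i (w p) / (wall i (w p) - wall i (w ?b))"
  have t: "0 < t" "t \<le> 1" using a b by (auto simp: t_def divide_simps)
  have "t * (wall i (w p) - wall i (w ?b)) = wall i (w p)" using a b by (simp add: t_def)
  then have "(1 - t) * wall i (w p) + t * wall i (w ?b) = 0" by (simp add: algebra_simps)
  then have "wall i (w ((1 - t) *\<^sub>R p + t *\<^sub>R ?b)) = 0"
    by (simp add: aff_auts_convex_comb[OF w] wall_convex_comb)
  then have "w ((1 - t) *\<^sub>R p + t *\<^sub>R ?b) \<in> wall_plane i" by (simp add: wall_plane_iff)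
  moreover have "w ((1 - t) *\<^sub>R p + t *\<^sub>R ?b) \<in> regular_points"
    using closed_alcove_comb[OF p t base_point_in] fund_alcove_regular aff_auts_regular[OF w] by blast
  ultimately show False using wall_plane_in[OF i] by (auto simp: regular_points_def)
qed

text \<open>A left descent of \<open>w\<close> separates \<open>C\<^sub>0\<close> from \<open>w C\<^sub>0\<close>, so every point of the closed alcove
  that \<open>w\<close> maps into the closed alcove lands on that wall.\<close>

lemma strict_fundamental_domain:
  assumes "w \<in> W" "F \<subseteq> closed_alcove" "w ` F \<subseteq> closed_alcove"
  shows "(\<forall>p\<in>F. w p = p) \<and> (\<exists>js\<in>lists {i\<in>I. F \<subseteq> wall_plane i}. word js = w)"
  using assms
proof (induction "len w" arbitrary: w rule: less_induct)
  case less
  show ?case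
  proof (cases "w = id")
    case True
    then show ?thesis by (auto intro: bexI[of _ "[]"])
  next
    case False
    obtain i where i: "i \<in> I" "descent i w" using ex_descent[OF less.prems(1) False] by blast
    have A: "w \<in> aff_auts" using less.prems(1) by (rule W_aff_auts)
    have on: "w p \<in> wall_plane i" if "p \<in> F" for p
    proof -
      have "wall i (w p) \<le> 0" using descent_wall_nonpos[OF A i] less.prems(2) that by blast
      moreover have "wall i (w p) \<ge> 0" using less.prems(3) that i(1) by (auto simp: closed_alcove_def)
      ultimately show ?thesis by (simp add: wall_plane_iff)
    qed
    have eq: "(s i \<circ> w) p = w p" if "p \<in> F" for p using on[OF that] s_fixes[OF i(1)] by simp
    have "len (s i \<circ> w) < len w" using len_step(3)[OF i(1) A i(2)] by simp
    moreover have "s i \<circ> w \<in> W" using comp_in_W s_in_W i less.prems(1) by blast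
    moreover have "(s i \<circ> w) ` F \<subseteq> closed_alcove" using eq less.prems(3) by auto
    ultimately have IH: "(\<forall>p\<in>F. (s i \<circ> w) p = p)" "\<exists>js\<in>lists {i\<in>I. F \<subseteq> wall_plane i}. word js = s i \<circ> w"
      using less.hyps less.prems(2) by blast+
    have fixes_F: "w p = p" if "p \<in> F" for p using IH(1) eq that by metis
    obtain js where js: "js \<in> lists {i\<in>I. F \<subseteq> wall_plane i}" "word js = s i \<circ> w" using IH(2) by blast
    have "word (i # js) = w" using js(2) i(1) by simp
    moreover have "F \<subseteq> wall_plane i" using on fixes_F by force
    ultimately show ?thesis using fixes_F js(1) i(1) by (intro conjI ballI bexI[of _ "i # js"]) auto
  qed
qed

end

section \<open>Vertices of the Coxeter complex\<close>

context root_datum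
begin

lemma I0_D: "i \<in> I0 \<Longrightarrow> i \<in> I \<and> i \<noteq> 0"
  by (auto simp: I_def intro: ccontr)

lemma wall_fund_vertex:
  assumes "i \<in> I" "j \<in> I"
  shows "wall i (fund_vertex j) = (if i = j then 1 / mark j else 0)"
proof -
  consider "j = 0" | "j \<in> I0" "j \<noteq> 0" "i = 0" | "j \<in> I0" "j \<noteq> 0" "i \<noteq> 0" "i \<in> I0"
    using I_cases assms by blast
  then show ?thesis
  proof cases
    case 1
    then show ?thesis by (simp add: wall_def fund_vertex_def mark_def)
  next
    case 2
    then have "mark j \<noteq> 0" using mark_pos[of j] assms by simp
    then show ?thesis using 2 mark_inner[OF 2(1)] by (simp add: wall_def fund_vertex_def inner_commute)
  next
    case 3
    then show ?thesis by (simp add: wall_def fund_vertex_def fund_coweight_inner)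
  qed
qed

lemma fund_vertex_closed_alcove: "j \<in> I \<Longrightarrow> fund_vertex j \<in> closed_alcove"
  using mark_pos[of j] by (simp add: closed_alcove_def wall_fund_vertex)

lemma fund_vertex_on_wall: "i \<in> I \<Longrightarrow> j \<in> I \<Longrightarrow> fund_vertex j \<in> wall_plane i \<longleftrightarrow> i \<noteq> j"
  using mark_pos[of j] by (auto simp: wall_plane_iff wall_fund_vertex)

lemma fund_vertex_inj: "inj_on fund_vertex I"
  by (rule inj_onI) (metis fund_vertex_on_wall)

lemma fund_vertex_0 [simp]: "fund_vertex 0 = 0" by (simp add: fund_vertex_def)

text \<open>Together with \<open>fund_vertex_expansion\<close> this says that the products of mark
  and wall function are the barycentric coordinates with respect to the vertices of the
  alcove.\<close>

lemma sum_mark_wall: "(\<Sum>i\<in>I. mark i * wall i x) = 1"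
proof -
  have "(\<Sum>i\<in>I0. mark i * wall i x) = (\<Sum>i\<in>I0. (x \<bullet> \<alpha> i) * (highest_root \<bullet> fund_coweight i))"
    by (intro sum.cong) (auto simp: mark_inner wall_def)
  then show ?thesis
    by (simp add: I_def finite_I0 mark_def wall_def inner_expansion[of x highest_root, symmetric])
qed

lemma fund_vertex_expansion: "x = (\<Sum>i\<in>I. (mark i * wall i x) *\<^sub>R fund_vertex i)"
proof -
  have "(\<Sum>i\<in>I0. (mark i * wall i x) *\<^sub>R fund_vertex i) = (\<Sum>i\<in>I0. (x \<bullet> \<alpha> i) *\<^sub>R fund_coweight i)"
  proof (rule sum.cong)
    fix i assume i: "i \<in> I0"
    then have "i \<noteq> 0" "mark i \<noteq> 0" using mark_pos[of i] I0_D by auto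
    then show "(mark i * wall i x) *\<^sub>R fund_vertex i = (x \<bullet> \<alpha> i) *\<^sub>R fund_coweight i"
      by (simp add: wall_def fund_vertex_def)
  qed simp
  then show ?thesis by (simp add: I_def finite_I0 coweight_expansion[of x, symmetric])
qed

lemma closure_fund_alcove: "closure fund_alcove = closed_alcove"
proof
  have "closed {x. wall i x \<ge> 0}" for i
    unfolding wall_def by (cases "i = 0") (auto intro!: closed_Collect_le continuous_intros)
  then have "closed (\<Inter>i\<in>I. {x. wall i x \<ge> 0})" by (intro closed_INT) auto
  moreover have "closed_alcove = (\<Inter>i\<in>I. {x. wall i x \<ge> 0})" by (auto simp: closed_alcove_def)
  moreover have "fund_alcove \<subseteq> closed_alcove" by (auto simp: closed_alcove_def fund_alcove_iff intro: less_imp_le)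
  ultimately show "closure fund_alcove \<subseteq> closed_alcove" by (simp add: closure_minimal)
  show "closed_alcove \<subseteq> closure fund_alcove"
  proof
    fix p assume p: "p \<in> closed_alcove"
    show "p \<in> closure fund_alcove" unfolding closure_approachable
    proof (intro allI impI)
      fix e :: real assume e: "e > 0"
      \<comment> \<open>The added 1 avoids division by zero and makes the final distance strictly
        smaller than \<open>e\<close>.\<close>
      define t where "t = min 1 (e / (1 + norm (base_point - p)))"
      have n: "1 + norm (base_point - p) > 0" by (smt (verit) norm_ge_zero)
      have t: "0 < t" "t \<le> 1" using e n by (auto simp: t_def)
      have "t \<le> e / (1 + norm (base_point - p))" by (simp add: t_def)
      then have "t * (1 + norm (base_point - p)) \<le> e" using n by (simp add: pos_le_divide_eq)
      then have "t * norm (base_point - p) < e" using t by (simp add: algebra_simps)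
      moreover have "dist ((1 - t) *\<^sub>R p + t *\<^sub>R base_point) p = t * norm (base_point - p)"
      proof -
        have "(1 - t) *\<^sub>R p + t *\<^sub>R base_point - p = t *\<^sub>R (base_point - p)" by (simp add: algebra_simps)
        then show ?thesis using t by (simp add: dist_norm)
      qed
      ultimately show "\<exists>y\<in>fund_alcove. dist y p < e"
        using closed_alcove_comb[OF p t base_point_in] by (intro bexI) auto
    qed
  qed
qed

lemma vertex_of_single_wall:
  assumes x: "x \<in> closed_alcove" and j: "j \<in> I" and z: "\<And>i. i \<in> I \<Longrightarrow> i \<noteq> j \<Longrightarrow> wall i x = 0"
  shows "x = fund_vertex j"
proof -
  have "(\<Sum>i\<in>I. mark i * wall i x) = mark j * wall j x"
    using z j finite_I by (subst sum.remove[of _ j]) (auto intro!: sum.neutral)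
  then have 1: "mark j * wall j x = 1" using sum_mark_wall by simp
  have "(\<Sum>i\<in>I. (mark i * wall i x) *\<^sub>R fund_vertex i) = (mark j * wall j x) *\<^sub>R fund_vertex j"
    using z j finite_I by (subst sum.remove[of _ j]) (auto intro!: sum.neutral)
  then show ?thesis using fund_vertex_expansion[of x] 1 by simp
qed

text \<open>At a vertex all wall functions but one vanish; being nonnegative, they then vanish at
  both ends of any segment through it, so the segment is degenerate. At a point with two positive
  barycentric coordinates one can move both ways along the edge direction between the two vertices,
  by at most the smaller coordinate.\<close>

lemma extreme_points_closed_alcove: "{v. v extreme_point_of closed_alcove} = fund_vertex ` I"
proof (intro equalityI subsetI)
  fix v assume "v \<in> fund_vertex ` I"
  then obtain j where j: "j \<in> I" "v = fund_vertex j" by blast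
  have "v \<notin> open_segment a b" if ab: "a \<in> closed_alcove" "b \<in> closed_alcove" for a b
  proof
    assume "v \<in> open_segment a b"
    then obtain u where u: "0 < u" "u < 1" "v = (1 - u) *\<^sub>R a + u *\<^sub>R b" and ne: "a \<noteq> b"
      by (auto simp: in_segment)
    have z: "wall i a = 0 \<and> wall i b = 0" if i: "i \<in> I" "i \<noteq> j" for i
    proof -
      have "(1 - u) * wall i a + u * wall i b = 0"
        using wall_convex_comb[of i u a b] u(3) wall_fund_vertex[OF i(1) j(1)] i(2) j(2) by simp
      moreover have "wall i a \<ge> 0" "wall i b \<ge> 0" using ab i by (auto simp: closed_alcove_def)
      ultimately show ?thesis using u
        by (smt (verit) mult_nonneg_nonneg mult_pos_pos)
    qed
    then have "a = fund_vertex j" "b = fund_vertex j"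
      using vertex_of_single_wall[OF ab(1) j(1)] vertex_of_single_wall[OF ab(2) j(1)] by simp_all
    then show False using ne by simp
  qed
  then show "v \<in> {v. v extreme_point_of closed_alcove}"
    using fund_vertex_closed_alcove j by (simp add: extreme_point_of_def)
next
  fix x assume "x \<in> {v. v extreme_point_of closed_alcove}"
  then have x: "x \<in> closed_alcove" and ext: "\<And>a b. a \<in> closed_alcove \<Longrightarrow> b \<in> closed_alcove \<Longrightarrow> x \<notin> open_segment a b"
    by (auto simp: extreme_point_of_def)
  have "\<exists>j\<in>I. wall j x \<noteq> 0"
  proof (rule ccontr)
    assume "\<not> ?thesis"
    then have "(\<Sum>i\<in>I. mark i * wall i x) = 0" by (intro sum.neutral) auto
    then show False using sum_mark_wall[of x] by simp
  qed
  then obtain j where j: "j \<in> I" "wall j x \<noteq> 0" by blast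
  then have jp: "wall j x > 0" using x by (force simp: closed_alcove_def)
  have "wall k x = 0" if k: "k \<in> I" "k \<noteq> j" for k
  proof (rule ccontr)
    assume "wall k x \<noteq> 0"
    then have kp: "wall k x > 0" using x k by (force simp: closed_alcove_def)
    define e where "e = min (mark j * wall j x) (mark k * wall k x)"
    have e: "e > 0" using jp kp mark_pos j k by (simp add: e_def)
    define d where "d = fund_vertex j - fund_vertex k"
    have wd: "wall i (x + c *\<^sub>R d) = wall i x + c * (wall i (fund_vertex j) - wall i (fund_vertex k))" for i c
      by (simp add: wall_def d_def inner_add_left inner_diff_left algebra_simps)
    have bnd: "x + c *\<^sub>R d \<in> closed_alcove" if c: "\<bar>c\<bar> = e" for c
    proof -
      have "wall i (x + c *\<^sub>R d) \<ge> 0" if i: "i \<in> I" for i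
      proof -
        have e1: "e / mark j \<le> wall j x" "e / mark k \<le> wall k x"
          using mark_pos[OF j(1)] mark_pos[OF k(1)] by (auto simp: e_def field_simps min_le_iff_disj)
        have c1: "\<bar>c / mark j\<bar> \<le> wall j x" "\<bar>c / mark k\<bar> \<le> wall k x"
          using e1 c mark_pos[OF j(1)] mark_pos[OF k(1)] by simp_all
        have "wall i x \<ge> 0" using x i by (auto simp: closed_alcove_def)
        moreover have "wall j x + c / mark j \<ge> 0" "wall k x - c / mark k \<ge> 0"
          using c1 unfolding abs_le_iff by linarith+
        ultimately show ?thesis using k unfolding wd wall_fund_vertex[OF i j(1)] wall_fund_vertex[OF i k(1)]
          by auto
      qed
      then show ?thesis by (simp add: closed_alcove_def)
    qed
    have "x + e *\<^sub>R d \<noteq> x + (- e) *\<^sub>R d"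
    proof -
      have "d \<noteq> 0" using inj_onD[OF fund_vertex_inj _ j(1) k(1)] k(2) by (auto simp: d_def)
      moreover have "x + e *\<^sub>R d - (x + (- e) *\<^sub>R d) = (2 * e) *\<^sub>R d"
        using scaleR_add_left[of e e d] by simp
      ultimately show ?thesis using e by force
    qed
    moreover have "x = (1 - 1/2) *\<^sub>R (x + e *\<^sub>R d) + (1/2) *\<^sub>R (x + (- e) *\<^sub>R d)"
    proof -
      have "(1 - 1/2) *\<^sub>R (x + e *\<^sub>R d) + (1/2) *\<^sub>R (x + (- e) *\<^sub>R d)
          = (1/2) *\<^sub>R ((x + e *\<^sub>R d) + (x + (- e) *\<^sub>R d))"
        unfolding scaleR_add_right by simp
      also have "(x + e *\<^sub>R d) + (x + (- e) *\<^sub>R d) = x + x" by simp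
      finally show ?thesis by (simp only: scaleR_half_double)
    qed
    ultimately have "x \<in> open_segment (x + e *\<^sub>R d) (x + (- e) *\<^sub>R d)"
      unfolding in_segment by (intro conjI exI[of _ "1/2"]) auto
    then show False using ext bnd[of e] bnd[of "- e"] e by simp
  qed
  then have "x = fund_vertex j" using vertex_of_single_wall x j(1) by blast
  then show "x \<in> fund_vertex ` I" using j(1) by simp
qed

section \<open>Alcoves as translates of the fundamental alcove\<close>

lemma aff_auts_extreme_points:
  assumes f: "f \<in> aff_auts"
  shows "{v. v extreme_point_of closure (f ` S)} = f ` {v. v extreme_point_of closure S}"
proof -
  from f obtain A b where A: "linear A" "\<And>x y. A x \<bullet> A y = x \<bullet> y" "\<And>x. f x = A x + b"
    by (rule aff_autsE) blast
  have inj: "inj A" using aff_auts_linear_part_bij[OF A(1,2)] by (rule bij_is_inj)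
  have fS: "f ` T = (+) b ` A ` T" for T using A(3) by (auto simp: image_image add.commute)
  have "closure (f ` S) = (+) b ` A ` closure S"
    unfolding fS closure_translation closure_injective_linear_image[OF A(1) inj] ..
  then have cl: "closure (f ` S) = f ` closure S" by (simp add: fS)
  have injf: "f x = f y \<longleftrightarrow> x = y" for x y
    using bij_is_inj[OF aff_auts_bij[OF f]] by (simp add: inj_eq)
  have "f v \<in> open_segment (f a) (f b) \<longleftrightarrow> v \<in> open_segment a b" for v a b
    by (simp add: in_segment aff_auts_convex_comb[OF f, symmetric] injf)
  then have ep: "f v extreme_point_of f ` T \<longleftrightarrow> v extreme_point_of T" for v T
    by (auto simp: extreme_point_of_def injf)
  show ?thesis unfolding cl
  proof (intro equalityI subsetI)
    fix v assume v: "v \<in> {v. v extreme_point_of f ` closure S}"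
    obtain u where "v = f u" using bij_is_surj[OF aff_auts_bij[OF f]] by blast
    then show "v \<in> f ` {v. v extreme_point_of closure S}" using v ep by simp
  qed (use ep in auto)
qed

lemma convex_fund_alcove: "convex fund_alcove"
  unfolding convex_alt
proof (intro ballI allI impI)
  fix x y :: 'a and u :: real assume x: "x \<in> fund_alcove" and y: "y \<in> fund_alcove" and u: "0 \<le> u \<and> u \<le> 1"
  show "(1 - u) *\<^sub>R x + u *\<^sub>R y \<in> fund_alcove"
  proof (cases "u = 0")
    case True then show ?thesis using x by simp
  next
    case False
    have "x \<in> closed_alcove" using x closure_fund_alcove closure_subset by blast
    then show ?thesis using closed_alcove_comb[OF _ _ _ y] u False by simp
  qed
qed

lemma connected_alcove: "f \<in> aff_auts \<Longrightarrow> connected (f ` fund_alcove)"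
proof -
  assume f: "f \<in> aff_auts"
  have "convex (f ` fund_alcove)" unfolding convex_alt
    by (auto simp: aff_auts_convex_comb[OF f, symmetric] intro!: imageI convex_fund_alcove[unfolded convex_alt, rule_format])
  then show ?thesis by (rule convex_connected)
qed

lemma aff_auts_fund_alcove:
  assumes g: "g \<in> aff_auts" and x: "x \<in> fund_alcove" "g x \<in> fund_alcove"
  shows "g ` fund_alcove = fund_alcove"
proof -
  have sub: "h y \<in> fund_alcove" if h: "h \<in> aff_auts" "z \<in> fund_alcove" "h z \<in> fund_alcove" "y \<in> fund_alcove" for h y z
  proof (rule ccontr)
    assume n: "h y \<notin> fund_alcove"
    have "h y \<in> regular_points" using aff_auts_regular[OF h(1)] h(4) fund_alcove_regular by blast
    then obtain i where "wall_plane i \<in> seps (h z) (h y)"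
      using not_fund_alcove_separated[OF h(3) _ n] by blast
    then show False using aff_auts_seps[OF h(1), of z y] fund_alcove_not_separated[OF h(2,4)] by simp
  qed
  have 1: "g ` fund_alcove \<subseteq> fund_alcove" using sub[OF g x] by blast
  have "inv g y \<in> fund_alcove" if "y \<in> fund_alcove" for y
    using sub[OF inv_aff_auts[OF g] x(2) _ that] g x by simp
  then have "fund_alcove \<subseteq> g ` fund_alcove" using aff_auts_f_inv[OF g] by (metis image_eqI subsetI)
  then show ?thesis using 1 by blast
qed

text \<open>Some word brings the image of the base point back to the alcove. Applied to translations
  this yields the elements of \<open>G\<close>, applied to negation the opposition
  involution.\<close>

lemma aff_auts_decomp:
  assumes f: "f \<in> aff_auts"
  obtains w g where "w \<in> W" "g \<in> aff_auts" "g ` fund_alcove = fund_alcove" "f = w \<circ> g"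
proof -
  obtain js where js: "js \<in> lists I" "word js (f base_point) \<in> fund_alcove"
    using regular_in_word_alcove[OF aff_auts_regular[OF f base_point_regular]] by blast
  have wA: "word js \<in> aff_auts" and gA: "word js \<circ> f \<in> aff_auts"
    using word_aff_auts[OF js(1)] comp_aff_auts f by auto
  show ?thesis
  proof (rule that)
    show "inv (word js) \<in> W" using inv_in_W word_in_W js by simp
    show "word js \<circ> f \<in> aff_auts" by (rule gA)
    show "(word js \<circ> f) ` fund_alcove = fund_alcove"
      by (rule aff_auts_fund_alcove[OF gA base_point_in]) (use js in simp)
    show "f = inv (word js) \<circ> (word js \<circ> f)" using wA by (simp add: fun_eq_iff)
  qed
qed

lemma regular_points_eq: "UNIV - (\<Union>\<beta>\<in>R. \<Union>k. hyperplane \<beta> k) = regular_points"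
  by (auto simp: regular_points_def hyperplanes_def)

text \<open>Connected because convex. Maximal because a connected set of regular points leaving the
  alcove would have points on both sides of one of its walls and hence meet that hyperplane.\<close>

lemma alcove_component:
  assumes w: "w \<in> aff_auts" shows "w ` fund_alcove \<in> components regular_points"
  unfolding in_components_maximal
proof (intro conjI allI impI)
  show "w ` fund_alcove \<noteq> {}" using fund_alcove_nonempty by blast
  show "w ` fund_alcove \<subseteq> regular_points" using aff_auts_regular[OF w] fund_alcove_regular by blast
  show "connected (w ` fund_alcove)" using w by (rule connected_alcove)
  fix d assume d: "d \<noteq> {} \<and> w ` fund_alcove \<subseteq> d \<and> d \<subseteq> regular_points \<and> connected d"
  have "y \<in> w ` fund_alcove" if y: "y \<in> d" for y
  proof (rule ccontr)
    assume n: "y \<notin> w ` fund_alcove"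
    have yr: "y \<in> regular_points" using d y by blast
    have "inv w y \<notin> fund_alcove" using n aff_auts_f_inv[OF w, of y] by (metis imageI)
    moreover have "inv w y \<in> regular_points" using aff_auts_regular[OF inv_aff_auts[OF w] yr] .
    ultimately obtain i where i: "i \<in> I" "wall_plane i \<in> seps base_point (inv w y)"
      using not_fund_alcove_separated[OF base_point_in] by blast
    have H: "w ` wall_plane i \<in> seps (w base_point) y"
      using aff_auts_image_seps[OF w, of base_point "inv w y"] i(2) w by auto
    obtain \<beta> k where b: "\<beta> \<in> R" "w ` wall_plane i = hyperplane \<beta> k"
      using aff_auts_image_hyperplanes[OF w wall_plane_in[OF i(1)]] by (rule hyperplanesE)
    have m: "(w base_point \<bullet> \<beta> - of_int k) * (y \<bullet> \<beta> - of_int k) < 0"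
      using H unfolding b(2) seps_iff[OF b(1)] .
    have wd: "w base_point \<in> d" using d base_point_in by blast
    have "\<exists>z\<in>d. \<beta> \<bullet> z = of_int k"
    proof (cases "w base_point \<bullet> \<beta> < of_int k")
      case True
      then show ?thesis using m connected_ivt_hyperplane[of d "w base_point" y \<beta> "of_int k"] d wd y
        by (auto simp: mult_less_0_iff inner_commute)
    next
      case False
      then show ?thesis using m connected_ivt_hyperplane[of d y "w base_point" \<beta> "of_int k"] d wd y
        by (auto simp: mult_less_0_iff inner_commute)
    qed
    then obtain z where z: "z \<in> d" "z \<bullet> \<beta> = of_int k" by (auto simp: inner_commute)
    then have "z \<in> regular_points" using d by blast
    then show False using z(2) b(1) by (simp add: regular_iff)
  qed
  then show "d = w ` fund_alcove" using d by blast
qed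

lemma alcoves_eq: "alcoves = {w ` fund_alcove | w. w \<in> W}"
proof (intro equalityI subsetI)
  fix K assume "K \<in> alcoves"
  then have K: "K \<in> components regular_points" by (simp add: alcoves_def regular_points_eq)
  then obtain x where x: "x \<in> K" "x \<in> regular_points"
    using in_components_nonempty in_components_subset by blast
  then obtain js where js: "js \<in> lists I" "word js x \<in> fund_alcove" using regular_in_word_alcove by blast
  let ?w = "inv (word js)"
  have wW: "?w \<in> W" using inv_in_W word_in_W js by simp
  have "?w (word js x) = x" using word_aff_auts[OF js(1)] by simp
  then have "x \<in> ?w ` fund_alcove" using js(2) by (metis imageI)
  then have "K = ?w ` fund_alcove"
    using components_nonoverlap[OF K alcove_component[OF W_aff_auts[OF wW]]] x by blast
  then show "K \<in> {w ` fund_alcove | w. w \<in> W}" using wW by blast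
next
  fix K assume "K \<in> {w ` fund_alcove | w. w \<in> W}"
  then show "K \<in> alcoves" unfolding alcoves_def regular_points_eq
    using alcove_component W_aff_auts by blast
qed

lemma alcove_vertices:
  "f \<in> aff_auts \<Longrightarrow> {v. v extreme_point_of closure (f ` fund_alcove)} = f ` fund_vertex ` I"
  by (simp add: aff_auts_extreme_points closure_fund_alcove extreme_points_closed_alcove)

lemma coxeter_complex_eq: "coxeter_complex = {t. \<exists>w\<in>W. t \<subseteq> w ` fund_vertex ` I}"
proof -
  have "(\<exists>K\<in>alcoves. t \<subseteq> {v. v extreme_point_of (closure K)}) \<longleftrightarrow> (\<exists>w\<in>W. t \<subseteq> w ` fund_vertex ` I)" for t
  proof
    assume "\<exists>K\<in>alcoves. t \<subseteq> {v. v extreme_point_of (closure K)}"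
    then obtain w where w: "w \<in> W" "t \<subseteq> {v. v extreme_point_of (closure (w ` fund_alcove))}"
      unfolding alcoves_eq by blast
    then show "\<exists>w\<in>W. t \<subseteq> w ` fund_vertex ` I"
      unfolding alcove_vertices[OF W_aff_auts[OF w(1)]] by blast
  next
    assume "\<exists>w\<in>W. t \<subseteq> w ` fund_vertex ` I"
    then obtain w where w: "w \<in> W" "t \<subseteq> w ` fund_vertex ` I" by blast
    then have "t \<subseteq> {v. v extreme_point_of (closure (w ` fund_alcove))}"
      unfolding alcove_vertices[OF W_aff_auts[OF w(1)]] by blast
    then show "\<exists>K\<in>alcoves. t \<subseteq> {v. v extreme_point_of (closure K)}"
      unfolding alcoves_eq using w(1) by blast
  qed
  then show ?thesis by (simp add: coxeter_complex_def)
qed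

lemma vertices_coxeter_complex: "\<Union>coxeter_complex = {w (fund_vertex i) | w i. w \<in> W \<and> i \<in> I}"
  unfolding coxeter_complex_eq
proof (intro equalityI subsetI)
  fix x assume "x \<in> {w (fund_vertex i) | w i. w \<in> W \<and> i \<in> I}"
  then obtain w i where "w \<in> W" "i \<in> I" "x = w (fund_vertex i)" by blast
  then have "{x} \<in> {t. \<exists>w\<in>W. t \<subseteq> w ` fund_vertex ` I}" by blast
  then show "x \<in> \<Union>{t. \<exists>w\<in>W. t \<subseteq> w ` fund_vertex ` I}" by blast
qed blast

text \<open>The walls through a vertex of the alcove are those of the other nodes, so
  \<open>strict_fundamental_domain\<close> makes the vertex stabiliser the group of words omitting
  one letter. This is the link between residues of the building and distances fixing a
  vertex.\<close>

lemma fund_vertex_conj: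
  assumes "w \<in> W" "i \<in> I" "j \<in> I" "w (fund_vertex i) = fund_vertex j"
  shows "i = j" "\<exists>js\<in>lists (I - {i}). word js = w"
proof -
  have F: "{fund_vertex i} \<subseteq> closed_alcove" "w ` {fund_vertex i} \<subseteq> closed_alcove"
    using assms fund_vertex_closed_alcove by auto
  have fd: "(\<forall>p\<in>{fund_vertex i}. w p = p) \<and>
    (\<exists>js\<in>lists {k\<in>I. {fund_vertex i} \<subseteq> wall_plane k}. word js = w)"
    by (rule strict_fundamental_domain[OF assms(1) F])
  then have "fund_vertex i = fund_vertex j" using assms(4) by simp
  then show "i = j" using inj_onD[OF fund_vertex_inj _ assms(2,3)] by simp
  have "{k\<in>I. {fund_vertex i} \<subseteq> wall_plane k} = I - {i}"
    using fund_vertex_on_wall[OF _ assms(2)] by auto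
  then show "\<exists>js\<in>lists (I - {i}). word js = w" using fd by simp
qed

text \<open>Only one wall contains all vertices except that of node \<open>i\<close>, so the word
  supplied by the fundamental domain uses a single letter.\<close>

lemma fixes_panel:
  assumes w: "w \<in> W" and i: "i \<in> I" and fx: "\<And>k. k \<in> I \<Longrightarrow> k \<noteq> i \<Longrightarrow> w (fund_vertex k) = fund_vertex k"
  shows "w = id \<or> w = s i"
proof -
  let ?F = "fund_vertex ` (I - {i})"
  have F: "?F \<subseteq> closed_alcove" "w ` ?F \<subseteq> closed_alcove"
  proof -
    show "?F \<subseteq> closed_alcove" using fund_vertex_closed_alcove by blast
    then show "w ` ?F \<subseteq> closed_alcove" using fx by force
  qed
  obtain js where js: "js \<in> lists {k\<in>I. ?F \<subseteq> wall_plane k}" "word js = w"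
    using strict_fundamental_domain[OF w F] by blast
  have sub: "{k\<in>I. ?F \<subseteq> wall_plane k} \<subseteq> {i}"
  proof
    fix k assume k: "k \<in> {k\<in>I. ?F \<subseteq> wall_plane k}"
    then have "fund_vertex k \<notin> wall_plane k" using fund_vertex_on_wall by simp
    then show "k \<in> {i}" using k by blast
  qed
  have "js \<in> lists {i}" using lists_mono[OF sub] js(1) by blast
  then have "word js = id \<or> word js = s i"
    by (induction js) (auto simp: i)
  then show ?thesis using js by simp
qed

lemma vertex_type_conj:
  assumes "w \<in> W" "i \<in> I" shows "vertex_type (w (fund_vertex i)) = i"
  unfolding vertex_type_def
proof (rule the_equality)
  show "i \<in> I \<and> (\<exists>u\<in>W. w (fund_vertex i) = u (fund_vertex i))" using assms by blast
  fix j assume "j \<in> I \<and> (\<exists>u\<in>W. w (fund_vertex i) = u (fund_vertex j))"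
  then obtain u where u: "j \<in> I" "u \<in> W" "w (fund_vertex i) = u (fund_vertex j)" by blast
  have "(inv u \<circ> w) (fund_vertex i) = fund_vertex j" using u(3) W_aff_auts[OF u(2)] by simp
  then show "j = i" using fund_vertex_conj(1)[OF comp_in_W[OF inv_in_W[OF u(2)] assms(1)] assms(2) u(1)] by simp
qed

section \<open>The extended affine Weyl group\<close>

lemma P_iff: "v \<in> P \<longleftrightarrow> (\<forall>\<beta>\<in>R. v \<bullet> \<beta> \<in> \<int>)"
proof
  assume "v \<in> P"
  then obtain a :: "nat \<Rightarrow> int" where v: "v = (\<Sum>i\<in>I0. of_int (a i) *\<^sub>R fund_coweight i)" by (auto simp: P_def)
  show "\<forall>\<beta>\<in>R. v \<bullet> \<beta> \<in> \<int>"
  proof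
    fix \<beta> assume b: "\<beta> \<in> R"
    have "fund_coweight i \<bullet> \<beta> \<in> \<int>" if "i \<in> I0" for i
      using root_coefficients(1)[OF b that] by (simp add: inner_commute)
    then show "v \<bullet> \<beta> \<in> \<int>" unfolding v inner_sum_left by (intro Ints_sum) auto
  qed
next
  assume "\<forall>\<beta>\<in>R. v \<bullet> \<beta> \<in> \<int>"
  then have i: "of_int \<lfloor>v \<bullet> \<alpha> i\<rfloor> = v \<bullet> \<alpha> i" if "i \<in> I0" for i
    using simple_root[OF that] by (auto elim!: Ints_cases)
  have "(\<Sum>i\<in>I0. (v \<bullet> \<alpha> i) *\<^sub>R fund_coweight i) = (\<Sum>i\<in>I0. of_int \<lfloor>v \<bullet> \<alpha> i\<rfloor> *\<^sub>R fund_coweight i)"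
    by (intro sum.cong) (simp_all add: i)
  then show "v \<in> P" unfolding P_def using coweight_expansion[of v] by (intro CollectI exI[of _ "\<lambda>i. \<lfloor>v \<bullet> \<alpha> i\<rfloor>"]) simp
qed

lemma translation_aff_auts: "v \<in> P \<Longrightarrow> (\<lambda>x. x + v) \<in> aff_auts"
  by (rule aff_autsI[of id v]) (simp_all add: P_iff linear_id)

lemma uminus_aff_auts: "uminus \<in> aff_auts"
  by (rule aff_autsI[of uminus 0]) (simp_all add: uminus_root linear_uminus)

lemma aff_auts_P:
  assumes "f \<in> aff_auts" "v \<in> P" shows "f v - f 0 \<in> P"
proof -
  from assms(1) obtain A b where f: "linear A" "\<And>x y. A x \<bullet> A y = x \<bullet> y" "A ` R = R"
      "\<And>\<beta>. \<beta> \<in> R \<Longrightarrow> b \<bullet> \<beta> \<in> \<int>" "\<And>x. f x = A x + b"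
    by (rule aff_autsE) blast
  have "f v - f 0 = A v" using f(5) linear_0[OF f(1)] by simp
  moreover have "A v \<bullet> \<beta> \<in> \<int>" if b: "\<beta> \<in> R" for \<beta>
  proof -
    obtain \<gamma> where "\<gamma> \<in> R" "\<beta> = A \<gamma>" using b f(3) by blast
    then show ?thesis using assms(2) f(2) by (simp add: P_iff)
  qed
  ultimately show ?thesis by (simp add: P_iff)
qed

lemma aff_auts_0_P: "f \<in> aff_auts \<Longrightarrow> f 0 \<in> P"
proof -
  assume "f \<in> aff_auts"
  then obtain A b where A: "linear A" "\<And>x y. A x \<bullet> A y = x \<bullet> y" "A ` R = R"
    "\<And>\<beta>. \<beta> \<in> R \<Longrightarrow> b \<bullet> \<beta> \<in> \<int>" "\<And>x. f x = A x + b" by (rule aff_autsE) blast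
  have "f 0 = b" using A(5)[of 0] linear_0[OF A(1)] by simp
  then show ?thesis using A(4) by (simp add: P_iff)
qed

lemma P_add: "u \<in> P \<Longrightarrow> v \<in> P \<Longrightarrow> u + v \<in> P" by (simp add: P_iff inner_add_left)
lemma P_uminus: "u \<in> P \<Longrightarrow> - u \<in> P" by (simp add: P_iff)

lemma aff_auts_linear:
  assumes "w \<in> aff_auts" "w 0 = 0" shows "linear w"
proof -
  from assms(1) obtain A b where A: "linear A" "\<And>x. w x = A x + b" by (rule aff_autsE) blast
  then have "b = 0" using assms(2) linear_0[OF A(1)] by simp
  then have "w = A" using A by auto
  then show ?thesis using A by simp
qed

text \<open>The origin is the vertex of node 0, and its stabiliser is generated by the remaining
  simple reflections.\<close>

lemma W0_eq: "W0 = {w\<in>W. w 0 = 0}"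
proof
  have "w \<in> W \<and> w 0 = 0" if "w \<in> W0" for w
    using that unfolding W0_def
  proof (induction w rule: generated.induct)
    case generated_id
    show ?case by (rule conjI[OF id_in_W id_apply])
  next
    case (generated_comp f g)
    then obtain i where i: "i \<in> I0" "f = s i" by blast
    then have "i \<in> I" "i \<noteq> 0" using I0_D by auto
    then have "f 0 = 0" using s_fixes[of i "fund_vertex 0"] fund_vertex_on_wall[of i 0] i by simp
    moreover have "g \<in> W" "g 0 = 0" using generated_comp by simp_all
    moreover have "f \<circ> g \<in> W" unfolding i(2) by (rule comp_in_W[OF s_in_W[OF \<open>i \<in> I\<close>] \<open>g \<in> W\<close>])
    ultimately show ?case by (simp add: comp_def)
  qed
  then show "W0 \<subseteq> {w\<in>W. w 0 = 0}" by blast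
  have gen: "word js \<in> W0" if "js \<in> lists I0" for js
    using that
  proof (induction js)
    case Nil
    show ?case unfolding W0_def word_Nil by (rule generated_id)
  next
    case (Cons i js)
    then show ?case unfolding W0_def word_Cons by (intro generated.generated_comp) auto
  qed
  show "{w\<in>W. w 0 = 0} \<subseteq> W0"
  proof
    fix w assume "w \<in> {w\<in>W. w 0 = 0}"
    then have w: "w \<in> W" "w (fund_vertex 0) = fund_vertex 0" by auto
    have "\<exists>js\<in>lists (I - {0}). word js = w" by (rule fund_vertex_conj(2)[OF w(1) zero_in_I zero_in_I w(2)])
    moreover have "I - {0} = I0" by (auto simp: I_def)
    ultimately show "w \<in> W0" using gen by auto
  qed
qed

lemma W0_W: "w \<in> W0 \<Longrightarrow> w \<in> W" and W0_fixes: "w \<in> W0 \<Longrightarrow> w 0 = 0"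
  and W0_aff_auts: "w \<in> W0 \<Longrightarrow> w \<in> aff_auts"
  using W_aff_auts by (auto simp: W0_eq)

lemma W0_linear: "w \<in> W0 \<Longrightarrow> linear w"
  using aff_auts_linear W0_aff_auts W0_fixes by blast

lemma W0_comp: "u \<in> W0 \<Longrightarrow> w \<in> W0 \<Longrightarrow> u \<circ> w \<in> W0" by (simp add: W0_eq comp_in_W)

lemma W0_inv: "w \<in> W0 \<Longrightarrow> inv w \<in> W0"
proof -
  assume w: "w \<in> W0"
  have "inv w 0 = 0" using aff_auts_inv_f[OF W0_aff_auts[OF w], of 0] W0_fixes[OF w] by simp
  then show ?thesis using w inv_in_W by (simp add: W0_eq)
qed

lemma W_ext_iff: "f \<in> W_ext \<longleftrightarrow> f 0 \<in> P \<and> (\<lambda>x. f x - f 0) \<in> W0"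
proof
  assume "f \<in> W_ext"
  then obtain v w where f: "v \<in> P" "w \<in> W0" "f = (\<lambda>x. x + v) \<circ> w" by (auto simp: W_ext_def)
  then have "f 0 = v" "(\<lambda>x. f x - f 0) = w" using W0_fixes by auto
  then show "f 0 \<in> P \<and> (\<lambda>x. f x - f 0) \<in> W0" using f by simp
next
  assume a: "f 0 \<in> P \<and> (\<lambda>x. f x - f 0) \<in> W0"
  have "f = (\<lambda>x. x + f 0) \<circ> (\<lambda>x. f x - f 0)" by auto
  then show "f \<in> W_ext" unfolding W_ext_def using a by blast
qed

lemma W_ext_aff_auts: "f \<in> W_ext \<Longrightarrow> f \<in> aff_auts"
  unfolding W_ext_def using comp_aff_auts translation_aff_auts W0_aff_auts by blast

lemma W_extI: "v \<in> P \<Longrightarrow> w \<in> W0 \<Longrightarrow> (\<lambda>x. w x + v) \<in> W_ext"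
  by (simp add: W_ext_iff W0_fixes)

lemma W_extE:
  assumes "f \<in> W_ext"
  obtains v w where "v \<in> P" "w \<in> W0" "\<And>x. f x = w x + v"
proof -
  from assms obtain v w where "v \<in> P" "w \<in> W0" "f = (\<lambda>x. x + v) \<circ> w" unfolding W_ext_def by blast
  then show ?thesis by (intro that[of v w]) simp_all
qed

lemma W_ext_comp:
  assumes "f \<in> W_ext" "g \<in> W_ext" shows "f \<circ> g \<in> W_ext"
proof -
  from assms(1) obtain v w where f: "v \<in> P" "w \<in> W0" "\<And>x. f x = w x + v" by (rule W_extE) blast
  from assms(2) obtain v' w' where g: "v' \<in> P" "w' \<in> W0" "\<And>x. g x = w' x + v'" by (rule W_extE) blast
  have "w v' \<in> P" using aff_auts_P[OF W0_aff_auts[OF f(2)] g(1)] W0_fixes[OF f(2)] by simp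
  then have "(\<lambda>x. (w \<circ> w') x + (w v' + v)) \<in> W_ext" using W_extI P_add f W0_comp g by blast
  moreover have "f \<circ> g = (\<lambda>x. (w \<circ> w') x + (w v' + v))"
    by (simp add: fun_eq_iff f(3) g(3) linear_add[OF W0_linear[OF f(2)]])
  ultimately show ?thesis by simp
qed

lemma W_ext_inv:
  assumes "f \<in> W_ext" shows "inv f \<in> W_ext"
proof -
  from assms obtain v w where f: "v \<in> P" "w \<in> W0" "\<And>x. f x = w x + v" by (rule W_extE) blast
  have wi: "inv w \<in> W0" using W0_inv f by simp
  have "inv w v \<in> P" using aff_auts_P[OF W0_aff_auts[OF wi] f(1)] W0_fixes[OF wi] by simp
  then have "(\<lambda>x. inv w x + - inv w v) \<in> W_ext" using W_extI P_uminus wi by blast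
  moreover have "inv f = (\<lambda>x. inv w x + - inv w v)"
  proof
    fix x
    have "f (inv w x + - inv w v) = x"
      using W0_aff_auts[OF f(2)] by (simp add: f(3) linear_diff[OF W0_linear[OF f(2)]])
    then have "inv f (f (inv w x + - inv w v)) = inv f x" by simp
    then show "inv f x = inv w x + - inv w v"
      using aff_auts_inv_f[OF W_ext_aff_auts[OF assms]] by simp
  qed
  ultimately show ?thesis by simp
qed

lemma W0_subset_W_ext: "w \<in> W0 \<Longrightarrow> w \<in> W_ext"
  using W_extI[of 0 w] by (simp add: P_iff)

text \<open>An affine simple reflection is its linear part followed by translation by a multiple of
  the coroot, and integrality puts the coroot into \<open>P\<close>.\<close>

lemma W_subset_W_ext: "w \<in> W \<Longrightarrow> w \<in> W_ext"
proof -
  have s: "s i \<in> W_ext" if i: "i \<in> I" for i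
  proof -
    let ?b = "wall_root i" and ?k = "if i = 0 then 1 else (0::int)"
    have bR: "?b \<in> R" by (rule wall_root_in_R[OF i])
    have "aff_reflection ?b 0 \<in> W" using reflection_word[OF bR] W_eq_words by simp
    then have "aff_reflection ?b 0 \<in> W0" by (simp add: W0_eq aff_reflection_def)
    moreover have "of_int ?k *\<^sub>R coroot ?b \<in> P"
      using aff_auts_0_P[OF aff_reflection_aff_auts[OF bR, of ?k]] by (simp add: aff_reflection_def split: if_splits)
    ultimately have "(\<lambda>x. aff_reflection ?b 0 x + of_int ?k *\<^sub>R coroot ?b) \<in> W_ext" by (rule W_extI[rotated])
    moreover have "s i = (\<lambda>x. aff_reflection ?b 0 x + of_int ?k *\<^sub>R coroot ?b)"
      unfolding s_reflection by (simp add: fun_eq_iff aff_reflection_def algebra_simps)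
    ultimately show ?thesis by simp
  qed
  have "word js \<in> W_ext" if "js \<in> lists I" for js
    using that
  proof (induction js)
    case Nil
    have "id \<in> W0" by (simp add: W0_eq id_in_W)
    then show ?case unfolding word_Nil by (rule W0_subset_W_ext)
  next
    case (Cons i js)
    then show ?case unfolding word_Cons by (intro W_ext_comp s) auto
  qed
  then show "w \<in> W \<Longrightarrow> w \<in> W_ext" unfolding W_eq_words by auto
qed

lemma W_normal:
  assumes f: "f \<in> aff_auts" and w: "w \<in> W"
  obtains u where "u \<in> W" "f \<circ> w = u \<circ> f"
proof -
  have "\<exists>u\<in>W. f \<circ> word js = u \<circ> f" if "js \<in> lists I" for js
    using that
  proof (induction js)
    case Nil
    then show ?case using id_in_W by (intro bexI[of _ id]) auto
  next
    case (Cons i js)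
    have "\<exists>u\<in>W. f \<circ> word js = u \<circ> f" by (rule Cons.IH)
    then obtain u where u: "u \<in> W" "f \<circ> word js = u \<circ> f" by blast
    have i: "i \<in> I" using Cons by simp
    obtain \<gamma> m where g: "\<gamma> \<in> R" "\<And>x. f (s i x) = aff_reflection \<gamma> m (f x)"
      unfolding s_reflection
      by (rule aff_auts_hyperplane[OF f wall_root_in_R[OF i], of "if i = 0 then 1 else 0"]) blast
    have "aff_reflection \<gamma> m \<in> W" using reflection_word[OF g(1)] W_eq_words by simp
    then have "aff_reflection \<gamma> m \<circ> u \<in> W" using comp_in_W u by blast
    moreover have "f \<circ> word (i # js) = (aff_reflection \<gamma> m \<circ> u) \<circ> f"
      using u(2) g(2) by (simp add: fun_eq_iff)
    ultimately show ?case by blast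
  qed
  then show ?thesis using w that unfolding W_eq_words by auto
qed

lemma W_conj: "f \<in> aff_auts \<Longrightarrow> w \<in> W \<Longrightarrow> f \<circ> w \<circ> inv f \<in> W"
proof -
  assume f: "f \<in> aff_auts" and w: "w \<in> W"
  then obtain u where u: "u \<in> W" "f \<circ> w = u \<circ> f" by (rule W_normal)
  have "f \<circ> w \<circ> inv f = u" using u(2) f by (simp add: fun_eq_iff)
  then show ?thesis using u by simp
qed

section \<open>Symmetries of the alcove and the diagram automorphisms they induce\<close>

definition alcove_auts :: "('a \<Rightarrow> 'a) set" where
  "alcove_auts = {f\<in>aff_auts. f ` fund_alcove = fund_alcove}"

lemma alcove_auts_aff: "f \<in> alcove_auts \<Longrightarrow> f \<in> aff_auts" by (simp add: alcove_auts_def)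

lemma alcove_auts_comp: "f \<in> alcove_auts \<Longrightarrow> g \<in> alcove_auts \<Longrightarrow> f \<circ> g \<in> alcove_auts"
proof -
  assume a: "f \<in> alcove_auts" "g \<in> alcove_auts"
  have "(f \<circ> g) ` fund_alcove = f ` g ` fund_alcove" by (rule image_comp[symmetric])
  then show ?thesis using a comp_aff_auts[of f g] unfolding alcove_auts_def by simp
qed

lemma alcove_auts_inv: "f \<in> alcove_auts \<Longrightarrow> inv f \<in> alcove_auts"
proof -
  assume "f \<in> alcove_auts"
  then have f: "f \<in> aff_auts" "f ` fund_alcove = fund_alcove" by (auto simp: alcove_auts_def)
  have "inv f ` fund_alcove = inv f ` f ` fund_alcove" using f by simp
  also have "\<dots> = fund_alcove" using f(1) by (simp add: image_image)
  finally show ?thesis using f inv_aff_auts by (simp add: alcove_auts_def)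
qed

lemma alcove_auts_W_id: "w \<in> W \<Longrightarrow> w \<in> alcove_auts \<Longrightarrow> w = id"
  using W_alcove_id[OF _ _ base_point_in] base_point_in unfolding alcove_auts_def by blast

text \<open>The diagram automorphism is read off from the vertices, where it is visible at once, and
  not from conjugation of reflections; it is the identity outside \<open>I\<close> so that
  \<open>permutes\<close> can hold.\<close>

definition node_perm :: "('a \<Rightarrow> 'a) \<Rightarrow> nat \<Rightarrow> nat" where
  "node_perm f i = (if i \<in> I then inv_into I fund_vertex (f (fund_vertex i)) else i)"

lemma alcove_auts_vertices: "f \<in> alcove_auts \<Longrightarrow> f ` fund_vertex ` I = fund_vertex ` I"
  using alcove_vertices[of f] alcove_vertices[OF id_aff_auts] by (simp add: alcove_auts_def)

lemma node_perm_in: "f \<in> alcove_auts \<Longrightarrow> i \<in> I \<Longrightarrow> node_perm f i \<in> I"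
  and node_perm_vertex: "f \<in> alcove_auts \<Longrightarrow> i \<in> I \<Longrightarrow> fund_vertex (node_perm f i) = f (fund_vertex i)"
proof -
  assume f: "f \<in> alcove_auts" and i: "i \<in> I"
  then have "f (fund_vertex i) \<in> fund_vertex ` I" using alcove_auts_vertices by blast
  then show "node_perm f i \<in> I" "fund_vertex (node_perm f i) = f (fund_vertex i)"
    using i by (simp_all add: node_perm_def inv_into_into f_inv_into_f)
qed

lemma node_perm_permutes: "f \<in> alcove_auts \<Longrightarrow> node_perm f permutes I"
proof -
  assume f: "f \<in> alcove_auts"
  have "inj_on (node_perm f) I"
  proof (rule inj_onI)
    fix i j assume ij: "i \<in> I" "j \<in> I" "node_perm f i = node_perm f j"
    then have "f (fund_vertex i) = f (fund_vertex j)" using node_perm_vertex[OF f] by metis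
    then have "fund_vertex i = fund_vertex j" using aff_auts_inv_f[OF alcove_auts_aff[OF f]] by metis
    then show "i = j" using fund_vertex_inj ij by (simp add: inj_on_eq_iff)
  qed
  moreover have "node_perm f ` I \<subseteq> I" using node_perm_in[OF f] by blast
  ultimately have "bij_betw (node_perm f) I I"
    using endo_inj_surj[OF finite_I] by (simp add: bij_betw_def)
  then show ?thesis by (rule bij_imp_permutes) (simp add: node_perm_def)
qed

text \<open>Conjugating \<open>s i\<close> by \<open>f\<close> gives a nontrivial element of
  \<open>W\<close> fixing all vertices of the alcove except the image of vertex \<open>i\<close>,
  and \<open>fixes_panel\<close> leaves one possibility.\<close>

lemma node_perm_s:
  assumes f: "f \<in> alcove_auts" and i: "i \<in> I"
  shows "f \<circ> s i = s (node_perm f i) \<circ> f"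
proof -
  have fA: "f \<in> aff_auts" using alcove_auts_aff f .
  let ?w = "f \<circ> s i \<circ> inv f"
  have w: "?w \<in> W" by (rule W_conj[OF fA s_in_W[OF i]])
  have "?w = id \<or> ?w = s (node_perm f i)"
  proof (rule fixes_panel[OF w node_perm_in[OF f i]])
    fix k assume k: "k \<in> I" "k \<noteq> node_perm f i"
    then obtain l where l: "l \<in> I" "k = node_perm f l"
      using permutes_image[OF node_perm_permutes[OF f]] by blast
    then have "l \<noteq> i" using k by blast
    then have "s i (fund_vertex l) = fund_vertex l" using s_fixes[OF i] fund_vertex_on_wall[OF i l(1)] by blast
    then show "?w (fund_vertex k) = fund_vertex k"
      unfolding l(2) node_perm_vertex[OF f l(1)] using fA by simp
  qed
  moreover have "?w \<noteq> id"
  proof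
    assume a: "?w = id"
    have "?w (f base_point) = f base_point" unfolding a by simp
    then have "f (s i base_point) = f base_point" using fA by simp
    then have "inv f (f (s i base_point)) = inv f (f base_point)" by simp
    then have "s i base_point = base_point" using fA by simp
    then show False using wall_s[OF i, of base_point] base_point_in i by (force simp: fund_alcove_iff)
  qed
  ultimately have e: "?w = s (node_perm f i)" by blast
  show ?thesis unfolding e[symmetric] using fA by (simp add: fun_eq_iff)
qed

section \<open>The group \<open>G\<close> and its commutativity\<close>

lemma G_eq: "G = alcove_auts \<inter> W_ext"
  using W_ext_aff_auts by (auto simp: G_def alcove_auts_def)

lemma G_alcove_auts: "g \<in> G \<Longrightarrow> g \<in> alcove_auts" and G_W_ext: "g \<in> G \<Longrightarrow> g \<in> W_ext"
  by (auto simp: G_eq)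

lemma G_aff_auts: "g \<in> G \<Longrightarrow> g \<in> aff_auts" using G_alcove_auts alcove_auts_aff by blast

lemma G_comp: "f \<in> G \<Longrightarrow> g \<in> G \<Longrightarrow> f \<circ> g \<in> G" by (simp add: G_eq alcove_auts_comp W_ext_comp)
lemma G_inv: "g \<in> G \<Longrightarrow> inv g \<in> G" by (simp add: G_eq alcove_auts_inv W_ext_inv)
lemma id_in_G: "id \<in> G" using W0_subset_W_ext by (simp add: G_def W0_eq id_in_W)

lemma W_ext_fixing_0: "f \<in> W_ext \<Longrightarrow> f 0 = 0 \<Longrightarrow> f \<in> W0"
  using W_ext_iff[of f] by simp

text \<open>The quotient of the two fixes the origin, so it lies in \<open>W0\<close>, and an
  element of \<open>W\<close> that preserves the alcove is trivial.\<close>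

lemma G_eqI: "f \<in> G \<Longrightarrow> g \<in> G \<Longrightarrow> f 0 = g 0 \<Longrightarrow> f = g"
proof -
  assume fg: "f \<in> G" "g \<in> G" "f 0 = g 0"
  have h: "inv g \<circ> f \<in> G" using fg G_comp G_inv by blast
  have "(inv g \<circ> f) 0 = 0" using fg(3) aff_auts_inv_f[OF G_aff_auts[OF fg(2)]] by simp
  then have "inv g \<circ> f \<in> W" using W_ext_fixing_0[OF G_W_ext[OF h]] W0_W by blast
  then have "inv g \<circ> f = id" using alcove_auts_W_id G_alcove_auts[OF h] by blast
  then have "g \<circ> (inv g \<circ> f) = g" by simp
  then show ?thesis using aff_auts_f_inv[OF G_aff_auts[OF fg(2)]] by (simp add: fun_eq_iff)
qed

lemma G_node: "g \<in> G \<Longrightarrow> g 0 = fund_vertex (node_perm g 0)"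
  using node_perm_vertex[OF G_alcove_auts, of g 0] by simp

lemma G_node_I_P: "g \<in> G \<Longrightarrow> node_perm g 0 \<in> I_P"
proof -
  assume g: "g \<in> G"
  have n: "node_perm g 0 \<in> I" using node_perm_in[OF G_alcove_auts[OF g]] by simp
  have "vertex_type (id (fund_vertex (node_perm g 0))) = node_perm g 0" by (rule vertex_type_conj[OF id_in_W n])
  then have "vertex_type (g 0) = node_perm g 0" using G_node[OF g] by simp
  moreover have "g 0 \<in> P" using aff_auts_0_P[OF G_aff_auts[OF g]] .
  ultimately show ?thesis unfolding I_P_def by (metis imageI)
qed

text \<open>Factor the translation by a lattice vector of type \<open>i\<close> as an element of
  \<open>W\<close> after a symmetry \<open>g\<close> of the alcove. Then \<open>g\<close> lies in
  \<open>G\<close> and sends 0 to a \<open>W\<close>-conjugate of that vector.\<close>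

lemma I_P_G:
  assumes "i \<in> I_P"
  obtains g where "g \<in> G" "g 0 = fund_vertex i" "node_perm g 0 = i" "i \<in> I"
proof -
  obtain v where v: "v \<in> P" "i = vertex_type v" using assms by (auto simp: I_P_def)
  obtain w g where g: "w \<in> W" "g \<in> aff_auts" "g ` fund_alcove = fund_alcove" "(\<lambda>x. x + v) = w \<circ> g"
    using translation_aff_auts[OF v(1)] by (rule aff_auts_decomp)
  have "g = inv w \<circ> (\<lambda>x. x + v)" using g(4) W_aff_auts[OF g(1)] by (simp add: fun_eq_iff)
  moreover have "(\<lambda>x. x + v) \<in> W_ext" using W_extI[OF v(1), of id] by (simp add: W0_eq id_in_W)
  ultimately have "g \<in> W_ext" using W_ext_comp W_subset_W_ext[OF inv_in_W[OF g(1)]] by simp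
  then have gG: "g \<in> G" using g by (simp add: G_def)
  have n: "node_perm g 0 \<in> I" using node_perm_in[OF G_alcove_auts[OF gG]] by simp
  have "w (fund_vertex (node_perm g 0)) = v" using G_node[OF gG] fun_cong[OF g(4), of 0] by simp
  then have "node_perm g 0 = i" using vertex_type_conj[OF g(1) n] v by simp
  then show ?thesis using that gG G_node n by metis
qed

lemma node_perm_Aut_tr: "g \<in> G \<Longrightarrow> node_perm g \<in> Aut_tr"
proof -
  assume g: "g \<in> G"
  have "g \<circ> s j \<circ> inv g = s (node_perm g j)" if "j \<in> I" for j
    unfolding node_perm_s[OF G_alcove_auts[OF g] that] using G_aff_auts[OF g] by (simp add: fun_eq_iff)
  then show ?thesis unfolding Aut_tr_def
    using node_perm_permutes[OF G_alcove_auts[OF g]] G_node_I_P[OF g] G_node[OF g] g by blast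
qed

text \<open>Modulo \<open>W\<close> an element of \<open>W_ext\<close> is determined by its
  translation part, and translation parts add under composition because \<open>W\<close> is
  normalised by translations from \<open>P\<close>.\<close>

lemma W_ext_mod_W:
  assumes "f \<in> W_ext" "g \<in> W_ext"
  obtains w where "w \<in> W" "\<And>x. (f \<circ> g) x = w x + (f 0 + g 0)"
proof -
  from assms(1) obtain v a where f: "v \<in> P" "a \<in> W0" "\<And>x. f x = a x + v" by (rule W_extE) blast
  from assms(2) obtain u b where g: "u \<in> P" "b \<in> W0" "\<And>x. g x = b x + u" by (rule W_extE) blast
  let ?t = "\<lambda>x. x + - u"
  have tA: "?t \<in> aff_auts" by (rule translation_aff_auts[OF P_uminus[OF g(1)]])
  obtain w where w: "w \<in> W" "?t \<circ> a = w \<circ> ?t" using tA W0_W[OF f(2)] by (rule W_normal)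
  show ?thesis
  proof (rule that[of "w \<circ> b"])
    show "w \<circ> b \<in> W" using comp_in_W w W0_W g by blast
    fix x
    have "a (b x + u) - u = w (b x)" using fun_cong[OF w(2), of "b x + u"] by simp
    then have "a (b x + u) = w (b x) + u" by (simp add: algebra_simps)
    then show "(f \<circ> g) x = (w \<circ> b) x + (f 0 + g 0)"
      by (simp add: f(3) g(3) W0_fixes[OF f(2)] W0_fixes[OF g(2)] algebra_simps)
  qed
qed

text \<open>By \<open>W_ext_mod_W\<close> the two products differ by an element of \<open>W\<close>;
  it also preserves the alcove, so it is trivial.\<close>

lemma G_commute: "f \<in> G \<Longrightarrow> g \<in> G \<Longrightarrow> f \<circ> g = g \<circ> f"
proof -
  assume f: "f \<in> G" and g: "g \<in> G"
  obtain w where w: "w \<in> W" "\<And>x. (f \<circ> g) x = w x + (f 0 + g 0)"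
    using W_ext_mod_W[OF G_W_ext[OF f] G_W_ext[OF g]] by blast
  obtain u where u: "u \<in> W" "\<And>x. (g \<circ> f) x = u x + (g 0 + f 0)"
    using W_ext_mod_W[OF G_W_ext[OF g] G_W_ext[OF f]] by blast
  have gf: "g \<circ> f \<in> G" "f \<circ> g \<in> G" using G_comp f g by auto
  have eq: "f \<circ> g = (g \<circ> f) \<circ> (inv u \<circ> w)"
  proof
    fix x
    have "(g \<circ> f) ((inv u \<circ> w) x) = u (inv u (w x)) + (g 0 + f 0)"
      using u(2)[of "(inv u \<circ> w) x"] by simp
    then show "(f \<circ> g) x = ((g \<circ> f) \<circ> (inv u \<circ> w)) x"
      using W_aff_auts[OF u(1)] w(2)[of x] by (simp add: algebra_simps)
  qed
  then have "inv (g \<circ> f) \<circ> (f \<circ> g) = inv u \<circ> w"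
    using aff_auts_inv_f[OF G_aff_auts[OF gf(1)]] by (simp add: fun_eq_iff)
  moreover have "inv (g \<circ> f) \<circ> (f \<circ> g) \<in> G" using G_comp G_inv gf by blast
  moreover have "inv u \<circ> w \<in> W" using comp_in_W inv_in_W u w by blast
  ultimately have "inv u \<circ> w = id" using alcove_auts_W_id G_alcove_auts by metis
  then show ?thesis using eq by simp
qed

text \<open>\<open>opp\<close> is the longest element of the finite Weyl group, so that \<open>opp_inv = - opp\<close> is the
  opposition involution, up to which \<open>t\<^sub>\<lambda>\<close> and its inverse have the same \<open>W\<^sub>0\<close>-double coset.\<close>

definition opp :: "'a \<Rightarrow> 'a" where
  "opp = (SOME w. w \<in> W0 \<and> (w \<circ> uminus) ` fund_alcove = fund_alcove)"

definition opp_inv :: "'a \<Rightarrow> 'a" where "opp_inv = opp \<circ> uminus"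

text \<open>Split negation into an element of \<open>W\<close> and a symmetry of the alcove. The
  inverse of the first factor carries vertex 0 to a vertex of the alcove, necessarily to itself
  because \<open>W\<close> preserves types; hence it lies in \<open>W0\<close>.\<close>

lemma opp_props: "opp \<in> W0" "opp_inv \<in> alcove_auts"
proof -
  obtain w g where g: "w \<in> W" "g \<in> aff_auts" "g ` fund_alcove = fund_alcove" "uminus = w \<circ> g"
    using uminus_aff_auts by (rule aff_auts_decomp)
  have e: "inv w \<circ> uminus = g" unfolding g(4) using W_aff_auts[OF g(1)] by (simp add: fun_eq_iff)
  have gA: "g \<in> alcove_auts" using g by (simp add: alcove_auts_def)
  have n: "node_perm g 0 \<in> I" using node_perm_in[OF gA] by simp
  have "inv w 0 = g 0" using fun_cong[OF e, of 0] by simp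
  then have "inv w (fund_vertex 0) = fund_vertex (node_perm g 0)" using node_perm_vertex[OF gA, of 0] by simp
  then have "0 = node_perm g 0" by (rule fund_vertex_conj(1)[OF inv_in_W[OF g(1)] zero_in_I n])
  then have "inv w 0 = 0" using \<open>inv w (fund_vertex 0) = _\<close> fund_vertex_0 by metis
  then have "inv w \<in> W0" using inv_in_W[OF g(1)] by (simp add: W0_eq)
  then have "\<exists>w. w \<in> W0 \<and> (w \<circ> uminus) ` fund_alcove = fund_alcove" using e g(3) by metis
  then have o: "opp \<in> W0 \<and> (opp \<circ> uminus) ` fund_alcove = fund_alcove" unfolding opp_def by (rule someI_ex)
  then show "opp \<in> W0" by blast
  show "opp_inv \<in> alcove_auts" unfolding opp_inv_def alcove_auts_def
    using o comp_aff_auts[OF W0_aff_auts uminus_aff_auts] by blast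
qed

lemma opp_inv_apply: "opp_inv x = - opp x"
  by (simp add: opp_inv_def linear_neg[OF W0_linear[OF opp_props(1)]])

lemma opp_inv_0 [simp]: "opp_inv 0 = 0"
  by (simp add: opp_inv_def W0_fixes[OF opp_props(1)])

text \<open>Modulo \<open>W\<close>, conjugation by \<open>opp_inv\<close> negates the translation
  part. So the product of the conjugate with \<open>g\<close> lies in \<open>W\<close>, preserves
  the alcove and is trivial.\<close>

lemma opp_inv_inverts_G:
  assumes g: "g \<in> G" shows "opp_inv \<circ> g \<circ> inv opp_inv = inv g"
proof -
  let ?i = opp_inv
  have iA: "?i \<in> aff_auts" using alcove_auts_aff opp_props by blast
  from G_W_ext[OF g] obtain v w where gv: "v \<in> P" "w \<in> W0" "\<And>x. g x = w x + v" by (rule W_extE) blast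
  obtain w2 where w2: "w2 \<in> W" "?i \<circ> w = w2 \<circ> ?i" using iA W0_W[OF gv(2)] by (rule W_normal)
  let ?t = "\<lambda>x. x + - v"
  have tA: "?t \<in> aff_auts" by (rule translation_aff_auts[OF P_uminus[OF gv(1)]])
  have oW: "opp \<in> W" "opp \<in> aff_auts" using opp_props W0_W W0_aff_auts by auto
  obtain w3 where w3: "w3 \<in> W" "?t \<circ> (inv opp \<circ> w2) = w3 \<circ> ?t"
    using tA comp_in_W[OF inv_in_W[OF oW(1)] w2(1)] by (rule W_normal)
  have il: "?i (x + y) = ?i x + ?i y" for x y
    by (simp add: opp_inv_apply linear_add[OF W0_linear[OF opp_props(1)]])
  have "(?i \<circ> g \<circ> inv ?i \<circ> g) x = (opp \<circ> w3 \<circ> w) x" for x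
  proof -
    have A: "(?i \<circ> g \<circ> inv ?i) y = w2 y - opp v" for y
    proof -
      have "?i (w (inv ?i y)) = w2 (?i (inv ?i y))" using fun_cong[OF w2(2), of "inv ?i y"] by simp
      then show ?thesis using aff_auts_f_inv[OF iA] by (simp add: gv(3) il opp_inv_apply[of v])
    qed
    have "inv opp (w2 (w x + v)) - v = w3 (w x)" using fun_cong[OF w3(2), of "w x + v"] by simp
    then have "inv opp (w2 (w x + v)) = w3 (w x) + v" by (simp add: algebra_simps)
    then have "opp (inv opp (w2 (w x + v))) = opp (w3 (w x) + v)" by simp
    then have "w2 (w x + v) = opp (w3 (w x)) + opp v"
      using aff_auts_f_inv[OF oW(2)] by (simp add: linear_add[OF W0_linear[OF opp_props(1)]])
    then show ?thesis using A[of "g x"] by (simp add: gv(3))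
  qed
  then have e: "?i \<circ> g \<circ> inv ?i \<circ> g = opp \<circ> w3 \<circ> w" by (rule ext)
  have "opp \<circ> w3 \<circ> w \<in> W" using comp_in_W oW w3 W0_W gv by blast
  moreover have "?i \<circ> g \<circ> inv ?i \<circ> g \<in> alcove_auts"
    using alcove_auts_comp alcove_auts_inv opp_props(2) G_alcove_auts[OF g] by blast
  ultimately have "?i \<circ> g \<circ> inv ?i \<circ> g = id" using alcove_auts_W_id e by metis
  then have "?i \<circ> g \<circ> inv ?i \<circ> (g \<circ> inv g) = inv g" by (metis comp_assoc id_comp)
  moreover have "g \<circ> inv g = id" using aff_auts_f_inv[OF G_aff_auts[OF g]] by (simp add: fun_eq_iff)
  ultimately show ?thesis by simp
qed

lemma node_perm_opp_inv_0: "node_perm opp_inv 0 = 0"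
proof -
  have "fund_vertex (node_perm opp_inv 0) = fund_vertex 0"
    using node_perm_vertex[OF opp_props(2), of 0] by simp
  then show ?thesis using inj_onD[OF fund_vertex_inj] node_perm_in[OF opp_props(2)] by simp
qed

lemma opp_s:
  assumes "i \<in> I0" shows "opp \<circ> s i = s (node_perm opp_inv i) \<circ> opp"
proof
  fix x
  have i: "i \<in> I" "i \<noteq> 0" using assms I0_D by auto
  have "s i (- y) = - s i y" for y using i by (simp add: s_def aff_reflection_def)
  then have "opp (s i x) = opp_inv (s i (- x))" by (simp add: opp_inv_def)
  also have "\<dots> = s (node_perm opp_inv i) (opp_inv (- x))"
    using fun_cong[OF node_perm_s[OF opp_props(2) i(1)], of "- x"] by simp
  finally show "(opp \<circ> s i) x = (s (node_perm opp_inv i) \<circ> opp) x" by (simp add: opp_inv_def)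
qed

lemma opp_descent:
  assumes "j \<in> I0" shows "descent j opp"
proof -
  have j: "j \<in> I" "j \<noteq> 0" using assms I0_D by auto
  have "opp_inv base_point \<in> fund_alcove" using opp_props(2) base_point_in by (auto simp: alcove_auts_def)
  then have "wall j (opp_inv base_point) > 0" using j by (simp add: fund_alcove_iff)
  then show ?thesis using j by (simp add: descent_iff wall_def opp_inv_apply)
qed

text \<open>An element is linear and permutes the finite spanning set \<open>R\<close>, so its
  restriction to \<open>R\<close> determines it.\<close>

lemma finite_W0: "finite W0"
proof (rule finite_imageD)
  show "finite ((\<lambda>w. restrict w R) ` W0)"
  proof (rule finite_subset)
    show "(\<lambda>w. restrict w R) ` W0 \<subseteq> (\<Pi>\<^sub>E \<beta>\<in>R. R)"
    proof
      fix f assume "f \<in> (\<lambda>w. restrict w R) ` W0"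
      then obtain w where w: "w \<in> W0" "f = restrict w R" by blast
      from W0_aff_auts[OF w(1)] obtain A b where A: "linear A" "A ` R = R" "\<And>x. w x = A x + b"
        by (rule aff_autsE) blast
      have "b = 0" using A(3)[of 0] W0_fixes[OF w(1)] linear_0[OF A(1)] by simp
      then show "f \<in> (\<Pi>\<^sub>E \<beta>\<in>R. R)" using A w by auto
    qed
    show "finite (\<Pi>\<^sub>E \<beta>\<in>R. R)" by (intro finite_PiE finite_R)
  qed
  show "inj_on (\<lambda>w. restrict w R) W0"
  proof (rule inj_onI)
    fix u w assume uw: "u \<in> W0" "w \<in> W0" "restrict u R = restrict w R"
    show "u = w"
    proof
      fix x
      have "x \<in> span R" using span_R by simp
      then show "u x = w x"
      proof (rule linear_eq_on_span[OF W0_linear[OF uw(1)] W0_linear[OF uw(2)], rotated])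
        fix y assume "y \<in> R"
        then show "u y = w y" using fun_cong[OF uw(3), of y] by simp
      qed
    qed
  qed
qed

text \<open>Stands in for the \<open>W0\<close>-double coset of the translation by \<open>l\<close>:
  an element of \<open>W_ext\<close> belongs to that double coset exactly when it sends 0 into this
  orbit.\<close>

definition orbit :: "'a \<Rightarrow> 'a set" where "orbit l = {w l | w. w \<in> W0}"

lemma finite_orbit: "finite (orbit l)"
  unfolding orbit_def using finite_W0 by (simp add: setcompr_eq_image)

lemma orbit_W0: "w \<in> W0 \<Longrightarrow> w x \<in> orbit l \<longleftrightarrow> x \<in> orbit l"
proof
  assume w: "w \<in> W0"
  { fix x assume "x \<in> orbit l"
    then obtain u where u: "u \<in> W0" "x = u l" by (auto simp: orbit_def)
    show "w x \<in> orbit l" unfolding orbit_def using W0_comp[OF w u(1)] u(2) by (intro CollectI exI[of _ "w \<circ> u"]) simp }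
  assume "w x \<in> orbit l"
  then obtain u where u: "u \<in> W0" "w x = u l" by (auto simp: orbit_def)
  have "x = inv w (u l)" using u(2) aff_auts_inv_f[OF W0_aff_auts[OF w], of x] by simp
  then show "x \<in> orbit l" unfolding orbit_def using W0_comp[OF W0_inv[OF w] u(1)]
    by (intro CollectI exI[of _ "inv w \<circ> u"]) simp
qed

lemma aff_auts_coxeter_complex:
  assumes f: "f \<in> aff_auts" shows "(\<lambda>t. f ` t) ` coxeter_complex \<subseteq> coxeter_complex"
proof
  fix t assume "t \<in> (\<lambda>t. f ` t) ` coxeter_complex"
  then obtain r w where r: "t = f ` r" "w \<in> W" "r \<subseteq> w ` fund_vertex ` I" unfolding coxeter_complex_eq by blast
  obtain u g where g: "u \<in> W" "g \<in> aff_auts" "g ` fund_alcove = fund_alcove" "f \<circ> w = u \<circ> g"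
    using comp_aff_auts[OF f W_aff_auts[OF r(2)]] by (rule aff_auts_decomp)
  have "t \<subseteq> f ` w ` fund_vertex ` I" using r by blast
  also have "\<dots> = (f \<circ> w) ` fund_vertex ` I" by (simp add: image_comp comp_assoc)
  also have "\<dots> = u ` g ` fund_vertex ` I" unfolding g(4) by (simp add: image_comp comp_assoc)
  also have "\<dots> = u ` fund_vertex ` I" using alcove_auts_vertices[of g] g by (simp add: alcove_auts_def)
  finally show "t \<in> coxeter_complex" unfolding coxeter_complex_eq using g(1) by blast
qed

lemma simplicial_iso_aff_auts:
  assumes f: "f \<in> aff_auts" shows "simplicial_iso coxeter_complex coxeter_complex f"
proof -
  let ?X = coxeter_complex
  have sub: "(\<lambda>t. g ` t) ` ?X \<subseteq> ?X" if "g \<in> aff_auts" for g using that by (rule aff_auts_coxeter_complex)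
  have eq: "(\<lambda>t. f ` t) ` ?X = ?X"
  proof
    show "?X \<subseteq> (\<lambda>t. f ` t) ` ?X"
    proof
      fix t assume "t \<in> ?X"
      then have "inv f ` t \<in> ?X" using sub[OF inv_aff_auts[OF f]] by blast
      moreover have "t = f ` inv f ` t" using f by (simp add: image_image)
      ultimately show "t \<in> (\<lambda>t. f ` t) ` ?X" by blast
    qed
  qed (rule sub[OF f])
  have "f ` \<Union>?X = \<Union>?X" by (subst (2) eq[symmetric]) blast
  then have "bij_betw f (\<Union>?X) (\<Union>?X)"
    using bij_is_inj[OF aff_auts_bij[OF f]] by (auto simp: bij_betw_def inj_on_def)
  then show ?thesis using eq by (simp add: simplicial_iso_def)
qed

end

section \<open>Galleries and isometric embeddings of the Weyl group\<close>

context root_datum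
begin

lemma reduced_word_rev: "js \<in> lists I \<Longrightarrow> reduced_word js \<Longrightarrow> reduced_word (rev js)"
proof -
  assume r: "reduced_word js"
  then have js: "js \<in> lists I" by (simp add: reduced_word_def)
  show ?thesis unfolding reduced_word_def
  proof (intro conjI ballI impI)
    show "rev js \<in> lists I" using js by auto
    fix ks assume ks: "ks \<in> lists I" "word ks = word (rev js)"
    have "word (rev ks) = word js"
      unfolding word_rev[OF ks(1)] ks(2) word_rev[OF js] using W_aff_auts[OF word_in_W[OF js]]
      by (simp add: inv_inv_eq aff_auts_bij)
    moreover have "rev ks \<in> lists I" using ks(1) by auto
    ultimately have "length js \<le> length (rev ks)" using r unfolding reduced_word_def by blast
    then show "length (rev js) \<le> length ks" by simp
  qed
qed

lemma reduced_word_Cons: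
  "i \<in> I \<Longrightarrow> reduced_word js \<Longrightarrow> \<not> descent i (word js) \<Longrightarrow> reduced_word (i # js)"
  using len_step(2)[of i "word js"] word_aff_auts[of js] by (simp add: reduced_word_iff)

lemma not_descent_id: "\<not> descent i id"
  by (simp add: descent_def fund_alcove_not_separated base_point_in)

lemma reduced_word_single: "i \<in> I \<Longrightarrow> reduced_word [i]"
  by (rule reduced_word_Cons) (simp_all add: reduced_word_iff not_descent_id)

lemma W_cancel_left: "w \<in> W \<Longrightarrow> inv w \<circ> (w \<circ> v) = v"
  and W_cancel_right: "w \<in> W \<Longrightarrow> w \<circ> (inv w \<circ> v) = v"
  using W_aff_auts[of w] by (simp_all add: fun_eq_iff)

lemma W_inv_comp: "u \<in> W \<Longrightarrow> v \<in> W \<Longrightarrow> inv (u \<circ> v) = inv v \<circ> inv u"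
  using aff_auts_bij W_aff_auts by (simp add: o_inv_distrib)

lemma W_inv_inv: "u \<in> W \<Longrightarrow> inv (inv u) = u"
  using aff_auts_bij W_aff_auts by (simp add: inv_inv_eq)

lemma inv_s: "i \<in> I \<Longrightarrow> inv (s i) = s i"
  using word_rev[of "[i]"] by simp

text \<open>Passing from \<open>u\<close> to \<open>u \<circ> s j\<close> crosses wall
  \<open>i\<close>, and the only hyperplane crossed is the image of wall \<open>j\<close> under
  \<open>u\<close>. Hence these walls coincide and \<open>s i\<close> passes through
  \<open>u\<close> as \<open>s j\<close>.\<close>

lemma wall_crossing_step:
  assumes i: "i \<in> I" and j: "j \<in> I" and u: "u \<in> W"
    and nd: "\<not> descent i u" "\<not> descent i v" and e: "s i \<circ> v = u \<circ> s j" and v: "v \<in> W"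
  shows "v = u"
proof -
  have uA: "u \<in> aff_auts" and vA: "v \<in> aff_auts" using u v W_aff_auts by auto
  let ?b = base_point
  have reg: "u ?b \<in> regular_points" "u (s j ?b) \<in> regular_points"
    using aff_auts_regular uA s_aff_auts[OF j] base_point_regular by blast+
  have "descent i (s i \<circ> v)" using len_step(1)[OF i vA] nd by blast
  then have "wall_plane i \<in> seps ?b (u (s j ?b))" unfolding e by (simp add: descent_def)
  moreover have "wall_plane i \<notin> seps ?b (u ?b)" using nd by (simp add: descent_def)
  ultimately have "wall_plane i \<in> seps (u ?b) (u (s j ?b))"
    using seps_triangle[OF base_point_regular reg] by blast
  then have H: "wall_plane i = u ` wall_plane j"
    unfolding aff_auts_seps[OF uA] seps_s[OF base_point_in j] by simp
  have "s i \<circ> u = u \<circ> s j" unfolding s_reflection[of i]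
    by (rule reflection_conj[OF uA j wall_root_in_R[OF i]]) (use H in \<open>simp add: wall_plane_def\<close>)
  then have "s i \<circ> (s i \<circ> v) = s i \<circ> (s i \<circ> u)" using e by simp
  then show ?thesis using i by simp
qed

end

section \<open>Galleries, and how the distance changes along a panel\<close>

context building
begin

lemma adjD: "i \<in> I \<Longrightarrow> (c, d) \<in> adj i \<Longrightarrow> c \<in> C \<and> d \<in> C"
  using adj_equiv[of i] unfolding equiv_def refl_on_def by blast

lemma adj_sym: "i \<in> I \<Longrightarrow> (c, d) \<in> adj i \<Longrightarrow> (d, c) \<in> adj i"
  using adj_equiv[of i] unfolding equiv_def by (meson symD)

lemma adj_trans: "i \<in> I \<Longrightarrow> (c, d) \<in> adj i \<Longrightarrow> (d, e) \<in> adj i \<Longrightarrow> (c, e) \<in> adj i"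
  using adj_equiv[of i] unfolding equiv_def by (meson transD)

lemma adj_refl: "i \<in> I \<Longrightarrow> c \<in> C \<Longrightarrow> (c, c) \<in> adj i"
  using adj_equiv[of i] unfolding equiv_def by (meson refl_onD)

fun gallery :: "nat list \<Rightarrow> 'c \<Rightarrow> 'c \<Rightarrow> bool" where
  "gallery [] c d \<longleftrightarrow> c = d"
| "gallery (i # js) c d \<longleftrightarrow> (\<exists>e. (c, e) \<in> adj i \<and> c \<noteq> e \<and> gallery js e d)"

lemma gallery_iff_path:
  "gallery js c d \<longleftrightarrow> (\<exists>p :: nat \<Rightarrow> 'c. p 0 = c \<and> p (length js) = d \<and>
         (\<forall>k<length js. (p k, p (Suc k)) \<in> adj (js ! k) \<and> p k \<noteq> p (Suc k)))"
proof (induction js arbitrary: c)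
  case Nil
  show ?case by (auto intro: exI[of _ "\<lambda>_. c"])
next
  case (Cons i js)
  show ?case
  proof
    assume "gallery (i # js) c d"
    then obtain e where e: "(c, e) \<in> adj i" "c \<noteq> e" "gallery js e d" by auto
    then obtain p where p: "p 0 = e" "p (length js) = d"
      "\<forall>k<length js. (p k, p (Suc k)) \<in> adj (js ! k) \<and> p k \<noteq> p (Suc k)"
      using Cons.IH[of e] by blast
    define r where "r k = (case k of 0 \<Rightarrow> c | Suc m \<Rightarrow> p m)" for k
    have "(r k, r (Suc k)) \<in> adj ((i # js) ! k) \<and> r k \<noteq> r (Suc k)" if "k < length (i # js)" for k
      using that e p by (cases k) (simp_all add: r_def)
    moreover have "r 0 = c" "r (length (i # js)) = d" using p by (simp_all add: r_def)
    ultimately show "\<exists>p. p 0 = c \<and> p (length (i # js)) = d \<and>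
         (\<forall>k<length (i # js). (p k, p (Suc k)) \<in> adj ((i # js) ! k) \<and> p k \<noteq> p (Suc k))" by blast
  next
    assume "\<exists>p. p 0 = c \<and> p (length (i # js)) = d \<and>
         (\<forall>k<length (i # js). (p k, p (Suc k)) \<in> adj ((i # js) ! k) \<and> p k \<noteq> p (Suc k))"
    then obtain p where p: "p 0 = c" "p (length (i # js)) = d"
         "\<forall>k<length (i # js). (p k, p (Suc k)) \<in> adj ((i # js) ! k) \<and> p k \<noteq> p (Suc k)" by blast
    have 0: "(p 0, p 1) \<in> adj i" "p 0 \<noteq> p 1" using p(3)[rule_format, of 0] by simp_all
    have "(p (Suc k), p (Suc (Suc k))) \<in> adj (js ! k) \<and> p (Suc k) \<noteq> p (Suc (Suc k))" if "k < length js" for k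
      using p(3)[rule_format, of "Suc k"] that by simp
    then have "gallery js (p 1) d"
      unfolding Cons.IH using p(2) by (intro exI[of _ "\<lambda>k. p (Suc k)"]) simp
    then show "gallery (i # js) c d" using 0 p(1) by auto
  qed
qed

lemma dist_iff: "reduced_word js \<Longrightarrow> c \<in> C \<Longrightarrow> d \<in> C \<Longrightarrow> \<delta> c d = word js \<longleftrightarrow> gallery js c d"
  unfolding gallery_iff_path by (rule dist_iff_gallery)

lemma dist_id_iff: "c \<in> C \<Longrightarrow> d \<in> C \<Longrightarrow> \<delta> c d = id \<longleftrightarrow> c = d"
  using dist_iff[of "[]" c d] by (simp add: reduced_word_iff)

lemma dist_s_iff: "i \<in> I \<Longrightarrow> c \<in> C \<Longrightarrow> d \<in> C \<Longrightarrow> \<delta> c d = s i \<longleftrightarrow> (c, d) \<in> adj i \<and> c \<noteq> d"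
  using dist_iff[OF reduced_word_single, of i c d] by auto

lemma gallery_append: "gallery xs c d \<Longrightarrow> gallery ys d e \<Longrightarrow> gallery (xs @ ys) c e"
  by (induction xs arbitrary: c) auto

lemma gallery_rev: "set js \<subseteq> I \<Longrightarrow> gallery js c d \<Longrightarrow> gallery (rev js) d c"
proof (induction js arbitrary: c)
  case (Cons i js)
  then obtain e where e: "(c, e) \<in> adj i" "c \<noteq> e" "gallery js e d" by auto
  then have "gallery (rev js) d e" "gallery [i] e c" using Cons adj_sym by auto
  then show ?case using gallery_append by fastforce
qed simp

lemma dist_inv:
  assumes "c \<in> C" "d \<in> C" shows "\<delta> d c = inv (\<delta> c d)"
proof -
  obtain js where js: "reduced_word js" "word js = \<delta> c d" using dist_in_W[OF assms] by (rule WE)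
  then have jI: "js \<in> lists I" by (simp add: reduced_word_def)
  have "gallery js c d" using dist_iff[OF js(1) assms] js(2) by simp
  moreover have "set js \<subseteq> I" using jI by auto
  ultimately have "gallery (rev js) d c" using gallery_rev by blast
  then have "\<delta> d c = word (rev js)" using dist_iff[OF reduced_word_rev[OF jI js(1)] assms(2,1)] by simp
  then show ?thesis using word_rev[OF jI] js(2) by simp
qed

lemma dist_self: "c \<in> C \<Longrightarrow> \<delta> c c = id" using dist_id_iff by blast

lemma dist_step_up:
  assumes i: "i \<in> I" and a: "(c, c') \<in> adj i" "c \<noteq> c'" and d: "d \<in> C" and nd: "\<not> descent i (\<delta> c' d)"
  shows "\<delta> c d = s i \<circ> \<delta> c' d"
proof -
  have C: "c \<in> C" "c' \<in> C" using adjD[OF i a(1)] by auto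
  obtain js where js: "reduced_word js" "word js = \<delta> c' d" using dist_in_W[OF C(2) d] by (rule WE)
  have "gallery js c' d" using dist_iff[OF js(1) C(2) d] js(2) by simp
  then have "gallery (i # js) c d" using a by auto
  moreover have "reduced_word (i # js)" using reduced_word_Cons[OF i js(1)] nd js(2) by simp
  ultimately show ?thesis using dist_iff[OF _ C(1) d, of "i # js"] js(2) by simp
qed

lemma dist_step_down:
  assumes i: "i \<in> I" and C: "c \<in> C" "d \<in> C" and de: "descent i (\<delta> c d)"
  obtains c' where "(c, c') \<in> adj i" "c \<noteq> c'" "\<delta> c' d = s i \<circ> \<delta> c d" "\<not> descent i (\<delta> c' d)"
proof -
  have wA: "\<delta> c d \<in> aff_auts" using W_aff_auts dist_in_W C by blast
  have "s i \<circ> \<delta> c d \<in> W" using comp_in_W s_in_W i dist_in_W C by blast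
  then obtain js where js: "reduced_word js" "word js = s i \<circ> \<delta> c d" by (rule WE)
  have nd: "\<not> descent i (s i \<circ> \<delta> c d)" using len_step(1)[OF i wA] de by simp
  have r: "reduced_word (i # js)" using reduced_word_Cons[OF i js(1)] nd js(2) by simp
  have "\<delta> c d = word (i # js)" using js(2) i by simp
  then have "gallery (i # js) c d" using dist_iff[OF r C] by simp
  then obtain c' where c': "(c, c') \<in> adj i" "c \<noteq> c'" "gallery js c' d" by auto
  then have "\<delta> c' d = word js" using dist_iff[OF js(1) _ C(2), of c'] adjD[OF i c'(1)] by simp
  then show ?thesis using that c' js(2) nd by simp
qed

text \<open>The chamber found is the projection of \<open>d\<close> to the panel of
  \<open>c\<close>; by \<open>dist_step_up\<close> every other chamber of the panel is one step
  further from \<open>d\<close>.\<close>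

lemma panel_gate:
  assumes i: "i \<in> I" and C: "c \<in> C" "d \<in> C"
  obtains g where "(c, g) \<in> adj i" "\<not> descent i (\<delta> g d)"
proof (cases "descent i (\<delta> c d)")
  case True
  then show ?thesis using that dist_step_down[OF i C] by metis
next
  case False
  then show ?thesis using that adj_refl[OF i C(1)] by blast
qed

lemma dist_left_step:
  assumes i: "i \<in> I" and a: "(c, c') \<in> adj i" and d: "d \<in> C"
  shows "\<delta> c' d = \<delta> c d \<or> \<delta> c' d = s i \<circ> \<delta> c d"
proof -
  have C: "c \<in> C" "c' \<in> C" using adjD[OF i a] by auto
  obtain g where g: "(c, g) \<in> adj i" "\<not> descent i (\<delta> g d)" using panel_gate[OF i C(1) d] by blast
  have e: "\<delta> x d = \<delta> g d \<or> \<delta> x d = s i \<circ> \<delta> g d" if x: "(x, g) \<in> adj i" for x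
    using dist_step_up[OF i x _ d g(2)] by (cases "x = g") auto
  have "(c', g) \<in> adj i" using adj_trans[OF i adj_sym[OF i a] g(1)] .
  then show ?thesis using e[OF g(1)] e[of c'] i by auto
qed

lemma dist_left_attain:
  assumes i: "i \<in> I" and C: "c \<in> C" "d \<in> C"
  obtains c' where "(c, c') \<in> adj i" "\<delta> c' d = s i \<circ> \<delta> c d"
proof (cases "descent i (\<delta> c d)")
  case True
  then show ?thesis using that dist_step_down[OF i C] by metis
next
  case False
  obtain c' where c': "(c, c') \<in> adj i" "c' \<noteq> c" using panel[OF i C(1)] by blast
  then show ?thesis using that[OF c'(1)] dist_step_up[OF i adj_sym[OF i c'(1)] c'(2) C(2) False] by blast
qed

lemma dist_right_step:
  assumes j: "j \<in> I" and a: "(d, d') \<in> adj j" and c: "c \<in> C"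
  shows "\<delta> c d' = \<delta> c d \<or> \<delta> c d' = \<delta> c d \<circ> s j"
proof -
  have C: "d \<in> C" "d' \<in> C" using adjD[OF j a] by auto
  have W: "\<delta> d c \<in> W" "s j \<in> W" using dist_in_W C c s_in_W j by auto
  have e: "\<delta> c d = inv (\<delta> d c)" "\<delta> c d' = inv (\<delta> d' c)" by (rule dist_inv[OF C(1) c] dist_inv[OF C(2) c])+
  have "inv (s j \<circ> \<delta> d c) = inv (\<delta> d c) \<circ> s j" using W_inv_comp[OF W(2,1)] inv_s[OF j] by simp
  then show ?thesis unfolding e using dist_left_step[OF j a c] by metis
qed

text \<open>A gallery along which the projection to a panel changes can be shortened: at such a step
  the distance from the projection does not change.\<close>

lemma gallery_across_panel:
  assumes "set js \<subseteq> I" "gallery js e f" "i \<in> I" "(c, c') \<in> adj i" "e \<in> C" "f \<in> C"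
    "\<not> descent i (\<delta> c e)" "\<not> descent i (\<delta> c' f)"
  shows "\<exists>ks\<in>lists I. word ks = inv (\<delta> c e) \<circ> \<delta> c' f \<and> length ks \<le> length js \<and> (c \<noteq> c' \<longrightarrow> length ks < length js)"
  using assms(1,2,4,5,7)
proof (induction js arbitrary: c e)
  case Nil
  then have e: "e = f" by simp
  have C: "c \<in> C" "c' \<in> C" using adjD[OF assms(3) Nil.prems(3)] by auto
  have "c = c'"
  proof (rule ccontr)
    assume "c \<noteq> c'"
    then have "\<delta> c e = s i \<circ> \<delta> c' f" using dist_step_up[OF assms(3) Nil.prems(3) _ assms(6,8)] e by simp
    moreover have "descent i (s i \<circ> \<delta> c' f)"
      using len_step(1)[OF assms(3) W_aff_auts[OF dist_in_W[OF C(2) assms(6)]]] assms(8) by blast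
    ultimately show False using Nil.prems(5) by metis
  qed
  then show ?case using e W_cancel_left[OF dist_in_W[OF C(1) assms(6)], of id] by (intro bexI[of _ "[]"]) auto
next
  case (Cons j js)
  have i: "i \<in> I" by fact
  have j: "j \<in> I" "set js \<subseteq> I" using Cons.prems by auto
  obtain e1 where e1: "(e, e1) \<in> adj j" "e \<noteq> e1" "gallery js e1 f" using Cons.prems(2) by auto
  have C: "c \<in> C" "c' \<in> C" "e \<in> C" "e1 \<in> C" using adjD[OF i Cons.prems(3)] adjD[OF j(1) e1(1)] by auto
  obtain g where g: "(c, g) \<in> adj i" "\<not> descent i (\<delta> g e1)" using panel_gate[OF i C(1,4)] by blast
  have gC: "g \<in> C" using adjD[OF i g(1)] by simp
  have gc': "(g, c') \<in> adj i" using adj_trans[OF i adj_sym[OF i g(1)] Cons.prems(3)] .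
  obtain ks where ks: "ks \<in> lists I" "word ks = inv (\<delta> g e1) \<circ> \<delta> c' f" "length ks \<le> length js"
      "g \<noteq> c' \<longrightarrow> length ks < length js"
    using Cons.IH[OF j(2) e1(3) gc' C(4) g(2)] by blast
  have W: "\<delta> c e \<in> W" "\<delta> g e1 \<in> W" using dist_in_W C gC by auto
  show ?case
  proof (cases "g = c")
    case True
    have "\<delta> c e1 = \<delta> c e \<or> \<delta> c e1 = \<delta> c e \<circ> s j" by (rule dist_right_step[OF j(1) e1(1) C(1)])
    then show ?thesis
    proof
      assume "\<delta> c e1 = \<delta> c e"
      then show ?thesis using ks True by (intro bexI[of _ ks]) auto
    next
      assume a: "\<delta> c e1 = \<delta> c e \<circ> s j"
      have "inv (\<delta> g e1) = s j \<circ> inv (\<delta> c e)"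
        using a True W_inv_comp[OF W(1) s_in_W[OF j(1)]] inv_s[OF j(1)] by simp
      then have "word (j # ks) = inv (\<delta> c e) \<circ> \<delta> c' f" using ks(2) j(1) by (simp add: comp_assoc)
      then show ?thesis using ks True j by (intro bexI[of _ "j # ks"]) auto
    qed
  next
    case False
    have up: "\<delta> c e1 = s i \<circ> \<delta> g e1" using dist_step_up[OF i g(1) _ C(4) g(2)] False by blast
    then have de: "descent i (\<delta> c e1)" using len_step(1)[OF i W_aff_auts[OF W(2)]] g(2) by simp
    have "\<delta> c e1 = \<delta> c e \<or> \<delta> c e1 = \<delta> c e \<circ> s j" by (rule dist_right_step[OF j(1) e1(1) C(1)])
    then have "s i \<circ> \<delta> g e1 = \<delta> c e \<circ> s j" using up de Cons.prems(5) by auto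
    then have "\<delta> g e1 = \<delta> c e" by (rule wall_crossing_step[OF i j(1) W(1) Cons.prems(5) g(2) _ W(2)])
    then show ?thesis using ks by (intro bexI[of _ ks]) auto
  qed
qed

text \<open>Two different projections would let \<open>gallery_across_panel\<close> produce a word
  for the distance from \<open>e\<close> to \<open>f\<close> that is shorter than a reduced
  one.\<close>

lemma panel_projections_agree:
  assumes i: "i \<in> I" and a: "(c, c') \<in> adj i" and C: "e \<in> C" "f \<in> C"
    and nd: "\<not> descent i (\<delta> c e)" "\<not> descent i (\<delta> c' f)"
    and eq: "\<delta> e f = inv (\<delta> c e) \<circ> \<delta> c' f"
  shows "c = c'"
proof (rule ccontr)
  assume ne: "c \<noteq> c'"
  obtain js where js: "reduced_word js" "word js = \<delta> e f" using dist_in_W[OF C] by (rule WE)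
  have "gallery js e f" using dist_iff[OF js(1) C] js(2) by simp
  moreover have "set js \<subseteq> I" using js(1) by (auto simp: reduced_word_def)
  ultimately obtain ks where "ks \<in> lists I" "word ks = word js" "length ks < length js"
    using gallery_across_panel[OF _ _ i a C nd, of js] ne eq js(2) by auto
  then show False using js(1) unfolding reduced_word_def by force
qed

section \<open>Partial isometries from the Weyl group, extended by Zorn's lemma\<close>

definition isometric :: "(('a \<Rightarrow> 'a) \<times> 'c) set \<Rightarrow> bool" where
  "isometric M \<longleftrightarrow> M \<subseteq> W \<times> C \<and> (\<forall>u c v d. (u, c) \<in> M \<longrightarrow> (v, d) \<in> M \<longrightarrow> \<delta> c d = inv u \<circ> v)"

lemma isometricD: "isometric M \<Longrightarrow> (u, c) \<in> M \<Longrightarrow> (v, d) \<in> M \<Longrightarrow> \<delta> c d = inv u \<circ> v"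
  unfolding isometric_def by blast

lemma isometric_insert:
  assumes M: "isometric M" and xc: "x \<in> W" "c \<in> C"
    and d: "\<And>y d. (y, d) \<in> M \<Longrightarrow> \<delta> c d = inv x \<circ> y"
  shows "isometric (insert (x, c) M)"
proof -
  have "\<delta> d c = inv y \<circ> x" if yd: "(y, d) \<in> M" for y d
  proof -
    have "y \<in> W" "d \<in> C" using M yd by (auto simp: isometric_def)
    then show ?thesis using dist_inv[OF xc(2), of d] d[OF yd] W_inv_comp[OF inv_in_W[OF xc(1)]] W_inv_inv[OF xc(1)] by simp
  qed
  moreover have "\<delta> c c = inv x \<circ> x" using dist_self[OF xc(2)] W_cancel_left[OF xc(1), of id] by simp
  ultimately show ?thesis using M xc d unfolding isometric_def by auto
qed

text \<open>Elements on the near side of the panel accept any other chamber of the panel as the new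
  value. Those on the far side prescribe it, as the projection of their own chamber, and
  \<open>panel_projections_agree\<close> shows that they all prescribe the same one.\<close>

lemma isometric_extend:
  assumes M: "isometric M" and xa: "(x, a) \<in> M" and i: "i \<in> I"
  obtains c where "isometric (insert (x \<circ> s i, c) M)"
proof -
  have x: "x \<in> W" "a \<in> C" using M xa by (auto simp: isometric_def)
  have sx: "inv (x \<circ> s i) = s i \<circ> inv x" using W_inv_comp[OF x(1) s_in_W[OF i]] inv_s[OF i] by simp
  have Md: "\<delta> a d = inv x \<circ> y" "y \<in> W" "d \<in> C" if "(y, d) \<in> M" for y d
    using that M xa by (auto simp: isometric_def)
  have up: "\<delta> c d = inv (x \<circ> s i) \<circ> y"
    if c: "(a, c) \<in> adj i" "c \<noteq> a" and yd: "(y, d) \<in> M" and nd: "\<not> descent i (inv x \<circ> y)" for c y d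
  proof -
    have "\<not> descent i (\<delta> a d)" using nd Md(1)[OF yd] by simp
    then have "\<delta> c d = s i \<circ> \<delta> a d" using dist_step_up[OF i adj_sym[OF i c(1)] c(2) Md(3)[OF yd]] by blast
    then show ?thesis using Md(1)[OF yd] sx by (simp add: comp_assoc)
  qed
  have xs: "x \<circ> s i \<in> W" using comp_in_W x s_in_W i by blast
  show ?thesis
  proof (cases "\<exists>y0 d0. (y0, d0) \<in> M \<and> descent i (inv x \<circ> y0)")
    case False
    obtain c where c: "(a, c) \<in> adj i" "c \<noteq> a" using panel[OF i x(2)] by blast
    have "c \<in> C" using adjD[OF i c(1)] by simp
    then show ?thesis using that isometric_insert[OF M xs] up[OF c] False by blast
  next
    case True
    then obtain y0 d0 where y0: "(y0, d0) \<in> M" "descent i (inv x \<circ> y0)" by blast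
    have "descent i (\<delta> a d0)" using y0(2) Md(1)[OF y0(1)] by simp
    then obtain c where c: "(a, c) \<in> adj i" "a \<noteq> c" "\<delta> c d0 = s i \<circ> \<delta> a d0" "\<not> descent i (\<delta> c d0)"
      using dist_step_down[OF i x(2) Md(3)[OF y0(1)]] by blast
    have cC: "c \<in> C" using adjD[OF i c(1)] by simp
    have "\<delta> c d = inv (x \<circ> s i) \<circ> y" if yd: "(y, d) \<in> M" for y d
    proof (cases "descent i (inv x \<circ> y)")
      case False
      then show ?thesis using up[OF c(1) c(2)[symmetric] yd] by blast
    next
      case True
      then have "descent i (\<delta> a d)" using Md(1)[OF yd] by simp
      then obtain c2 where c2: "(a, c2) \<in> adj i" "a \<noteq> c2" "\<delta> c2 d = s i \<circ> \<delta> a d" "\<not> descent i (\<delta> c2 d)"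
        using dist_step_down[OF i x(2) Md(3)[OF yd]] by blast
      have "(c, c2) \<in> adj i" using adj_trans[OF i adj_sym[OF i c(1)] c2(1)] .
      moreover have "\<delta> d0 d = inv (\<delta> c d0) \<circ> \<delta> c2 d"
      proof -
        have W: "inv x \<in> W" "y0 \<in> W" "s i \<in> W" using inv_in_W x Md[OF y0(1)] s_in_W i by auto
        have "inv (\<delta> c d0) = inv (s i \<circ> (inv x \<circ> y0))" using c(3) Md(1)[OF y0(1)] by simp
        also have "\<dots> = inv (inv x \<circ> y0) \<circ> s i" using W_inv_comp[OF W(3) comp_in_W[OF W(1,2)]] inv_s[OF i] by simp
        also have "inv (inv x \<circ> y0) = inv y0 \<circ> x" using W_inv_comp[OF W(1,2)] W_inv_inv[OF x(1)] by simp
        finally have e: "inv (\<delta> c d0) = inv y0 \<circ> x \<circ> s i" .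
        have "inv (\<delta> c d0) \<circ> \<delta> c2 d = inv y0 \<circ> x \<circ> s i \<circ> (s i \<circ> (inv x \<circ> y))"
          unfolding e c2(3) Md(1)[OF yd] ..
        also have "\<dots> = inv y0 \<circ> (x \<circ> (s i \<circ> (s i \<circ> (inv x \<circ> y))))" by (simp only: comp_assoc)
        also have "\<dots> = inv y0 \<circ> y" unfolding s_comp_s_comp[OF i] W_cancel_right[OF x(1)] ..
        also have "\<dots> = \<delta> d0 d" by (rule isometricD[OF M y0(1) yd, symmetric])
        finally show ?thesis by simp
      qed
      ultimately have "c = c2"
        using panel_projections_agree[OF i _ Md(3)[OF y0(1)] Md(3)[OF yd] c(4) c2(4)] by blast
      then show ?thesis using c2(3) Md(1)[OF yd] sx by (simp add: comp_assoc)
    qed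
    then show ?thesis using that isometric_insert[OF M xs cC] by blast
  qed
qed

text \<open>Start from the two pairs given by \<open>a\<close> and \<open>b\<close> and take a
  maximal partial isometry. Its domain contains the identity and, by
  \<open>isometric_extend\<close>, is closed under right multiplication by simple reflections, so it
  is all of \<open>W\<close>. Its image is the future apartment through \<open>a\<close> and
  \<open>b\<close>.\<close>

lemma isometry_exists:
  assumes C: "a \<in> C" "b \<in> C"
  obtains f where "\<And>u. u \<in> W \<Longrightarrow> f u \<in> C" "\<And>u v. u \<in> W \<Longrightarrow> v \<in> W \<Longrightarrow> \<delta> (f u) (f v) = inv u \<circ> v"
    "f id = a" "f (\<delta> a b) = b"
proof -
  define M0 where "M0 = {(id, a), (\<delta> a b, b)}"
  have "isometric {}" by (simp add: isometric_def)
  then have "isometric {(\<delta> a b, b)}" by (rule isometric_insert) (use C dist_in_W in auto)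
  then have M0: "isometric M0" unfolding M0_def
    by (rule isometric_insert) (use C id_in_W in auto)
  define A where "A = {M. M0 \<subseteq> M \<and> isometric M}"
  have "\<exists>M\<in>A. \<forall>X\<in>A. M \<subseteq> X \<longrightarrow> X = M"
  proof (rule subset_Zorn_nonempty)
    show "A \<noteq> {}" using M0 by (auto simp: A_def)
    fix K assume K: "K \<noteq> {}" "subset.chain A K"
    then have KA: "K \<subseteq> A" and lin: "\<And>X Y. X \<in> K \<Longrightarrow> Y \<in> K \<Longrightarrow> X \<subseteq> Y \<or> Y \<subseteq> X"
      by (auto simp: subset_chain_def)
    have "\<delta> c d = inv u \<circ> v" if uv: "(u, c) \<in> \<Union>K" "(v, d) \<in> \<Union>K" for u c v d
    proof -
      obtain X Y where XY: "X \<in> K" "Y \<in> K" "(u, c) \<in> X" "(v, d) \<in> Y" using uv by blast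
      then have "\<exists>Z\<in>K. (u, c) \<in> Z \<and> (v, d) \<in> Z" using lin[OF XY(1,2)] by blast
      then obtain Z where "Z \<in> K" "(u, c) \<in> Z" "(v, d) \<in> Z" by blast
      moreover have "isometric Z" using KA \<open>Z \<in> K\<close> by (auto simp: A_def)
      ultimately show ?thesis by (intro isometricD)
    qed
    moreover have "\<Union>K \<subseteq> W \<times> C" using KA by (auto simp: A_def isometric_def)
    moreover have "M0 \<subseteq> \<Union>K" using K(1) KA by (auto simp: A_def)
    ultimately show "\<Union>K \<in> A" unfolding A_def isometric_def by blast
  qed
  then obtain M where MA: "M \<in> A" "\<forall>X\<in>A. M \<subseteq> X \<longrightarrow> X = M" by (elim bexE)
  then have M: "M0 \<subseteq> M" "isometric M" by (auto simp: A_def)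
  have mx: "X = M" if "M \<subseteq> X" "isometric X" for X
    using MA(2) M(1) that by (auto simp: A_def)
  have dom: "\<exists>c. (word js, c) \<in> M" if "js \<in> lists I" for js
    using that
  proof (induction js rule: rev_induct)
    case Nil
    show ?case unfolding word_Nil using M(1) unfolding M0_def by blast
  next
    case (snoc i js)
    then have i: "i \<in> I" and "js \<in> lists I" by auto
    then obtain c where c: "(word js, c) \<in> M" using snoc.IH by blast
    obtain d where "isometric (insert (word js \<circ> s i, d) M)" using isometric_extend[OF M(2) c i] by blast
    then have "insert (word js \<circ> s i, d) M = M" using mx by blast
    then have "(word js \<circ> s i, d) \<in> M" by blast
    moreover have "word (js @ [i]) = word js \<circ> s i" by (simp add: word_append)
    ultimately show ?case by metis
  qed
  define f where "f u = (SOME c. (u, c) \<in> M)" for u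
  have fM: "(u, f u) \<in> M" if u: "u \<in> W" for u
  proof -
    obtain js where "js \<in> lists I" "u = word js" using u unfolding W_eq_words by blast
    then have "\<exists>c. (u, c) \<in> M" using dom by simp
    then show ?thesis unfolding f_def by (rule someI_ex)
  qed
  have fC: "f u \<in> C" if "u \<in> W" for u using fM[OF that] M(2) by (auto simp: isometric_def)
  have fd: "\<delta> (f u) (f v) = inv u \<circ> v" if "u \<in> W" "v \<in> W" for u v
    by (rule isometricD[OF M(2) fM[OF that(1)] fM[OF that(2)]])
  have uniq: "f u = c" if uc: "(u, c) \<in> M" for u c
  proof -
    have u: "u \<in> W" "c \<in> C" using uc M(2) by (auto simp: isometric_def)
    have "\<delta> (f u) c = inv u \<circ> u" by (rule isometricD[OF M(2) fM[OF u(1)] uc])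
    then have "\<delta> (f u) c = id" using W_cancel_left[OF u(1), of id] by simp
    then show ?thesis using dist_id_iff[OF fC[OF u(1)] u(2)] by blast
  qed
  show ?thesis by (rule that[of f]) (use fC fd uniq M(1) in \<open>auto simp: M0_def\<close>)
qed

end

section \<open>Vertices, apartments and vector distance\<close>

lemma simplicial_iso_comp:
  assumes "simplicial_iso K L f" "simplicial_iso L M g"
  shows "simplicial_iso K M (\<lambda>v. g (f v))"
proof -
  have "bij_betw (g \<circ> f) (\<Union>K) (\<Union>M)"
    using assms bij_betw_trans unfolding simplicial_iso_def by blast
  moreover have "(\<lambda>s. (\<lambda>v. g (f v)) ` s) ` K = (\<lambda>s. g ` s) ` (\<lambda>s. f ` s) ` K"
    by (simp add: image_image)
  ultimately show ?thesis using assms unfolding simplicial_iso_def by (simp add: comp_def)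
qed

section \<open>Residues as vertices\<close>

context building
begin

lemma s_fixes_vertex: "i \<in> I \<Longrightarrow> j \<in> I - {i} \<Longrightarrow> s j (fund_vertex i) = fund_vertex i"
  using s_fixes[of j "fund_vertex i"] fund_vertex_on_wall[of j i] by auto

lemma residue_dist_fixes:
  assumes "i \<in> I" "c \<in> C" "(c, d) \<in> (\<Union>j\<in>I - {i}. adj j)\<^sup>*"
  shows "d \<in> C \<and> \<delta> c d (fund_vertex i) = fund_vertex i"
  using assms(3)
proof (induction rule: rtrancl_induct)
  case base
  show ?case using assms dist_self by simp
next
  case (step d e)
  then obtain j where j: "j \<in> I - {i}" "(d, e) \<in> adj j" by blast
  then have "j \<in> I" by blast
  have "e \<in> C" using adjD[OF \<open>j \<in> I\<close> j(2)] by simp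
  moreover have "\<delta> c e = \<delta> c d \<or> \<delta> c e = \<delta> c d \<circ> s j" by (rule dist_right_step[OF \<open>j \<in> I\<close> j(2) assms(2)])
  then have "\<delta> c e (fund_vertex i) = \<delta> c d (fund_vertex i)"
    using s_fixes_vertex[OF assms(1) j(1)] by auto
  ultimately show ?case using step by simp
qed

lemma residue_of_word:
  assumes "js \<in> lists (I - {i})" "c \<in> C" "d \<in> C" "\<delta> c d = word js"
  shows "(c, d) \<in> (\<Union>j\<in>I - {i}. adj j)\<^sup>*"
  using assms
proof (induction js arbitrary: c)
  case Nil
  have "\<delta> c d = id" using Nil.prems(3) unfolding word_Nil .
  then have "c = d" using dist_id_iff[OF Nil.prems(1,2)] by blast
  then show ?case by simp
next
  case (Cons j js)
  then have j: "j \<in> I" "j \<in> I - {i}" by auto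
  obtain c' where c': "(c, c') \<in> adj j" "\<delta> c' d = s j \<circ> \<delta> c d"
    using dist_left_attain[OF j(1) Cons.prems(1,2)] by blast
  have "\<delta> c' d = word js" unfolding c'(2) Cons.prems(3) word_Cons by (rule s_comp_s_comp[OF j(1)])
  then have "(c', d) \<in> (\<Union>j\<in>I - {i}. adj j)\<^sup>*"
    using Cons.IH[of c'] adjD[OF j(1) c'(1)] Cons.prems by blast
  moreover have "(c, c') \<in> (\<Union>j\<in>I - {i}. adj j)" using c'(1) j(2) by blast
  ultimately show ?case by (rule converse_rtrancl_into_rtrancl[rotated])
qed

text \<open>Steps inside the residue use reflections fixing vertex \<open>i\<close>. Conversely
  \<open>fund_vertex_conj\<close> writes a distance fixing that vertex as a word without the letter
  \<open>i\<close>, which \<open>residue_of_word\<close> follows letter by letter.\<close>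

lemma residue_iff:
  assumes "i \<in> I" "c \<in> C" "d \<in> C"
  shows "(c, d) \<in> (\<Union>j\<in>I - {i}. adj j)\<^sup>* \<longleftrightarrow> \<delta> c d (fund_vertex i) = fund_vertex i"
proof
  show "\<delta> c d (fund_vertex i) = fund_vertex i" if "(c, d) \<in> (\<Union>j\<in>I - {i}. adj j)\<^sup>*"
    using residue_dist_fixes[OF assms(1,2) that] by simp
  assume "\<delta> c d (fund_vertex i) = fund_vertex i"
  then obtain js where js: "js \<in> lists (I - {i})" "word js = \<delta> c d"
    using fund_vertex_conj(2)[OF dist_in_W[OF assms(2,3)] assms(1,1)] by blast
  show "(c, d) \<in> (\<Union>j\<in>I - {i}. adj j)\<^sup>*" by (rule residue_of_word[OF js(1) assms(2,3) js(2)[symmetric]])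
qed

lemma residue_sym: "(c, d) \<in> (\<Union>j\<in>I - {i}. adj j)\<^sup>* \<Longrightarrow> (d, c) \<in> (\<Union>j\<in>I - {i}. adj j)\<^sup>*"
proof -
  have "sym (\<Union>j\<in>I - {i}. adj j)" using adj_sym by (auto simp: sym_def)
  then show "(c, d) \<in> (\<Union>j\<in>I - {i}. adj j)\<^sup>* \<Longrightarrow> (d, c) \<in> (\<Union>j\<in>I - {i}. adj j)\<^sup>*"
    using sym_rtrancl by (meson symD)
qed

lemma vertex_of_eq_iff:
  assumes "i \<in> I" "c \<in> C" "d \<in> C"
  shows "vertex_of i c = vertex_of i d \<longleftrightarrow> \<delta> c d (fund_vertex i) = fund_vertex i"
proof -
  let ?r = "(\<Union>j\<in>I - {i}. adj j)\<^sup>*"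
  have "?r `` {c} = ?r `` {d} \<longleftrightarrow> (c, d) \<in> ?r"
  proof
    assume "?r `` {c} = ?r `` {d}"
    moreover have "d \<in> ?r `` {d}" by simp
    ultimately show "(c, d) \<in> ?r" by blast
  next
    assume cd: "(c, d) \<in> ?r"
    then have dc: "(d, c) \<in> ?r" by (rule residue_sym)
    show "?r `` {c} = ?r `` {d}"
      using rtrancl_trans[OF cd] rtrancl_trans[OF dc] by (intro equalityI subsetI) auto
  qed
  then show ?thesis unfolding vertex_of_def residue_iff[OF assms, symmetric] by simp
qed

section \<open>Apartments as isometric images of the affine Weyl group\<close>

lemma fst_vertex_of [simp]: "fst (vertex_of i c) = i" by (simp add: vertex_of_def)

text \<open>The preimage of the vertex set of an alcove lies in the vertex set of one chamber, and
  types show that it is all of it; this chamber is the value of \<open>f\<close>. Adjacent alcoves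
  share all vertices but one, so their chambers are adjacent, and reduced words become
  galleries.\<close>

lemma apartment_isometry:
  assumes sub: "subcomplex A building_complex" and iso: "type_preserving_iso A \<psi>"
  shows "\<exists>f. (\<forall>u\<in>W. f u \<in> C) \<and>
    (\<forall>u\<in>W. \<forall>k\<in>I. vertex_of k (f u) \<in> \<Union>A \<and> \<psi> (vertex_of k (f u)) = u (fund_vertex k)) \<and>
    (\<forall>u\<in>W. \<forall>v\<in>W. \<delta> (f u) (f v) = inv u \<circ> v)"
proof -
  have bij: "bij_betw \<psi> (\<Union>A) (\<Union>coxeter_complex)" and img: "(\<lambda>s. \<psi> ` s) ` A = coxeter_complex"
    and ty: "\<And>v. v \<in> \<Union>A \<Longrightarrow> vertex_type (\<psi> v) = fst v"
    using iso by (auto simp: type_preserving_iso_def simplicial_iso_def)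
  have inj: "x = y" if "x \<in> \<Union>A" "y \<in> \<Union>A" "\<psi> x = \<psi> y" for x y
    using bij that by (auto simp: bij_betw_def inj_on_def)
  have ex: "\<exists>c. c \<in> C \<and> (\<forall>k\<in>I. vertex_of k c \<in> \<Union>A \<and> \<psi> (vertex_of k c) = u (fund_vertex k))" if u: "u \<in> W" for u
  proof -
    have "u ` fund_vertex ` I \<in> coxeter_complex" unfolding coxeter_complex_eq using u by blast
    then obtain t where t: "t \<in> A" "\<psi> ` t = u ` fund_vertex ` I" using img by (metis imageE)
    then have "t \<in> building_complex" using sub by (auto simp: subcomplex_def)
    then obtain c where c: "c \<in> C" "t \<subseteq> (\<lambda>i. vertex_of i c) ` I" by (auto simp: building_complex_def)
    have "vertex_of k c \<in> \<Union>A \<and> \<psi> (vertex_of k c) = u (fund_vertex k)" if k: "k \<in> I" for k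
    proof -
      have "u (fund_vertex k) \<in> \<psi> ` t" unfolding t(2) using k by blast
      then obtain x where x: "x \<in> t" "\<psi> x = u (fund_vertex k)" by (metis imageE)
      then obtain i where i: "x = vertex_of i c" using c(2) by blast
      have xA: "x \<in> \<Union>A" using x(1) t(1) by blast
      then have "i = k" using ty[OF xA] i x(2) vertex_type_conj[OF u k] by simp
      then show ?thesis using x xA i by simp
    qed
    then show ?thesis using c(1) by (intro exI[of _ c] conjI ballI) simp_all
  qed
  define f where "f u = (SOME c. c \<in> C \<and> (\<forall>k\<in>I. vertex_of k c \<in> \<Union>A \<and> \<psi> (vertex_of k c) = u (fund_vertex k)))" for u
  have f: "f u \<in> C \<and> (\<forall>k\<in>I. vertex_of k (f u) \<in> \<Union>A \<and> \<psi> (vertex_of k (f u)) = u (fund_vertex k))" if "u \<in> W" for u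
    unfolding f_def using ex[OF that] by (rule someI_ex)
  have fC: "f u \<in> C" if "u \<in> W" for u using f[OF that] by blast
  have fv: "vertex_of k (f u) \<in> \<Union>A" "\<psi> (vertex_of k (f u)) = u (fund_vertex k)" if "u \<in> W" "k \<in> I" for u k
    using f[OF that(1)] that(2) by blast+
  have step: "(f u, f (u \<circ> s j)) \<in> adj j \<and> f u \<noteq> f (u \<circ> s j)" if u: "u \<in> W" and j: "j \<in> I" for u j
  proof -
    have us: "u \<circ> s j \<in> W" using comp_in_W u s_in_W j by blast
    let ?d = "\<delta> (f u) (f (u \<circ> s j))"
    have "?d = id \<or> ?d = s j"
    proof (rule fixes_panel[OF dist_in_W[OF fC[OF u] fC[OF us]] j])
      fix k assume k: "k \<in> I" "k \<noteq> j"
      have "\<psi> (vertex_of k (f u)) = \<psi> (vertex_of k (f (u \<circ> s j)))"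
        unfolding fv(2)[OF u k(1)] fv(2)[OF us k(1)] using s_fixes_vertex[OF k(1), of j] j k(2) by simp
      then have "vertex_of k (f u) = vertex_of k (f (u \<circ> s j))" by (rule inj[OF fv(1)[OF u k(1)] fv(1)[OF us k(1)]])
      then show "?d (fund_vertex k) = fund_vertex k"
        using vertex_of_eq_iff[OF k(1) fC[OF u] fC[OF us]] by simp
    qed
    moreover have "f u \<noteq> f (u \<circ> s j)"
    proof
      assume "f u = f (u \<circ> s j)"
      then have "u (fund_vertex j) = u (s j (fund_vertex j))"
        using fv(2)[OF u j] fv(2)[OF us j] by simp
      then have "inv u (u (fund_vertex j)) = inv u (u (s j (fund_vertex j)))" by simp
      then have "s j (fund_vertex j) = fund_vertex j" using W_aff_auts[OF u] by simp
      then show False using wall_s[OF j, of "fund_vertex j"] fund_vertex_on_wall[OF j j] by (simp add: wall_plane_iff)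
    qed
    ultimately show ?thesis using dist_s_iff[OF j fC[OF u] fC[OF us]] dist_id_iff[OF fC[OF u] fC[OF us]] by blast
  qed
  have gal: "gallery js (f u) (f (u \<circ> word js))" if "u \<in> W" "js \<in> lists I" for u js
    using that(2,1)
  proof (induction js arbitrary: u)
    case Nil
    show ?case by simp
  next
    case (Cons j js)
    have us: "u \<circ> s j \<in> W" using comp_in_W[OF Cons.prems s_in_W[OF Cons.hyps(1)]] .
    have "gallery js (f (u \<circ> s j)) (f (u \<circ> s j \<circ> word js))" by (rule Cons.IH[OF us])
    then have "gallery (j # js) (f u) (f (u \<circ> s j \<circ> word js))"
      using step[OF Cons.prems Cons.hyps(1)] by (subst gallery.simps) blast
    moreover have "u \<circ> s j \<circ> word js = u \<circ> word (j # js)" unfolding word_Cons by (rule comp_assoc)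
    ultimately show ?case by metis
  qed
  have fd: "\<delta> (f u) (f v) = inv u \<circ> v" if u: "u \<in> W" and v: "v \<in> W" for u v
  proof -
    obtain js where js: "reduced_word js" "word js = inv u \<circ> v" using comp_in_W[OF inv_in_W[OF u] v] by (rule WE)
    have "js \<in> lists I" using js(1) by (simp add: reduced_word_def)
    have "u \<circ> word js = v" unfolding js(2) by (rule W_cancel_right[OF u])
    then have "gallery js (f u) (f v)" using gal[OF u \<open>js \<in> lists I\<close>] by simp
    then show ?thesis using dist_iff[OF js(1) fC[OF u] fC[OF v]] js(2) by simp
  qed
  show ?thesis by (intro exI[of _ f] conjI ballI fC fv fd)
qed

lemma apartment_exists:
  assumes C: "a \<in> C" "b \<in> C"
  shows "\<exists>A \<psi>. apartment A \<and> type_preserving_iso A \<psi> \<and>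
    (\<forall>k\<in>I. vertex_of k a \<in> \<Union>A \<and> \<psi> (vertex_of k a) = fund_vertex k) \<and>
    (\<forall>k\<in>I. vertex_of k b \<in> \<Union>A \<and> \<psi> (vertex_of k b) = \<delta> a b (fund_vertex k))"
proof -
  obtain f where fC: "\<And>u. u \<in> W \<Longrightarrow> f u \<in> C" and fd: "\<And>u v. u \<in> W \<Longrightarrow> v \<in> W \<Longrightarrow> \<delta> (f u) (f v) = inv u \<circ> v"
    and fa: "f id = a" and fb: "f (\<delta> a b) = b" using isometry_exists[OF C] by blast
  define A where "A = {t. \<exists>u\<in>W. t \<subseteq> (\<lambda>k. vertex_of k (f u)) ` I}"
  \<comment> \<open>A representing \<open>u\<close> is chosen; the fact \<open>same\<close> below
    shows that the value does not depend on the choice.\<close>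
  define \<psi> where "\<psi> x = (SOME u. u \<in> W \<and> x = vertex_of (fst x) (f u)) (fund_vertex (fst x))" for x
  have same: "vertex_of k (f u) = vertex_of k (f v) \<longleftrightarrow> u (fund_vertex k) = v (fund_vertex k)"
    if k: "k \<in> I" and u: "u \<in> W" and v: "v \<in> W" for k u v
  proof -
    have "vertex_of k (f u) = vertex_of k (f v) \<longleftrightarrow> inv u (v (fund_vertex k)) = fund_vertex k"
      unfolding vertex_of_eq_iff[OF k fC[OF u] fC[OF v]] fd[OF u v] by simp
    also have "\<dots> \<longleftrightarrow> u (fund_vertex k) = v (fund_vertex k)"
      using W_aff_auts[OF u] by (metis aff_auts_f_inv aff_auts_inv_f)
    finally show ?thesis .
  qed
  have psi: "\<psi> (vertex_of k (f u)) = u (fund_vertex k)" if k: "k \<in> I" and u: "u \<in> W" for k u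
  proof -
    let ?v = "SOME v. v \<in> W \<and> vertex_of k (f u) = vertex_of k (f v)"
    have "?v \<in> W \<and> vertex_of k (f u) = vertex_of k (f ?v)" by (rule someI[of _ u]) (use u in simp)
    then show ?thesis using same[OF k u, of ?v] by (simp add: \<psi>_def)
  qed
  have UA: "\<Union>A = {vertex_of k (f u) | k u. k \<in> I \<and> u \<in> W}"
  proof (intro equalityI subsetI)
    fix x assume "x \<in> {vertex_of k (f u) | k u. k \<in> I \<and> u \<in> W}"
    then obtain k u where x: "k \<in> I" "u \<in> W" "x = vertex_of k (f u)" by blast
    then have "{x} \<in> A" unfolding A_def by blast
    then show "x \<in> \<Union>A" by blast
  next
    fix x assume "x \<in> \<Union>A"
    then obtain t u where "x \<in> t" "u \<in> W" "t \<subseteq> (\<lambda>k. vertex_of k (f u)) ` I" unfolding A_def by blast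
    then show "x \<in> {vertex_of k (f u) | k u. k \<in> I \<and> u \<in> W}" by blast
  qed
  have ty: "vertex_type (\<psi> x) = fst x" if x: "x \<in> \<Union>A" for x
  proof -
    obtain k u where "k \<in> I" "u \<in> W" "x = vertex_of k (f u)" using x unfolding UA by blast
    then show ?thesis using vertex_type_conj psi by simp
  qed
  have "inj_on \<psi> (\<Union>A)"
  proof (rule inj_onI)
    fix x y assume xy: "x \<in> \<Union>A" "y \<in> \<Union>A" "\<psi> x = \<psi> y"
    obtain k u where x: "k \<in> I" "u \<in> W" "x = vertex_of k (f u)" using xy(1) unfolding UA by blast
    obtain l v where y: "l \<in> I" "v \<in> W" "y = vertex_of l (f v)" using xy(2) unfolding UA by blast
    have "fst x = fst y" using ty[OF xy(1)] ty[OF xy(2)] xy(3) by simp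
    then have "k = l" using x y by simp
    then show "x = y" using xy(3) same[OF x(1,2) y(2)] psi x y by simp
  qed
  moreover have "\<psi> ` \<Union>A = \<Union>coxeter_complex"
    unfolding UA vertices_coxeter_complex
  proof (intro equalityI subsetI)
    fix p assume "p \<in> {w (fund_vertex i) | w i. w \<in> W \<and> i \<in> I}"
    then obtain w i where "w \<in> W" "i \<in> I" "p = w (fund_vertex i)" by blast
    then have "p = \<psi> (vertex_of i (f w))" using psi by simp
    then show "p \<in> \<psi> ` {vertex_of k (f u) | k u. k \<in> I \<and> u \<in> W}" using \<open>w \<in> W\<close> \<open>i \<in> I\<close> by blast
  next
    fix p assume "p \<in> \<psi> ` {vertex_of k (f u) | k u. k \<in> I \<and> u \<in> W}"
    then obtain k u where "k \<in> I" "u \<in> W" "p = \<psi> (vertex_of k (f u))" by blast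
    then show "p \<in> {w (fund_vertex i) | w i. w \<in> W \<and> i \<in> I}" using psi by blast
  qed
  moreover have "(\<lambda>t. \<psi> ` t) ` A = coxeter_complex"
  proof (intro equalityI subsetI)
    fix r assume "r \<in> (\<lambda>t. \<psi> ` t) ` A"
    then obtain t u where t: "r = \<psi> ` t" "u \<in> W" "t \<subseteq> (\<lambda>k. vertex_of k (f u)) ` I" by (auto simp: A_def)
    have "r \<subseteq> u ` fund_vertex ` I"
    proof
      fix p assume "p \<in> r"
      then obtain x where "x \<in> t" "p = \<psi> x" using t(1) by blast
      then obtain k where "k \<in> I" "p = \<psi> (vertex_of k (f u))" using t(3) by blast
      then show "p \<in> u ` fund_vertex ` I" using psi[OF _ t(2)] by simp
    qed
    then show "r \<in> coxeter_complex" unfolding coxeter_complex_eq using t(2) by blast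
  next
    fix r assume "r \<in> coxeter_complex"
    then obtain u where u: "u \<in> W" "r \<subseteq> u ` fund_vertex ` I" unfolding coxeter_complex_eq by blast
    let ?t = "(\<lambda>k. vertex_of k (f u)) ` {k\<in>I. u (fund_vertex k) \<in> r}"
    have "?t \<in> A" unfolding A_def using u(1) by blast
    moreover have "\<psi> ` ?t = (\<lambda>k. u (fund_vertex k)) ` {k\<in>I. u (fund_vertex k) \<in> r}"
      unfolding image_image using psi[OF _ u(1)] by (intro image_cong) auto
    then have "\<psi> ` ?t = r" using u(2) by auto
    ultimately show "r \<in> (\<lambda>t. \<psi> ` t) ` A" by blast
  qed
  ultimately have iso: "type_preserving_iso A \<psi>"
    using ty by (auto simp: type_preserving_iso_def simplicial_iso_def bij_betw_def)
  have "subcomplex A building_complex"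
    unfolding subcomplex_def A_def building_complex_def using fC by blast
  then have ap: "apartment A" using iso by (auto simp: apartment_def)
  show ?thesis
  proof (intro exI[of _ A] exI[of _ \<psi>] conjI[OF ap] conjI[OF iso], intro conjI ballI)
    fix k assume k: "k \<in> I"
    have "vertex_of k a \<in> \<Union>A \<and> \<psi> (vertex_of k a) = fund_vertex k"
      using psi[OF k id_in_W] k id_in_W unfolding UA fa[symmetric] by auto
    have w: "\<delta> a b \<in> W" using dist_in_W C by blast
    have "\<psi> (vertex_of k b) = \<delta> a b (fund_vertex k)" using psi[OF k w] unfolding fb .
    moreover have "vertex_of k (f (\<delta> a b)) \<in> \<Union>A" unfolding UA using k w by blast
    ultimately have "vertex_of k b \<in> \<Union>A \<and> \<psi> (vertex_of k b) = \<delta> a b (fund_vertex k)" unfolding fb by blast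
    note ab = this \<open>vertex_of k a \<in> \<Union>A \<and> \<psi> (vertex_of k a) = fund_vertex k\<close>
    show "vertex_of k a \<in> \<Union>A" "\<psi> (vertex_of k a) = fund_vertex k"
      "vertex_of k b \<in> \<Union>A" "\<psi> (vertex_of k b) = \<delta> a b (fund_vertex k)"
      using ab by simp_all
  qed
qed

text \<open>A good vertex of type \<open>node_perm g 0\<close> corresponds to \<open>g \<in> G\<close>; pairing chambers with
  elements of \<open>G\<close> gives an extended distance \<open>inv g \<circ> \<delta> a b \<circ> h\<close> with values in the
  extended affine Weyl group, whose \<open>W\<^sub>0\<close>-double coset is read off from the image of \<open>0\<close>.\<close>

lemma node_perm_0_in: "g \<in> G \<Longrightarrow> node_perm g 0 \<in> I"
  using node_perm_in[OF G_alcove_auts] by simp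

lemma good_vertices_eq: "good_vertices = {vertex_of (node_perm g 0) c | g c. g \<in> G \<and> c \<in> C}"
proof (intro equalityI subsetI)
  fix x assume "x \<in> good_vertices"
  then obtain i c where x: "i \<in> I" "c \<in> C" "x = vertex_of i c" "i \<in> I_P"
    by (auto simp: good_vertices_def vertices_def)
  obtain g where "g \<in> G" "node_perm g 0 = i" using x(4) by (rule I_P_G) blast
  then show "x \<in> {vertex_of (node_perm g 0) c | g c. g \<in> G \<and> c \<in> C}" using x by blast
next
  fix x assume "x \<in> {vertex_of (node_perm g 0) c | g c. g \<in> G \<and> c \<in> C}"
  then obtain g c where x: "g \<in> G" "c \<in> C" "x = vertex_of (node_perm g 0) c" by blast
  then show "x \<in> good_vertices" unfolding good_vertices_def vertices_def
    using node_perm_0_in[OF x(1)] G_node_I_P[OF x(1)] by auto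
qed

lemma orbit_left_step:
  assumes g: "g \<in> G" and j: "j \<in> I - {node_perm g 0}"
  shows "inv g (s j z) \<in> orbit l \<longleftrightarrow> inv g z \<in> orbit l"
proof -
  have jI: "j \<in> I" using j by blast
  let ?w = "inv g \<circ> s j \<circ> g"
  have gA: "g \<in> aff_auts" using G_aff_auts g by blast
  have "?w \<in> W_ext" using W_ext_comp W_ext_inv G_W_ext[OF g] W_subset_W_ext[OF s_in_W[OF jI]] by blast
  moreover have "?w 0 = 0"
    using s_fixes_vertex[OF node_perm_0_in[OF g] j] G_node[OF g] aff_auts_inv_f[OF gA, of 0] by simp
  ultimately have "?w \<in> W0" by (rule W_ext_fixing_0)
  moreover have "?w (inv g z) = inv g (s j z)" using gA by simp
  ultimately show ?thesis using orbit_W0[of ?w "inv g z" l] by metis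
qed

lemma orbit_left_residue:
  assumes g: "g \<in> G" and b: "b \<in> C" and r: "(a, a') \<in> (\<Union>j\<in>I - {node_perm g 0}. adj j)\<^sup>*"
  shows "inv g (\<delta> a b p) \<in> orbit l \<longleftrightarrow> inv g (\<delta> a' b p) \<in> orbit l"
  using r
proof (induction rule: rtrancl_induct)
  case base
  show ?case by simp
next
  case (step d e)
  then obtain j where j: "j \<in> I - {node_perm g 0}" "(d, e) \<in> adj j" by blast
  then have jI: "j \<in> I" by blast
  have "\<delta> e b = \<delta> d b \<or> \<delta> e b = s j \<circ> \<delta> d b" by (rule dist_left_step[OF jI j(2) b])
  then have "\<delta> e b p = \<delta> d b p \<or> \<delta> e b p = s j (\<delta> d b p)" by (elim disjE) simp_all
  then have "inv g (\<delta> e b p) \<in> orbit l \<longleftrightarrow> inv g (\<delta> d b p) \<in> orbit l"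
    using orbit_left_step[OF g j(1), of "\<delta> d b p" l] by (elim disjE) simp_all
  then show ?case using step.IH by blast
qed

text \<open>Moving \<open>a\<close> within the residue of its vertex changes the extended distance
  on the left by elements \<open>inv g \<circ> s j \<circ> g\<close> that fix 0 and so lie in
  \<open>W0\<close>. Moving \<open>b\<close> appends reflections fixing \<open>h 0\<close>. Thus the
  condition depends only on the two vertices.\<close>

lemma orbit_vertex_invariant:
  assumes g: "g \<in> G" and h: "h \<in> G" and C: "a \<in> C" "b \<in> C" "a' \<in> C" "b' \<in> C"
    and va: "vertex_of (node_perm g 0) a = vertex_of (node_perm g 0) a'"
    and vb: "vertex_of (node_perm h 0) b = vertex_of (node_perm h 0) b'"
  shows "inv g (\<delta> a b (h 0)) \<in> orbit l \<longleftrightarrow> inv g (\<delta> a' b' (h 0)) \<in> orbit l"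
proof -
  have ga: "node_perm g 0 \<in> I" "node_perm h 0 \<in> I" using node_perm_0_in g h by auto
  have "(a, a') \<in> (\<Union>j\<in>I - {node_perm g 0}. adj j)\<^sup>*"
    using va vertex_of_eq_iff[OF ga(1) C(1,3)] residue_iff[OF ga(1) C(1,3)] by simp
  then have 1: "inv g (\<delta> a b (h 0)) \<in> orbit l \<longleftrightarrow> inv g (\<delta> a' b (h 0)) \<in> orbit l"
    by (rule orbit_left_residue[OF g C(2)])
  have "(b, b') \<in> (\<Union>j\<in>I - {node_perm h 0}. adj j)\<^sup>*"
    using vb vertex_of_eq_iff[OF ga(2) C(2,4)] residue_iff[OF ga(2) C(2,4)] by simp
  then have "\<delta> a' b' (h 0) = \<delta> a' b (h 0)"
  proof (induction rule: rtrancl_induct)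
    case base
    show ?case by simp
  next
    case (step d e)
    then obtain j where j: "j \<in> I - {node_perm h 0}" "(d, e) \<in> adj j" by blast
    then have jI: "j \<in> I" by blast
    have "\<delta> a' e = \<delta> a' d \<or> \<delta> a' e = \<delta> a' d \<circ> s j" by (rule dist_right_step[OF jI j(2) C(3)])
    then have "\<delta> a' e (h 0) = \<delta> a' d (h 0)"
      using s_fixes_vertex[OF ga(2) j(1)] G_node[OF h] by (elim disjE) simp_all
    then show ?case using step.IH by simp
  qed
  then show ?thesis using 1 by simp
qed

theorem vertex_sphere_iff:
  assumes g: "g \<in> G" and h: "h \<in> G" and C: "a \<in> C" "b \<in> C"
  shows "vertex_of (node_perm h 0) b \<in> vertex_sphere l (vertex_of (node_perm g 0) a) \<longleftrightarrow>
    inv g (\<delta> a b (h 0)) \<in> orbit l"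
proof
  let ?x = "vertex_of (node_perm g 0) a" and ?y = "vertex_of (node_perm h 0) b"
  have nI: "node_perm g 0 \<in> I" "node_perm h 0 \<in> I" using node_perm_0_in g h by auto
  have gA: "g \<in> aff_auts" using G_aff_auts g by blast
  {
    assume "?y \<in> vertex_sphere l ?x"
    then obtain A \<psi> where A: "apartment A" "?x \<in> \<Union>A" "?y \<in> \<Union>A" "type_rotating_iso A \<psi>" "\<psi> ?x = 0" "\<psi> ?y = l"
      unfolding vertex_sphere_def by blast
    obtain w \<psi>1 where w: "w \<in> W_ext" "type_preserving_iso A \<psi>1" "\<And>v. v \<in> \<Union>A \<Longrightarrow> \<psi> v = w (\<psi>1 v)"
      using A(4) unfolding type_rotating_iso_def by blast
    have sub: "subcomplex A building_complex" using A(1) by (simp add: apartment_def)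
    obtain f where f: "\<forall>u\<in>W. f u \<in> C"
      "\<forall>u\<in>W. \<forall>k\<in>I. vertex_of k (f u) \<in> \<Union>A \<and> \<psi>1 (vertex_of k (f u)) = u (fund_vertex k)"
      "\<forall>u\<in>W. \<forall>v\<in>W. \<delta> (f u) (f v) = inv u \<circ> v"
      using apartment_isometry[OF sub w(2)] by (elim exE conjE)
    have fC: "f u \<in> C" if "u \<in> W" for u using f(1) that by (rule bspec)
    have fv: "vertex_of k (f u) \<in> \<Union>A \<and> \<psi>1 (vertex_of k (f u)) = u (fund_vertex k)"
      if "u \<in> W" "k \<in> I" for u k using bspec[OF bspec[OF f(2) that(1)] that(2)] .
    have fd: "\<delta> (f u) (f v) = inv u \<circ> v" if "u \<in> W" "v \<in> W" for u v
      using bspec[OF bspec[OF f(3) that(1)] that(2)] .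
    have bij: "bij_betw \<psi>1 (\<Union>A) (\<Union>coxeter_complex)" and ty: "\<And>v. v \<in> \<Union>A \<Longrightarrow> vertex_type (\<psi>1 v) = fst v"
      using w(2) by (auto simp: type_preserving_iso_def simplicial_iso_def)
    have find: "\<exists>u\<in>W. v = vertex_of (fst v) (f u) \<and> \<psi>1 v = u (fund_vertex (fst v))" if v: "v \<in> \<Union>A" for v
    proof -
      have "\<psi>1 v \<in> \<Union>coxeter_complex" using bij v by (auto simp: bij_betw_def)
      then obtain u k where u: "u \<in> W" "k \<in> I" "\<psi>1 v = u (fund_vertex k)" unfolding vertices_coxeter_complex by blast
      then have "k = fst v" using ty[OF v] vertex_type_conj by simp
      then have "\<psi>1 (vertex_of (fst v) (f u)) = \<psi>1 v" "vertex_of (fst v) (f u) \<in> \<Union>A" using fv[OF u(1,2)] u(3) by simp_all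
      then have "v = vertex_of (fst v) (f u)" using inj_onD[OF bij_betw_imp_inj_on[OF bij]] v by metis
      then show ?thesis using u \<open>k = fst v\<close> by blast
    qed
    obtain u where u: "u \<in> W" "?x = vertex_of (node_perm g 0) (f u)" "\<psi>1 ?x = u (g 0)"
      using find[OF A(2)] G_node[OF g] by auto
    obtain v where v: "v \<in> W" "?y = vertex_of (node_perm h 0) (f v)" "\<psi>1 ?y = v (h 0)"
      using find[OF A(3)] G_node[OF h] by auto
    have wA: "w \<in> aff_auts" "u \<in> aff_auts" using W_ext_aff_auts w(1) W_aff_auts u(1) by auto
    have z: "w (u (g 0)) = 0" "w (v (h 0)) = l" using w(3)[OF A(2)] w(3)[OF A(3)] A(5,6) u(3) v(3) by auto
    \<comment> \<open>Compares the coordinates of \<open>\<psi>\<close> with those of the extended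
      distance. It fixes 0, hence lies in \<open>W0\<close>, so both see the second vertex in the
      same orbit.\<close>
    let ?z = "inv g \<circ> inv u \<circ> inv w"
    have "inv w 0 = u (g 0)" using aff_auts_inv_f[OF wA(1), of "u (g 0)"] z(1) by simp
    then have "?z 0 = 0" using wA(2) gA by simp
    moreover have "?z \<in> W_ext" using W_ext_comp W_ext_inv G_W_ext[OF g] W_subset_W_ext[OF u(1)] w(1) by blast
    ultimately have "?z \<in> W0" by (intro W_ext_fixing_0)
    then have "?z l \<in> orbit l" unfolding orbit_def by blast
    moreover have "?z l = inv g (\<delta> (f u) (f v) (h 0))"
      unfolding fd[OF u(1) v(1)] using aff_auts_inv_f[OF wA(1), of "v (h 0)"] z(2) by simp
    ultimately have "inv g (\<delta> (f u) (f v) (h 0)) \<in> orbit l" by simp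
    then show "inv g (\<delta> a b (h 0)) \<in> orbit l"
      using orbit_vertex_invariant[OF g h C fC[OF u(1)] fC[OF v(1)] u(2) v(2)] by simp
  next
    assume "inv g (\<delta> a b (h 0)) \<in> orbit l"
    then obtain w0 where w0: "w0 \<in> W0" "inv g (\<delta> a b (h 0)) = w0 l" unfolding orbit_def by blast
    obtain A \<psi> where A: "apartment A" "type_preserving_iso A \<psi>"
      "\<forall>k\<in>I. vertex_of k a \<in> \<Union>A \<and> \<psi> (vertex_of k a) = fund_vertex k"
      "\<forall>k\<in>I. vertex_of k b \<in> \<Union>A \<and> \<psi> (vertex_of k b) = \<delta> a b (fund_vertex k)"
      using apartment_exists[OF C] by (elim exE conjE)
    \<comment> \<open>\<open>inv g\<close> moves the position \<open>g 0\<close> of the first vertex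
      to the origin, and \<open>inv w0\<close> then moves the position of the second to
      \<open>l\<close> itself.\<close>
    let ?w = "inv w0 \<circ> inv g"
    have wE: "?w \<in> W_ext" using W_ext_comp W0_subset_W_ext[OF W0_inv[OF w0(1)]] W_ext_inv[OF G_W_ext[OF g]] by blast
    have s1: "simplicial_iso A coxeter_complex \<psi>" using A(2) by (simp add: type_preserving_iso_def)
    have "type_rotating_iso A (\<lambda>v. ?w (\<psi> v))" unfolding type_rotating_iso_def
      using simplicial_iso_comp[OF s1 simplicial_iso_aff_auts[OF W_ext_aff_auts[OF wE]]] wE A(2) by blast
    moreover have "?w (\<psi> ?x) = 0"
      using bspec[OF A(3) nI(1)] G_node[OF g] aff_auts_inv_f[OF gA, of 0] W0_fixes[OF W0_inv[OF w0(1)]] by simp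
    moreover have "?w (\<psi> ?y) = l"
      using bspec[OF A(4) nI(2)] G_node[OF h] w0(2) aff_auts_inv_f[OF W0_aff_auts[OF w0(1)]] by simp
    moreover have "?y \<in> good_vertices" unfolding good_vertices_eq using h C by blast
    moreover have "?x \<in> \<Union>A" "?y \<in> \<Union>A" using bspec[OF A(3) nI(1)] bspec[OF A(4) nI(2)] by auto
    ultimately show "?y \<in> vertex_sphere l ?x" using A(1) unfolding vertex_sphere_def by blast
  }
qed

end

section \<open>Counting chambers\<close>

text \<open>Turns equalities of finite counts into one bijection between sets that may be
  infinite.\<close>

lemma bij_of_equal_fibers:
  assumes fin: "\<And>x. finite {a\<in>A. \<phi> a = x}" "\<And>x. finite {b\<in>B. \<psi> b = x}"
    and eq: "\<And>x. card {a\<in>A. \<phi> a = x} = card {b\<in>B. \<psi> b = x}"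
  shows "\<exists>h. bij_betw h A B \<and> (\<forall>a\<in>A. \<psi> (h a) = \<phi> a)"
proof -
  have "\<exists>h. bij_betw h {a\<in>A. \<phi> a = x} {b\<in>B. \<psi> b = x}" for x
    by (rule finite_same_card_bij[OF fin eq])
  then obtain h where h: "\<And>x. bij_betw (h x) {a\<in>A. \<phi> a = x} {b\<in>B. \<psi> b = x}" by metis
  define k where "k a = h (\<phi> a) a" for a
  have k: "k a \<in> B \<and> \<psi> (k a) = \<phi> a" if "a \<in> A" for a
    using bij_betw_apply[OF h[of "\<phi> a"], of a] that by (simp add: k_def)
  have "inj_on k A"
  proof (rule inj_onI)
    fix a a' assume a: "a \<in> A" "a' \<in> A" "k a = k a'"
    then have e: "\<phi> a = \<phi> a'" using k by metis
    then have "h (\<phi> a) a = h (\<phi> a) a'" using a(3) by (simp add: k_def)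
    then show "a = a'" using inj_onD[OF bij_betw_imp_inj_on[OF h[of "\<phi> a"]]] a e by simp
  qed
  moreover have "k ` A = B"
  proof (intro equalityI subsetI)
    fix b assume b: "b \<in> B"
    then have "b \<in> h (\<psi> b) ` {a\<in>A. \<phi> a = \<psi> b}" using bij_betw_imp_surj_on[OF h[of "\<psi> b"]] by simp
    then obtain a where a: "a \<in> A" "\<phi> a = \<psi> b" "b = h (\<psi> b) a" by blast
    then have "b = k a" by (simp add: k_def)
    then show "b \<in> k ` A" using a(1) by blast
  qed (use k in auto)
  ultimately show ?thesis using k by (auto simp: bij_betw_def)
qed

section \<open>Conjugation by symmetries of the alcove, and double cosets under inversion\<close>

context root_datum
begin

definition conj_by :: "('a \<Rightarrow> 'a) \<Rightarrow> ('a \<Rightarrow> 'a) \<Rightarrow> 'a \<Rightarrow> 'a" where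
  "conj_by f w = f \<circ> w \<circ> inv f"

lemma conj_by_apply: "conj_by f w x = f (w (inv f x))" by (simp add: conj_by_def)

lemma conj_by_comp: "f \<in> aff_auts \<Longrightarrow> conj_by f (u \<circ> v) = conj_by f u \<circ> conj_by f v"
  by (simp add: fun_eq_iff conj_by_apply)

lemma conj_by_id: "f \<in> aff_auts \<Longrightarrow> conj_by f id = id"
  by (simp add: fun_eq_iff conj_by_apply)

lemma conj_by_inj: "f \<in> aff_auts \<Longrightarrow> conj_by f u = conj_by f v \<longleftrightarrow> u = v"
proof
  assume f: "f \<in> aff_auts" and e: "conj_by f u = conj_by f v"
  show "u = v"
  proof
    fix x
    have "inv f (conj_by f u (f x)) = inv f (conj_by f v (f x))" by (simp only: e)
    then show "u x = v x" using f by (simp add: conj_by_apply)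
  qed
qed simp

lemma conj_by_surj: "f \<in> aff_auts \<Longrightarrow> conj_by f (inv f \<circ> u \<circ> f) = u"
  by (simp add: fun_eq_iff conj_by_apply)

lemma conj_by_W: "f \<in> aff_auts \<Longrightarrow> w \<in> W \<Longrightarrow> conj_by f w \<in> W"
  unfolding conj_by_def by (rule W_conj)

lemma conj_by_W_iff: "f \<in> aff_auts \<Longrightarrow> conj_by f w \<in> W \<longleftrightarrow> w \<in> W"
proof
  assume f: "f \<in> aff_auts" and w: "conj_by f w \<in> W"
  have "conj_by (inv f) (conj_by f w) = w"
    using f aff_auts_bij[OF f] by (simp add: fun_eq_iff conj_by_apply inv_inv_eq)
  then show "w \<in> W" using conj_by_W[OF inv_aff_auts[OF f] w] by simp
qed (rule conj_by_W)

lemma conj_by_s: "f \<in> alcove_auts \<Longrightarrow> i \<in> I \<Longrightarrow> conj_by f (s i) = s (node_perm f i)"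
  using fun_cong[OF node_perm_s, of f i] alcove_auts_aff[of f] by (simp add: fun_eq_iff conj_by_apply)

lemma alcove_auts_wall_plane:
  assumes f: "f \<in> alcove_auts" and i: "i \<in> I"
  shows "f ` wall_plane i = wall_plane (node_perm f i)"
proof -
  have fA: "f \<in> aff_auts" using f by (rule alcove_auts_aff)
  have fixed: "x \<in> wall_plane j \<longleftrightarrow> s j x = x" if "j \<in> I" for j x
    using s_fixes[OF that] wall_s[OF that, of x] by (auto simp: wall_plane_iff)
  have "f x \<in> wall_plane (node_perm f i) \<longleftrightarrow> x \<in> wall_plane i" for x
  proof -
    have "s (node_perm f i) (f x) = f (s i x)" using fun_cong[OF node_perm_s[OF f i], of x] by simp
    moreover have "f (s i x) = f x \<longleftrightarrow> s i x = x" using bij_is_inj[OF aff_auts_bij[OF fA]] by (simp add: inj_eq)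
    ultimately show ?thesis unfolding fixed[OF i] fixed[OF node_perm_in[OF f i]] by simp
  qed
  note mem = this
  show ?thesis
  proof (intro equalityI subsetI)
    fix y assume y: "y \<in> wall_plane (node_perm f i)"
    have "f (inv f y) = y" using fA by simp
    then show "y \<in> f ` wall_plane i" using y mem[of "inv f y"] by (metis imageI)
  qed (use mem in auto)
qed

lemma descent_conj_by:
  assumes f: "f \<in> alcove_auts" and i: "i \<in> I" and w: "w \<in> W"
  shows "descent (node_perm f i) (conj_by f w) \<longleftrightarrow> descent i w"
proof -
  let ?b = base_point
  have fA: "f \<in> aff_auts" and wA: "w \<in> aff_auts" using alcove_auts_aff f W_aff_auts w by auto
  \<comment> \<open>\<open>f\<close> may move \<open>base_point\<close>, but only within the alcove,
    and any point of the alcove gives the same separating hyperplanes.\<close>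
  define x where "x = inv f ?b"
  have x: "x \<in> fund_alcove" using alcove_auts_inv[OF f] base_point_in by (auto simp: x_def alcove_auts_def)
  then have xr: "x \<in> regular_points" using fund_alcove_regular by blast
  have fx: "f x = ?b" using fA by (simp add: x_def)
  have "seps ?b (w x) = seps x (w x)"
    using seps_triangle[OF base_point_regular xr aff_auts_regular[OF wA xr]]
      fund_alcove_not_separated[OF base_point_in x] by simp
  moreover have "seps ?b (w x) = seps ?b (w ?b)"
    using seps_triangle[OF base_point_regular aff_auts_regular[OF wA base_point_regular] aff_auts_regular[OF wA xr]]
      aff_auts_seps[OF wA, of ?b x] fund_alcove_not_separated[OF base_point_in x] by simp
  ultimately have eq: "seps x (w x) = seps ?b (w ?b)" by simp
  have "descent (node_perm f i) (conj_by f w) \<longleftrightarrow> f ` wall_plane i \<in> seps (f x) (f (w x))"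
    unfolding descent_def alcove_auts_wall_plane[OF f i] fx conj_by_apply x_def[symmetric] ..
  also have "\<dots> \<longleftrightarrow> descent i w" unfolding aff_auts_seps_mem[OF fA] eq descent_def ..
  finally show ?thesis .
qed

lemma reduced_word_ConsD:
  assumes "reduced_word (i # js)"
  shows "i \<in> I" "reduced_word js" "\<not> descent i (word js)"
proof -
  have l: "i \<in> I" "js \<in> lists I" "len (s i \<circ> word js) = Suc (length js)"
    using assms unfolding reduced_word_iff word_Cons by auto
  have le: "len (word js) \<le> length js" by (rule len_word_le[OF l(2)])
  show "i \<in> I" by fact
  show nd: "\<not> descent i (word js)"
    using len_step(3)[OF l(1) word_aff_auts[OF l(2)]] l(3) le by linarith
  show "reduced_word js"
    using len_step(2)[OF l(1) word_aff_auts[OF l(2)] nd] l by (simp add: reduced_word_iff)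
qed

lemma finite_G: "finite G"
proof (rule finite_imageD)
  have "(\<lambda>g. node_perm g 0) ` G \<subseteq> I" using node_perm_in[OF G_alcove_auts] by auto
  then show "finite ((\<lambda>g. node_perm g 0) ` G)" by (rule finite_subset[OF _ finite_I])
  show "inj_on (\<lambda>g. node_perm g 0) G"
    by (rule inj_onI) (rule G_eqI, auto simp: G_node)
qed

lemma node_perm_0_inj: "g \<in> G \<Longrightarrow> h \<in> G \<Longrightarrow> node_perm g 0 = node_perm h 0 \<Longrightarrow> g = h"
  by (rule G_eqI) (auto simp: G_node)

text \<open>The element \<open>inv g \<circ> w \<circ> h\<close> is determined by its translation
  part, in a finite orbit, and its linear part, in the finite group \<open>W0\<close>.\<close>

lemma finite_W_orbit:
  assumes g: "g \<in> G" and h: "h \<in> G" shows "finite {w\<in>W. inv g (w (h 0)) \<in> orbit l}"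
proof (rule finite_imageD)
  let ?F = "\<lambda>w. inv g \<circ> w \<circ> h"
  have gA: "g \<in> aff_auts" "h \<in> aff_auts" using G_aff_auts g h by auto
  have "?F ` {w\<in>W. inv g (w (h 0)) \<in> orbit l} \<subseteq> (\<lambda>(v, u) x. u x + v) ` (orbit l \<times> W0)"
  proof (rule image_subsetI)
    fix w assume "w \<in> {w\<in>W. inv g (w (h 0)) \<in> orbit l}"
    then have w: "w \<in> W" "?F w 0 \<in> orbit l" by auto
    have "?F w \<in> W_ext"
      by (intro W_ext_comp W_ext_inv G_W_ext[OF g] G_W_ext[OF h] W_subset_W_ext[OF w(1)])
    then have "(\<lambda>x. ?F w x - ?F w 0) \<in> W0" unfolding W_ext_iff by (rule conjunct2)
    then have "(?F w 0, \<lambda>x. ?F w x - ?F w 0) \<in> orbit l \<times> W0" using w(2) by blast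
    moreover have "?F w = (\<lambda>(v, u) x. u x + v) (?F w 0, \<lambda>x. ?F w x - ?F w 0)" by (simp add: fun_eq_iff)
    ultimately show "?F w \<in> (\<lambda>(v, u) x. u x + v) ` (orbit l \<times> W0)" by (rule image_eqI[rotated])
  qed
  then show "finite (?F ` {w\<in>W. inv g (w (h 0)) \<in> orbit l})"
    by (rule finite_subset) (intro finite_imageI finite_cartesian_product finite_orbit finite_W0)
  show "inj_on ?F {w\<in>W. inv g (w (h 0)) \<in> orbit l}"
  proof (rule inj_onI)
    fix u w assume e: "?F u = ?F w"
    show "u = w"
    proof
      fix x
      have "g (?F u (inv h x)) = g (?F w (inv h x))" by (simp only: e)
      then show "u x = w x" using gA by simp
    qed
  qed
qed

text \<open>Inversion turns the translation part \<open>v\<close> into \<open>- inv w v\<close>, and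
  \<open>opp_inv\<close> removes the sign up to an element of \<open>W0\<close>.\<close>

lemma orbit_opp_inv:
  assumes e: "e \<in> W_ext" shows "opp_inv (inv e 0) \<in> orbit l \<longleftrightarrow> e 0 \<in> orbit l"
proof -
  from e obtain v w where vw: "v \<in> P" "w \<in> W0" "\<And>x. e x = w x + v" by (rule W_extE) blast
  have wi: "inv w \<in> W0" by (rule W0_inv[OF vw(2)])
  have "e (- inv w v) = 0"
    using W0_aff_auts[OF vw(2)] by (simp add: vw(3) linear_neg[OF W0_linear[OF vw(2)]])
  then have "inv e 0 = - inv w v" using aff_auts_inv_f[OF W_ext_aff_auts[OF e]] by metis
  then have "opp_inv (inv e 0) = opp (inv w v)" by (simp add: opp_inv_def)
  moreover have "e 0 = v" using vw(3) W0_fixes[OF vw(2)] by simp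
  ultimately show ?thesis using orbit_W0[OF opp_props(1)] orbit_W0[OF wi] by simp
qed

text \<open>Inversion replaces the translation part by a \<open>W0\<close>-conjugate of its
  negative, and conjugation by \<open>opp_inv\<close> restores the sign up to \<open>W0\<close>; the
  linear parts are absorbed on both sides. This is the anti-automorphism fixing every double
  coset.\<close>

lemma opp_inv_double_coset:
  assumes e: "e \<in> W_ext"
  obtains p r where "p \<in> W0" "r \<in> W0" "\<And>x. opp_inv (inv e (inv opp_inv x)) = p (e (r x))"
proof -
  from e obtain v w where vw: "v \<in> P" "w \<in> W0" "\<And>x. e x = w x + v" by (rule W_extE) blast
  have eA: "e \<in> aff_auts" and wA: "w \<in> aff_auts" and oA: "opp \<in> aff_auts" and iA: "opp_inv \<in> aff_auts"
    using W_ext_aff_auts[OF e] W0_aff_auts vw(2) opp_props alcove_auts_aff by auto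
  have wi: "inv w \<in> W0" and oi: "inv opp \<in> W0" using W0_inv vw(2) opp_props by auto
  show ?thesis
  proof (rule that[of "opp \<circ> inv w" "inv w \<circ> inv opp"])
    show "opp \<circ> inv w \<in> W0" "inv w \<circ> inv opp \<in> W0" using W0_comp opp_props wi oi by auto
    fix x
    have "opp_inv (- inv opp x) = x" using oA by (simp add: opp_inv_def)
    then have 1: "inv opp_inv x = - inv opp x" using aff_auts_inv_f[OF iA] by metis
    have "e (inv w (y - v)) = y" for y using wA by (simp add: vw(3))
    then have 2: "inv e y = inv w (y - v)" for y using aff_auts_inv_f[OF eA] by metis
    have "inv e (- inv opp x) = - inv w (inv opp x + v)"
      unfolding 2 using linear_neg[OF W0_linear[OF wi], of "inv opp x + v"] by simp
    then have "opp_inv (inv e (inv opp_inv x)) = opp (inv w (inv opp x + v))"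
      unfolding 1 by (simp add: opp_inv_def)
    also have "inv opp x + v = e (inv w (inv opp x))" using wA by (simp add: vw(3))
    finally show "opp_inv (inv e (inv opp_inv x)) = (opp \<circ> inv w) (e ((inv w \<circ> inv opp) x))" by simp
  qed
qed

lemma opp_inv_G:
  assumes g: "g \<in> G" shows "opp_inv (g x) = inv g (opp_inv x)" "inv opp_inv (inv g x) = g (inv opp_inv x)"
    "opp_inv (inv g x) = g (opp_inv x)"
proof -
  have iA: "opp_inv \<in> aff_auts" and gA: "g \<in> aff_auts" using opp_props alcove_auts_aff G_aff_auts g by auto
  have e: "opp_inv (g (inv opp_inv y)) = inv g y" for y
    using fun_cong[OF opp_inv_inverts_G[OF g], of y] by simp
  show 1: "opp_inv (g x) = inv g (opp_inv x)" for x using e[of "opp_inv x"] iA by simp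
  show "inv opp_inv (inv g x) = g (inv opp_inv x)" using arg_cong[OF e[of x], of "inv opp_inv"] iA by simp
  show "opp_inv (inv g x) = g (opp_inv x)" using arg_cong[OF 1[of "inv g x"], of g] gA by simp
qed

end

section \<open>Decomposing spheres of chambers, and moving within residues\<close>

context building
begin

definition nbrs :: "nat \<Rightarrow> 'c \<Rightarrow> 'c set" where "nbrs i a = {b\<in>C. \<delta> a b = s i}"

lemma nbrs_iff: "i \<in> I \<Longrightarrow> a \<in> C \<Longrightarrow> b \<in> nbrs i a \<longleftrightarrow> (a, b) \<in> adj i \<and> a \<noteq> b"
  using dist_s_iff[of i a b] adjD[of i a b] by (auto simp: nbrs_def)

lemma q_card_nbrs: "q a i = card (nbrs i a)" by (simp add: q_def nbrs_def)

text \<open>A chamber at distance \<open>s i \<circ> u\<close> is reached through exactly one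
  neighbour in the panel, namely its projection there. The predicate \<open>Q\<close> carries along
  a second condition, such as a prescribed distance to another chamber.\<close>

lemma sphere_first_step:
  assumes i: "i \<in> I" and nd: "\<not> descent i u" and u: "u \<in> W" and a: "a \<in> C"
  shows "{c\<in>C. \<delta> a c = s i \<circ> u \<and> Q c} = (\<Union>c1\<in>nbrs i a. {c\<in>C. \<delta> c1 c = u \<and> Q c})"
    and "c1 \<in> nbrs i a \<Longrightarrow> c2 \<in> nbrs i a \<Longrightarrow> c1 \<noteq> c2 \<Longrightarrow> {c\<in>C. \<delta> c1 c = u \<and> Q c} \<inter> {c\<in>C. \<delta> c2 c = u \<and> Q c} = {}"
proof -
  have de: "descent i (s i \<circ> u)" using len_step(1)[OF i W_aff_auts[OF u]] nd by blast
  show "{c\<in>C. \<delta> a c = s i \<circ> u \<and> Q c} = (\<Union>c1\<in>nbrs i a. {c\<in>C. \<delta> c1 c = u \<and> Q c})"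
  proof (intro equalityI subsetI)
    fix c assume "c \<in> {c\<in>C. \<delta> a c = s i \<circ> u \<and> Q c}"
    then have c: "c \<in> C" "\<delta> a c = s i \<circ> u" "Q c" by auto
    have "descent i (\<delta> a c)" unfolding c(2) by (rule de)
    then obtain c1 where c1: "(a, c1) \<in> adj i" "a \<noteq> c1" "\<delta> c1 c = s i \<circ> \<delta> a c"
      using dist_step_down[OF i a c(1)] by blast
    have "\<delta> c1 c = u" unfolding c1(3) c(2) by (rule s_comp_s_comp[OF i])
    moreover have "c1 \<in> nbrs i a" using nbrs_iff[OF i a] c1 by blast
    ultimately show "c \<in> (\<Union>c1\<in>nbrs i a. {c\<in>C. \<delta> c1 c = u \<and> Q c})" using c by blast
  next
    fix c assume "c \<in> (\<Union>c1\<in>nbrs i a. {c\<in>C. \<delta> c1 c = u \<and> Q c})"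
    then obtain c1 where c: "c1 \<in> nbrs i a" "c \<in> C" "\<delta> c1 c = u" "Q c" by blast
    have "(a, c1) \<in> adj i" "a \<noteq> c1" using nbrs_iff[OF i a] c(1) by auto
    moreover have "\<not> descent i (\<delta> c1 c)" unfolding c(3) by (rule nd)
    ultimately have "\<delta> a c = s i \<circ> \<delta> c1 c" using dist_step_up[OF i _ _ c(2)] by blast
    then have "\<delta> a c = s i \<circ> u" unfolding c(3) .
    then show "c \<in> {c\<in>C. \<delta> a c = s i \<circ> u \<and> Q c}" using c by simp
  qed
  show "{c\<in>C. \<delta> c1 c = u \<and> Q c} \<inter> {c\<in>C. \<delta> c2 c = u \<and> Q c} = {}"
    if c: "c1 \<in> nbrs i a" "c2 \<in> nbrs i a" "c1 \<noteq> c2"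
  proof (rule ccontr)
    assume "\<not> ?thesis"
    then obtain d where d: "d \<in> C" "\<delta> c1 d = u" "\<delta> c2 d = u" by blast
    have "(c1, c2) \<in> adj i" using nbrs_iff[OF i a] c adj_trans[OF i adj_sym[OF i]] by blast
    moreover have "\<not> descent i (\<delta> c2 d)" unfolding d(3) by (rule nd)
    ultimately have "\<delta> c1 d = s i \<circ> \<delta> c2 d" using dist_step_up[OF i _ c(3) d(1)] by blast
    then have "u = s i \<circ> u" unfolding d(2,3) .
    then show False using de nd by metis
  qed
qed

lemma reach_left:
  assumes i: "i \<in> I" and p: "p \<in> W" "p (fund_vertex i) = fund_vertex i" and C: "a \<in> C" "b \<in> C"
  shows "\<exists>a'\<in>C. vertex_of i a' = vertex_of i a \<and> \<delta> a' b = p \<circ> \<delta> a b"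
proof -
  have "\<exists>a'\<in>C. vertex_of i a' = vertex_of i a \<and> \<delta> a' b = word js \<circ> \<delta> a b" if "js \<in> lists (I - {i})" for js
    using that
  proof (induction js rule: lists.induct)
    case Nil
    show ?case using C by (intro bexI[of _ a]) simp_all
  next
    case (Cons j js)
    then obtain a1 where a1: "a1 \<in> C" "vertex_of i a1 = vertex_of i a" "\<delta> a1 b = word js \<circ> \<delta> a b" by blast
    have j: "j \<in> I" "j \<in> I - {i}" using Cons.hyps by auto
    obtain a' where a': "(a1, a') \<in> adj j" "\<delta> a' b = s j \<circ> \<delta> a1 b" using dist_left_attain[OF j(1) a1(1) C(2)] by blast
    have a'C: "a' \<in> C" using adjD[OF j(1) a'(1)] by simp
    have "(a1, a') \<in> (\<Union>j\<in>I - {i}. adj j)\<^sup>*" using a'(1) j(2) by blast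
    then have "vertex_of i a1 = vertex_of i a'"
      using vertex_of_eq_iff[OF i a1(1) a'C] residue_iff[OF i a1(1) a'C] by simp
    moreover have "\<delta> a' b = word (j # js) \<circ> \<delta> a b" unfolding a'(2) a1(3) word_Cons by (rule comp_assoc[symmetric])
    ultimately show ?case using a'C a1(2) by metis
  qed
  moreover obtain js where "js \<in> lists (I - {i})" "word js = p"
    using fund_vertex_conj(2)[OF p(1) i i p(2)] by blast
  ultimately show ?thesis by blast
qed

lemma reach_right:
  assumes i: "i \<in> I" and p: "p \<in> W" "p (fund_vertex i) = fund_vertex i" and C: "a \<in> C" "b \<in> C"
  shows "\<exists>b'\<in>C. vertex_of i b' = vertex_of i b \<and> \<delta> a b' = \<delta> a b \<circ> p"
proof -
  have "inv p (fund_vertex i) = fund_vertex i" using aff_auts_inv_f[OF W_aff_auts[OF p(1)], of "fund_vertex i"] p(2) by simp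
  then obtain b' where b': "b' \<in> C" "vertex_of i b' = vertex_of i b" "\<delta> b' a = inv p \<circ> \<delta> b a"
    using reach_left[OF i inv_in_W[OF p(1)] _ C(2,1)] by blast
  have "\<delta> a b' = inv (\<delta> b' a)" by (rule dist_inv[OF b'(1) C(1)])
  also have "\<dots> = inv (\<delta> b a) \<circ> p"
    unfolding b'(3) W_inv_comp[OF inv_in_W[OF p(1)] dist_in_W[OF C(2,1)]] W_inv_inv[OF p(1)] ..
  also have "\<dots> = \<delta> a b \<circ> p" unfolding dist_inv[OF C(2,1), symmetric] ..
  finally show ?thesis using b' by blast
qed

end

section \<open>Parameters, and transport of chambers\<close>

context locally_finite_regular_affine_building
begin

lemma finite_nbrs: "i \<in> I \<Longrightarrow> a \<in> C \<Longrightarrow> finite (nbrs i a)"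
  by (rule finite_subset[OF _ locally_finite[of i a]]) (auto simp: nbrs_iff)

lemma q_pos: "i \<in> I \<Longrightarrow> a \<in> C \<Longrightarrow> q a i > 0"
proof -
  assume i: "i \<in> I" and a: "a \<in> C"
  obtain b where "(a, b) \<in> adj i" "b \<noteq> a" using panel[OF i a] by blast
  then have "b \<in> nbrs i a" using nbrs_iff[OF i a] by blast
  then show ?thesis unfolding q_card_nbrs using finite_nbrs[OF i a] by (auto simp: card_gt_0_iff)
qed

text \<open>Each first step contributes one factor. The parameters are read at a fixed
  \<open>a0\<close>, by regularity, while \<open>a\<close> moves along the gallery.\<close>

lemma sphere_card:
  assumes "reduced_word js" "a \<in> C" "a0 \<in> C"
  shows "finite {c\<in>C. \<delta> a c = word js}" "card {c\<in>C. \<delta> a c = word js} = prod_list (map (q a0) js)"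
proof -
  have "finite {c\<in>C. \<delta> a c = word js} \<and> card {c\<in>C. \<delta> a c = word js} = prod_list (map (q a0) js)"
    using assms(1,2)
  proof (induction js arbitrary: a)
    case Nil
    have "{c\<in>C. \<delta> a c = word []} = {a}" unfolding word_Nil using dist_id_iff[OF Nil.prems(2)] Nil.prems(2) by auto
    then show ?case by (metis card.empty card_insert_disjoint empty_iff finite.emptyI finite.insertI list.map(1) prod_list.Nil One_nat_def)
  next
    case (Cons i js)
    note r = reduced_word_ConsD[OF Cons.prems(1)]
    have uW: "word js \<in> W" using r(2) by (intro word_in_W) (simp add: reduced_word_def)
    note st = sphere_first_step[OF r(1,3) uW Cons.prems(2), where Q = "\<lambda>_. True", simplified]
    have IH: "finite {c\<in>C. \<delta> c1 c = word js}" "card {c\<in>C. \<delta> c1 c = word js} = prod_list (map (q a0) js)"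
      if "c1 \<in> nbrs i a" for c1
      using Cons.IH[OF r(2), of c1] that by (auto simp: nbrs_def)
    have fin: "finite (nbrs i a)" by (rule finite_nbrs[OF r(1) Cons.prems(2)])
    have "card {c\<in>C. \<delta> a c = word (i # js)} = (\<Sum>c1\<in>nbrs i a. card {c\<in>C. \<delta> c1 c = word js})"
      unfolding word_Cons st(1) by (rule card_UN_disjoint[OF fin]) (use IH st(2) in auto)
    also have "\<dots> = card (nbrs i a) * prod_list (map (q a0) js)" using IH by simp
    also have "card (nbrs i a) = q a0 i" using regular[OF r(1) Cons.prems(2) assms(3)] by (simp add: q_card_nbrs)
    finally have "card {c\<in>C. \<delta> a c = word (i # js)} = prod_list (map (q a0) (i # js))"
      by (simp only: list.map prod_list.Cons)
    moreover have "finite {c\<in>C. \<delta> a c = word (i # js)}"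
      unfolding word_Cons st(1) using fin IH by blast
    ultimately show ?case by blast
  qed
  then show "finite {c\<in>C. \<delta> a c = word js}" "card {c\<in>C. \<delta> a c = word js} = prod_list (map (q a0) js)" by auto
qed

lemma finite_sphere: "a \<in> C \<Longrightarrow> finite {c\<in>C. \<delta> a c = u}"
proof (cases "u \<in> W")
  case True
  assume a: "a \<in> C"
  obtain js where js: "reduced_word js" "word js = u" using True by (rule WE)
  show ?thesis using sphere_card(1)[OF js(1) a a] unfolding js(2) .
next
  case False
  assume "a \<in> C"
  then have "{c\<in>C. \<delta> a c = u} = {}" using dist_in_W False by blast
  then show ?thesis by (simp only: finite.emptyI)
qed

definition q_preserving :: "('a \<Rightarrow> 'a) \<Rightarrow> bool" where
  "q_preserving f \<longleftrightarrow> f \<in> alcove_auts \<and> (\<forall>a\<in>C. \<forall>i\<in>I. q a (node_perm f i) = q a i)"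

lemma q_preserving_comp:
  assumes "q_preserving f" "q_preserving g" shows "q_preserving (f \<circ> g)"
proof -
  have f: "f \<in> alcove_auts" and g: "g \<in> alcove_auts" using assms by (auto simp: q_preserving_def)
  have "node_perm (f \<circ> g) i = node_perm f (node_perm g i)" if i: "i \<in> I" for i
  proof (rule inj_onD[OF fund_vertex_inj])
    show "fund_vertex (node_perm (f \<circ> g) i) = fund_vertex (node_perm f (node_perm g i))"
      using node_perm_vertex[OF alcove_auts_comp[OF f g] i] node_perm_vertex[OF f node_perm_in[OF g i]]
        node_perm_vertex[OF g i] by simp
    show "node_perm (f \<circ> g) i \<in> I" by (rule node_perm_in[OF alcove_auts_comp[OF f g] i])
    show "node_perm f (node_perm g i) \<in> I" by (rule node_perm_in[OF f node_perm_in[OF g i]])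
  qed
  then show ?thesis using assms alcove_auts_comp[OF f g] node_perm_in[OF g] by (simp add: q_preserving_def)
qed

text \<open>Here the convention on parameters under type-rotating diagram automorphisms
  enters.\<close>

lemma q_preserving_G: "g \<in> G \<Longrightarrow> q_preserving g"
  using parameters_invariant[OF node_perm_Aut_tr] G_alcove_auts by (simp add: q_preserving_def)

text \<open>Both \<open>s\<^sub>j u'\<close> and \<open>u' s\<^sub>i\<close> with \<open>j = node_perm opp_inv i\<close> are reduced expressions of the
  longest element, so comparing sphere sizes gives \<open>q\<^sub>j = q\<^sub>i\<close>.\<close>

lemma q_preserving_opp_inv: "q_preserving opp_inv"
proof -
  have "q a (node_perm opp_inv i) = q a i" if a: "a \<in> C" and i: "i \<in> I" for a i
  proof (cases "i = 0")
    case True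
    then show ?thesis by (simp add: node_perm_opp_inv_0)
  next
    case False
    then have i0: "i \<in> I0" using I_cases[OF i] by blast
    let ?j = "node_perm opp_inv i"
    have jI: "?j \<in> I" by (rule node_perm_in[OF opp_props(2) i])
    have "?j \<noteq> 0"
    proof
      assume "?j = 0"
      then have "?j = node_perm opp_inv 0" by (simp add: node_perm_opp_inv_0)
      then have "i = 0" using permutes_inj[OF node_perm_permutes[OF opp_props(2)]] by (simp add: inj_eq)
      then show False using False by simp
    qed
    then have j0: "?j \<in> I0" using I_cases[OF jI] by simp
    have oW: "opp \<in> W" and oA: "opp \<in> aff_auts" using opp_props W0_W W0_aff_auts by auto
    have u: "opp \<circ> s i \<in> W" using comp_in_W oW s_in_W i by blast
    obtain js where js: "reduced_word js" "word js = opp \<circ> s i" "length js = len (opp \<circ> s i)" using u by (rule WE)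
    have jl: "js \<in> lists I" using js(1) by (simp add: reduced_word_def)
    have 1: "s ?j \<circ> (opp \<circ> s i) = opp"
      unfolding opp_s[OF i0] by (rule s_comp_s_comp[OF jI])
    have 2: "s ?j \<circ> opp = opp \<circ> s i" by (rule opp_s[OF i0, symmetric])
    have nd: "\<not> descent ?j (opp \<circ> s i)"
      using len_step(1)[OF jI oA] opp_descent[OF j0] unfolding 2 by blast
    have r1: "reduced_word (?j # js)" using reduced_word_Cons[OF jI js(1)] nd unfolding js(2) by blast
    have w1: "word (?j # js) = opp" unfolding word_Cons js(2) by (rule 1)
    have "word (js @ [i]) = (opp \<circ> s i) \<circ> s i" unfolding word_append js(2) by simp
    then have w2: "word (js @ [i]) = opp" unfolding comp_assoc s_comp_s[OF i] by simp
    have r2: "reduced_word (js @ [i])"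
      using r1 jl i unfolding reduced_word_iff w1 w2 by simp
    have "prod_list (map (q a) (?j # js)) = prod_list (map (q a) (js @ [i]))"
      using sphere_card(2)[OF r1 a a] sphere_card(2)[OF r2 a a] unfolding w1 w2 by (rule trans[OF sym])
    moreover have "prod_list (map (q a) js) > 0" using jl
      by (induction js) (auto simp: q_pos[OF _ a])
    ultimately show ?thesis by simp
  qed
  then show ?thesis using opp_props(2) by (simp add: q_preserving_def)
qed

text \<open>If \<open>i\<close> is not a descent, all neighbours have the same distance to
  \<open>b\<close>. If it is, one neighbour is the projection of \<open>b\<close> and the others
  keep the distance of \<open>a\<close>. Conjugation preserves descents and the panels have equal
  sizes, so any bijection matching the projections works.\<close>

lemma nbrs_transport:
  assumes f: "q_preserving f" and i: "i \<in> I" and C: "a \<in> C" "b \<in> C" "a' \<in> C" "b' \<in> C"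
    and d: "\<delta> a' b' = conj_by f (\<delta> a b)"
  shows "\<exists>h. bij_betw h (nbrs i a) (nbrs (node_perm f i) a') \<and>
    (\<forall>c\<in>nbrs i a. \<delta> (h c) b' = conj_by f (\<delta> c b))"
proof -
  let ?i = "node_perm f i"
  have fO: "f \<in> alcove_auts" using f by (simp add: q_preserving_def)
  have fA: "f \<in> aff_auts" using fO by (rule alcove_auts_aff)
  have i': "?i \<in> I" by (rule node_perm_in[OF fO i])
  have w: "\<delta> a b \<in> W" using dist_in_W C by blast
  have fin: "finite (nbrs i a)" "finite (nbrs ?i a')" using finite_nbrs i i' C by auto
  have "q a' ?i = q a' i" using f i C(3) by (simp add: q_preserving_def)
  then have card: "card (nbrs i a) = card (nbrs ?i a')"
    using regular[OF i C(1,3)] by (simp add: q_card_nbrs)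
  have cs: "conj_by f (s i \<circ> \<delta> a b) = s ?i \<circ> \<delta> a' b'" unfolding conj_by_comp[OF fA] conj_by_s[OF fO i] d ..
  have dd: "descent ?i (\<delta> a' b') \<longleftrightarrow> descent i (\<delta> a b)" unfolding d by (rule descent_conj_by[OF fO i w])
  show ?thesis
  proof (cases "descent i (\<delta> a b)")
    case False
    obtain h where h: "bij_betw h (nbrs i a) (nbrs ?i a')" using finite_same_card_bij[OF fin card] by blast
    have "\<delta> (h c) b' = conj_by f (\<delta> c b)" if c: "c \<in> nbrs i a" for c
    proof -
      have hc: "h c \<in> nbrs ?i a'" using bij_betw_apply[OF h c] .
      have "(c, a) \<in> adj i" "c \<noteq> a" using nbrs_iff[OF i C(1)] c adj_sym[OF i] by auto
      then have 1: "\<delta> c b = s i \<circ> \<delta> a b" using dist_step_up[OF i _ _ C(2) False] by blast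
      have "(h c, a') \<in> adj ?i" "h c \<noteq> a'" using nbrs_iff[OF i' C(3)] hc adj_sym[OF i'] by auto
      then have 2: "\<delta> (h c) b' = s ?i \<circ> \<delta> a' b'" using dist_step_up[OF i' _ _ C(4)] False dd by blast
      show ?thesis unfolding 1 2 cs ..
    qed
    then show ?thesis using h by blast
  next
    case True
    obtain g where g: "(a, g) \<in> adj i" "a \<noteq> g" "\<delta> g b = s i \<circ> \<delta> a b" "\<not> descent i (\<delta> g b)"
      using dist_step_down[OF i C(1,2) True] by blast
    have "descent ?i (\<delta> a' b')" using True dd by simp
    then obtain g' where g': "(a', g') \<in> adj ?i" "a' \<noteq> g'" "\<delta> g' b' = s ?i \<circ> \<delta> a' b'" "\<not> descent ?i (\<delta> g' b')"
      using dist_step_down[OF i' C(3,4)] by blast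
    have gn: "g \<in> nbrs i a" "g' \<in> nbrs ?i a'" using nbrs_iff[OF i C(1)] nbrs_iff[OF i' C(3)] g g' by auto
    have "card (nbrs i a - {g}) = card (nbrs ?i a' - {g'})" using card gn fin by simp
    then obtain h0 where h0: "bij_betw h0 (nbrs i a - {g}) (nbrs ?i a' - {g'})"
      using finite_same_card_bij[of "nbrs i a - {g}" "nbrs ?i a' - {g'}"] fin by blast
    define h where "h x = (if x = g then g' else h0 x)" for x
    have "bij_betw h (nbrs i a - {g}) (nbrs ?i a' - {g'})"
      using h0 by (subst bij_betw_cong[of _ h h0]) (auto simp: h_def)
    moreover have "bij_betw h {g} {g'}" by (simp add: h_def)
    ultimately have "bij_betw h (nbrs i a - {g} \<union> {g}) (nbrs ?i a' - {g'} \<union> {g'})"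
      by (rule bij_betw_combine) blast
    moreover have "nbrs i a - {g} \<union> {g} = nbrs i a" "nbrs ?i a' - {g'} \<union> {g'} = nbrs ?i a'" using gn by auto
    ultimately have h: "bij_betw h (nbrs i a) (nbrs ?i a')" by simp
    have "\<delta> (h c) b' = conj_by f (\<delta> c b)" if c: "c \<in> nbrs i a" for c
    proof (cases "c = g")
      case True
      then have "h c = g'" by (simp add: h_def)
      then show ?thesis using True unfolding g(3) cs g'(3)[symmetric] by (metis cs g(3) g'(3))
    next
      case False
      have hc: "h c \<in> nbrs ?i a' - {g'}" using bij_betw_apply[OF h0, of c] c False by (simp add: h_def)
      have "(c, g) \<in> adj i" using nbrs_iff[OF i C(1)] c g(1) adj_trans[OF i adj_sym[OF i]] by blast
      then have 1: "\<delta> c b = s i \<circ> \<delta> g b" using dist_step_up[OF i _ False C(2) g(4)] by blast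
      have "(h c, g') \<in> adj ?i" using nbrs_iff[OF i' C(3)] hc g'(1) adj_trans[OF i' adj_sym[OF i']] by blast
      then have 2: "\<delta> (h c) b' = s ?i \<circ> \<delta> g' b'" using dist_step_up[OF i' _ _ C(4) g'(4)] hc by blast
      have "\<delta> c b = \<delta> a b" unfolding 1 g(3) by (rule s_comp_s_comp[OF i])
      moreover have "\<delta> (h c) b' = \<delta> a' b'" unfolding 2 g'(3) by (rule s_comp_s_comp[OF i'])
      ultimately show ?thesis using d by metis
    qed
    then show ?thesis using h by blast
  qed
qed

text \<open>Both counts are split by the first chamber of a gallery of type \<open>js\<close>.
  \<open>nbrs_transport\<close> matches the first chambers so that the hypothesis on distances to
  \<open>b\<close> and \<open>b'\<close> holds again one step further on.\<close>

lemma count_transport: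
  assumes f: "q_preserving f" and r: "reduced_word js" and C: "a \<in> C" "b \<in> C" "a' \<in> C" "b' \<in> C"
    and d: "\<delta> a' b' = conj_by f (\<delta> a b)"
  shows "card {c\<in>C. \<delta> a c = word js \<and> \<delta> c b = v} =
    card {c\<in>C. \<delta> a' c = conj_by f (word js) \<and> \<delta> c b' = conj_by f v}"
proof -
  have fO: "f \<in> alcove_auts" using f by (simp add: q_preserving_def)
  have fA: "f \<in> aff_auts" using fO by (rule alcove_auts_aff)
  have fin: "finite {c\<in>C. \<delta> x c = u \<and> Q c}" if "x \<in> C" for x u Q
    by (rule finite_subset[OF _ finite_sphere[OF that, of u]]) blast
  show ?thesis using r C(1,3) d
  proof (induction js arbitrary: a a')
    case Nil
    have 1: "{c\<in>C. \<delta> x c = id \<and> \<delta> c y = u} = (if \<delta> x y = u then {x} else {})" if "x \<in> C" for x y u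
      using dist_id_iff[OF that] that by auto
    show ?case unfolding word_Nil conj_by_id[OF fA] 1[OF Nil.prems(2)] 1[OF Nil.prems(3)] Nil.prems(4) conj_by_inj[OF fA]
      by simp
  next
    case (Cons i js)
    note rd = reduced_word_ConsD[OF Cons.prems(1)]
    let ?i = "node_perm f i" and ?u = "conj_by f (word js)"
    have uW: "word js \<in> W" using rd(2) by (intro word_in_W) (simp add: reduced_word_def)
    have i': "?i \<in> I" by (rule node_perm_in[OF fO rd(1)])
    have u': "?u \<in> W" by (rule conj_by_W[OF fA uW])
    have nd': "\<not> descent ?i ?u" using descent_conj_by[OF fO rd(1) uW] rd(3) by simp
    have cw: "conj_by f (word (i # js)) = s ?i \<circ> ?u" unfolding word_Cons conj_by_comp[OF fA] conj_by_s[OF fO rd(1)] ..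
    let ?A = "\<lambda>c1. {c\<in>C. \<delta> c1 c = word js \<and> \<delta> c b = v}"
    let ?B = "\<lambda>c1. {c\<in>C. \<delta> c1 c = ?u \<and> \<delta> c b' = conj_by f v}"
    obtain h where h: "bij_betw h (nbrs i a) (nbrs ?i a')" "\<forall>c\<in>nbrs i a. \<delta> (h c) b' = conj_by f (\<delta> c b)"
      using nbrs_transport[OF f rd(1) Cons.prems(2) C(2) Cons.prems(3) C(4) Cons.prems(4)] by blast
    have nC: "c \<in> C" if "c \<in> nbrs k x" for c k x using that by (simp add: nbrs_def)
    note st = sphere_first_step[OF rd(1,3) uW Cons.prems(2), where Q = "\<lambda>c. \<delta> c b = v"]
    note st' = sphere_first_step[OF i' nd' u' Cons.prems(3), where Q = "\<lambda>c. \<delta> c b' = conj_by f v"]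
    have "card {c\<in>C. \<delta> a c = word (i # js) \<and> \<delta> c b = v} = card (\<Union>c1\<in>nbrs i a. ?A c1)"
      unfolding word_Cons st(1) ..
    also have "\<dots> = (\<Sum>c1\<in>nbrs i a. card (?A c1))"
    proof (rule card_UN_disjoint)
      show "finite (nbrs i a)" by (rule finite_nbrs[OF rd(1) Cons.prems(2)])
      show "\<forall>c1\<in>nbrs i a. finite (?A c1)" by (intro ballI fin) (rule nC)
      show "\<forall>c1\<in>nbrs i a. \<forall>c2\<in>nbrs i a. c1 \<noteq> c2 \<longrightarrow> ?A c1 \<inter> ?A c2 = {}" using st(2) by blast
    qed
    also have "\<dots> = (\<Sum>c1\<in>nbrs i a. card (?B (h c1)))"
    proof (rule sum.cong)
      fix c1 assume c1: "c1 \<in> nbrs i a"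
      have hc: "h c1 \<in> C" using nC bij_betw_apply[OF h(1) c1] by blast
      show "card (?A c1) = card (?B (h c1))"
        by (rule Cons.IH[OF rd(2) nC[OF c1] hc]) (rule bspec[OF h(2) c1])
    qed simp
    also have "\<dots> = (\<Sum>c1\<in>nbrs ?i a'. card (?B c1))"
      by (rule sum.reindex_bij_betw[OF h(1)])
    also have "\<dots> = card (\<Union>c1\<in>nbrs ?i a'. ?B c1)"
    proof (rule card_UN_disjoint[symmetric])
      show "finite (nbrs ?i a')" by (rule finite_nbrs[OF i' Cons.prems(3)])
      show "\<forall>c1\<in>nbrs ?i a'. finite (?B c1)" by (intro ballI fin) (rule nC)
      show "\<forall>c1\<in>nbrs ?i a'. \<forall>c2\<in>nbrs ?i a'. c1 \<noteq> c2 \<longrightarrow> ?B c1 \<inter> ?B c2 = {}" using st'(2) by blast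
    qed
    also have "\<dots> = card {c\<in>C. \<delta> a' c = conj_by f (word (i # js)) \<and> \<delta> c b' = conj_by f v}"
      unfolding cw st'(1) ..
    finally show ?case .
  qed
qed

text \<open>The counts of \<open>count_transport\<close> are the fibre sizes of the pairs of
  distances. The resulting bijection need not respect distances between two arbitrary chambers; only
  those to the two chosen ones are controlled.\<close>

lemma chamber_transport:
  assumes f: "q_preserving f" and C: "a \<in> C" "b \<in> C" "a' \<in> C" "b' \<in> C"
    and d: "\<delta> a' b' = conj_by f (\<delta> a b)"
  shows "\<exists>h. bij_betw h C C \<and> (\<forall>c\<in>C. \<delta> a' (h c) = conj_by f (\<delta> a c) \<and> \<delta> (h c) b' = conj_by f (\<delta> c b))"
proof -
  have fO: "f \<in> alcove_auts" using f by (simp add: q_preserving_def)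
  have fA: "f \<in> aff_auts" using fO by (rule alcove_auts_aff)
  let ?p = "\<lambda>c. (conj_by f (\<delta> a c), conj_by f (\<delta> c b))" and ?r = "\<lambda>c. (\<delta> a' c, \<delta> c b')"
  have P: "{c\<in>C. ?p c = (conj_by f u, conj_by f v)} = {c\<in>C. \<delta> a c = u \<and> \<delta> c b = v}" for u v
    unfolding prod.inject conj_by_inj[OF fA] ..
  have R: "{c\<in>C. ?r c = (u, v)} = {c\<in>C. \<delta> a' c = u \<and> \<delta> c b' = v}" for u v
    unfolding prod.inject ..
  have ex: "\<exists>u v. x = (conj_by f u, conj_by f v)" for x
    using conj_by_surj[OF fA] by (metis surj_pair)
  have "\<exists>h. bij_betw h C C \<and> (\<forall>c\<in>C. ?r (h c) = ?p c)"
  proof (rule bij_of_equal_fibers)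
    fix x
    obtain u v where x: "x = (conj_by f u, conj_by f v)" using ex by blast
    show "finite {c\<in>C. ?p c = x}" unfolding x P
      by (rule finite_subset[OF _ finite_sphere[OF C(1), of u]]) blast
    show "finite {c\<in>C. ?r c = x}" unfolding x R
      by (rule finite_subset[OF _ finite_sphere[OF C(3), of "conj_by f u"]]) blast
    show "card {c\<in>C. ?p c = x} = card {c\<in>C. ?r c = x}" unfolding x P R
    proof (cases "u \<in> W")
      case True
      obtain js where js: "reduced_word js" "word js = u" using True by (rule WE)
      show "card {c\<in>C. \<delta> a c = u \<and> \<delta> c b = v} = card {c\<in>C. \<delta> a' c = conj_by f u \<and> \<delta> c b' = conj_by f v}"
        using count_transport[OF f js(1) C d, of v] unfolding js(2) .
    next
      case False
      then have "conj_by f u \<notin> W" using conj_by_W_iff[OF fA] by blast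
      then have "\<delta> a' c \<noteq> conj_by f u" if "c \<in> C" for c using dist_in_W[OF C(3) that] by metis
      then have "{c\<in>C. \<delta> a' c = conj_by f u \<and> \<delta> c b' = conj_by f v} = {}"
        by (intro equals0I) (elim CollectE conjE, metis)
      moreover have "\<delta> a c \<noteq> u" if "c \<in> C" for c using dist_in_W[OF C(1) that] False by metis
      then have "{c\<in>C. \<delta> a c = u \<and> \<delta> c b = v} = {}"
        by (intro equals0I) (elim CollectE conjE, metis)
      ultimately show "card {c\<in>C. \<delta> a c = u \<and> \<delta> c b = v} = card {c\<in>C. \<delta> a' c = conj_by f u \<and> \<delta> c b' = conj_by f v}"
        by (simp only:)
    qed
  qed
  then show ?thesis unfolding prod.inject .
qed

end

section \<open>Commutativity\<close>

context root_datum
begin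

lemma G_comm_apply: "f \<in> G \<Longrightarrow> g \<in> G \<Longrightarrow> f (g x) = g (f x)"
  using fun_cong[OF G_commute, of f g x] by simp

lemma G_inv_f [simp]: "g \<in> G \<Longrightarrow> inv g (g x) = x" and G_f_inv [simp]: "g \<in> G \<Longrightarrow> g (inv g x) = x"
  using G_aff_auts by auto

lemma opp_inv_aff_auts: "opp_inv \<in> aff_auts" using opp_props alcove_auts_aff by blast

lemma inv_opp_inv_0: "inv opp_inv 0 = 0"
  using aff_auts_inv_f[OF opp_inv_aff_auts, of 0] by simp

lemma orbit_0: "x \<in> orbit 0 \<longleftrightarrow> x = 0"
proof -
  have "id \<in> W0" by (simp add: W0_eq id_in_W)
  then show ?thesis unfolding orbit_def using W0_fixes by force
qed

end

section \<open>From counts of chambers to counts of vertices\<close>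

context locally_finite_regular_affine_building
begin

text \<open>A residue is treated as the sphere with \<lambda> = 0, so finiteness and transport of
  spheres apply to it.\<close>

lemma same_vertex_iff:
  assumes g: "g \<in> G" and C: "a \<in> C" "c \<in> C"
  shows "vertex_of (node_perm g 0) c = vertex_of (node_perm g 0) a \<longleftrightarrow> inv g (\<delta> a c (g 0)) \<in> orbit 0"
proof -
  have "vertex_of (node_perm g 0) a = vertex_of (node_perm g 0) c \<longleftrightarrow> \<delta> a c (g 0) = g 0"
    using vertex_of_eq_iff[OF node_perm_0_in[OF g] C] G_node[OF g] by simp
  moreover have "inv g (\<delta> a c (g 0)) = 0 \<longleftrightarrow> \<delta> a c (g 0) = g 0"
    using G_inv_f[OF g, of 0] G_f_inv[OF g] by metis
  ultimately show ?thesis unfolding orbit_0 by auto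
qed

lemma finite_chamber_sphere:
  assumes g: "g \<in> G" and h: "h \<in> G" and a: "a \<in> C"
  shows "finite {c\<in>C. inv g (\<delta> a c (h 0)) \<in> orbit l}"
proof (rule finite_subset)
  show "{c\<in>C. inv g (\<delta> a c (h 0)) \<in> orbit l}
      \<subseteq> (\<Union>w\<in>{w\<in>W. inv g (w (h 0)) \<in> orbit l}. {c\<in>C. \<delta> a c = w})"
    using dist_in_W[OF a] by auto
  show "finite (\<Union>w\<in>{w\<in>W. inv g (w (h 0)) \<in> orbit l}. {c\<in>C. \<delta> a c = w})"
    by (intro finite_UN_I finite_W_orbit[OF g h] finite_sphere[OF a])
qed

text \<open>The case of equal chambers, transported by the element of \<open>G\<close> taking the
  type of one base vertex to that of the other; extended distances from the base vertex are
  unchanged.\<close>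

lemma chamber_sphere_transport:
  assumes g: "g \<in> G" "g' \<in> G" and C: "a \<in> C" "a' \<in> C"
  shows "\<exists>k. bij_betw k C C \<and>
    (\<forall>c\<in>C. \<forall>z. inv g' (\<delta> a' (k c) (g' (inv g z))) = inv g (\<delta> a c z))"
proof -
  let ?f = "g' \<circ> inv g"
  have fG: "?f \<in> G" using G_comp[OF g(2) G_inv[OF g(1)]] .
  have fA: "?f \<in> aff_auts" by (rule G_aff_auts[OF fG])
  have "\<delta> a' a' = conj_by ?f (\<delta> a a)" unfolding dist_self[OF C(1)] dist_self[OF C(2)] conj_by_id[OF fA] ..
  then obtain k where k: "bij_betw k C C" "\<forall>c\<in>C. \<delta> a' (k c) = conj_by ?f (\<delta> a c) \<and> \<delta> (k c) a' = conj_by ?f (\<delta> c a)"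
    using chamber_transport[OF q_preserving_G[OF fG] C(1,1) C(2,2)] by blast
  have "inv g' (\<delta> a' (k c) (g' (inv g z))) = inv g (\<delta> a c z)" if c: "c \<in> C" for c z
  proof -
    have "\<delta> a' (k c) = conj_by ?f (\<delta> a c)" using k(2) c by blast
    then have "\<delta> a' (k c) (?f z) = ?f (\<delta> a c (inv ?f (?f z)))" by (simp only: conj_by_apply)
    also have "inv ?f (?f z) = z" by (rule aff_auts_inv_f[OF fA])
    finally show ?thesis using g by simp
  qed
  then show ?thesis using k(1) by blast
qed

definition residue_size :: nat where
  "residue_size = card {c\<in>C. vertex_of (node_perm id 0) c = vertex_of (node_perm id 0) (SOME a. a \<in> C)}"

lemma residue_card:
  assumes g: "g \<in> G" and a: "a \<in> C"
  shows "card {c\<in>C. vertex_of (node_perm g 0) c = vertex_of (node_perm g 0) a} = residue_size"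
proof -
  define a0 where "a0 = (SOME a. a \<in> C)"
  have a0: "a0 \<in> C" unfolding a0_def using a by (rule someI)
  obtain k where k: "bij_betw k C C"
    "\<forall>c\<in>C. \<forall>z. inv id (\<delta> a0 (k c) (id (inv g z))) = inv g (\<delta> a c z)"
    using chamber_sphere_transport[OF g id_in_G a a0] by blast
  have mem: "vertex_of (node_perm id 0) (k c) = vertex_of (node_perm id 0) a0 \<longleftrightarrow>
      vertex_of (node_perm g 0) c = vertex_of (node_perm g 0) a" if c: "c \<in> C" for c
  proof -
    have "inv id (\<delta> a0 (k c) (id (inv g (g 0)))) = inv g (\<delta> a c (g 0))" using k(2) c by blast
    moreover have "id (inv g (g 0)) = id (0::'a)" using g by simp
    ultimately show ?thesis
      unfolding same_vertex_iff[OF g a c] same_vertex_iff[OF id_in_G a0 bij_betw_apply[OF k(1) c]] by simp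
  qed
  have img: "k ` {c\<in>C. vertex_of (node_perm g 0) c = vertex_of (node_perm g 0) a} =
      {c\<in>C. vertex_of (node_perm id 0) c = vertex_of (node_perm id 0) a0}"
  proof (intro equalityI subsetI)
    fix d assume d: "d \<in> {c\<in>C. vertex_of (node_perm id 0) c = vertex_of (node_perm id 0) a0}"
    then have "d \<in> k ` C" using bij_betw_imp_surj_on[OF k(1)] by simp
    then obtain c where "c \<in> C" "d = k c" by blast
    then show "d \<in> k ` {c\<in>C. vertex_of (node_perm g 0) c = vertex_of (node_perm g 0) a}" using d mem by blast
  next
    fix d assume "d \<in> k ` {c\<in>C. vertex_of (node_perm g 0) c = vertex_of (node_perm g 0) a}"
    then obtain c where "c \<in> C" "d = k c" "vertex_of (node_perm g 0) c = vertex_of (node_perm g 0) a" by blast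
    then show "d \<in> {c\<in>C. vertex_of (node_perm id 0) c = vertex_of (node_perm id 0) a0}"
      using mem bij_betw_apply[OF k(1)] by simp
  qed
  have "inj_on k {c\<in>C. vertex_of (node_perm g 0) c = vertex_of (node_perm g 0) a}"
    by (rule inj_on_subset[OF bij_betw_imp_inj_on[OF k(1)]]) blast
  then show ?thesis unfolding residue_size_def a0_def[symmetric] img[symmetric] by (rule card_image[symmetric])
qed

lemma finite_residue:
  assumes g: "g \<in> G" and a: "a \<in> C"
  shows "finite {c\<in>C. vertex_of (node_perm g 0) c = vertex_of (node_perm g 0) a}"
  by (rule finite_subset[OF _ finite_chamber_sphere[OF g g a, of 0]]) (use same_vertex_iff[OF g a] in blast)

lemma residue_size_pos: "a \<in> C \<Longrightarrow> residue_size > 0"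
proof -
  assume a: "a \<in> C"
  then have "{c\<in>C. vertex_of (node_perm id 0) c = vertex_of (node_perm id 0) a} \<noteq> {}" by blast
  then show ?thesis using finite_residue[OF id_in_G a]
    unfolding residue_card[OF id_in_G a, symmetric] card_gt_0_iff by simp
qed

text \<open>The component \<open>h\<close> records which vertex of the chamber is meant, so each
  vertex of \<open>Y\<close> is counted once for every chamber containing it.\<close>

definition chambers_over :: "(nat \<times> 'c set) set \<Rightarrow> ('c \<times> ('a \<Rightarrow> 'a)) set" where
  "chambers_over Y = {(c, h). c \<in> C \<and> h \<in> G \<and> vertex_of (node_perm h 0) c \<in> Y}"

lemma card_chambers_over:
  assumes Y: "Y \<subseteq> good_vertices" and fin: "finite Y"
  shows "card (chambers_over Y) = residue_size * card Y"
proof -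
  have one: "finite (chambers_over {y}) \<and> card (chambers_over {y}) = residue_size" if y: "y \<in> Y" for y
  proof -
    have "y \<in> good_vertices" using y Y by blast
    then obtain h0 c0 where h: "h0 \<in> G" "c0 \<in> C" "y = vertex_of (node_perm h0 0) c0"
      unfolding good_vertices_eq by blast
    have eq: "chambers_over {y} = {c\<in>C. vertex_of (node_perm h0 0) c = vertex_of (node_perm h0 0) c0} \<times> {h0}"
    proof (intro equalityI subsetI)
      fix x assume "x \<in> chambers_over {y}"
      then obtain c j where x: "x = (c, j)" "c \<in> C" "j \<in> G" "vertex_of (node_perm j 0) c = y"
        by (auto simp: chambers_over_def)
      have "node_perm j 0 = node_perm h0 0" using arg_cong[OF trans[OF x(4) h(3)], of fst] by simp
      then have "j = h0" by (rule node_perm_0_inj[OF x(3) h(1)])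
      then show "x \<in> {c\<in>C. vertex_of (node_perm h0 0) c = vertex_of (node_perm h0 0) c0} \<times> {h0}"
        using x h(3) by simp
    next
      fix x assume "x \<in> {c\<in>C. vertex_of (node_perm h0 0) c = vertex_of (node_perm h0 0) c0} \<times> {h0}"
      then show "x \<in> chambers_over {y}" using h by (auto simp: chambers_over_def)
    qed
    show ?thesis unfolding eq using finite_residue[OF h(1,2)] residue_card[OF h(1,2)]
      by (simp add: card_cartesian_product)
  qed
  have "chambers_over Y = (\<Union>y\<in>Y. chambers_over {y})" by (auto simp: chambers_over_def)
  then have "card (chambers_over Y) = (\<Sum>y\<in>Y. card (chambers_over {y}))"
  proof (simp only:, intro card_UN_disjoint)
    show "\<forall>i\<in>Y. \<forall>j\<in>Y. i \<noteq> j \<longrightarrow> chambers_over {i} \<inter> chambers_over {j} = {}"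
      by (auto simp: chambers_over_def)
  qed (use one fin in blast)+
  also have "\<dots> = (\<Sum>y\<in>Y. residue_size)" by (rule sum.cong) (use one in blast)+
  finally show ?thesis by simp
qed

lemma chambers_over_sphere:
  assumes g: "g \<in> G" and a: "a \<in> C"
  shows "chambers_over (vertex_sphere l (vertex_of (node_perm g 0) a)) =
    {(c, h). c \<in> C \<and> h \<in> G \<and> inv g (\<delta> a c (h 0)) \<in> orbit l}"
  unfolding chambers_over_def using vertex_sphere_iff[OF g _ a] by auto

lemma vertex_sphere_good: "vertex_sphere l x \<subseteq> good_vertices" by (auto simp: vertex_sphere_def)

lemma finite_vertex_sphere:
  assumes "x \<in> good_vertices" shows "finite (vertex_sphere l x)"
proof -
  obtain g a where x: "g \<in> G" "a \<in> C" "x = vertex_of (node_perm g 0) a" using assms unfolding good_vertices_eq by blast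
  have "vertex_sphere l x \<subseteq> (\<Union>h\<in>G. (\<lambda>c. vertex_of (node_perm h 0) c) ` {c\<in>C. inv g (\<delta> a c (h 0)) \<in> orbit l})"
  proof
    fix y assume y: "y \<in> vertex_sphere l x"
    then have "y \<in> good_vertices" using vertex_sphere_good by blast
    then obtain h c where h: "h \<in> G" "c \<in> C" "y = vertex_of (node_perm h 0) c" unfolding good_vertices_eq by blast
    then have "inv g (\<delta> a c (h 0)) \<in> orbit l" using vertex_sphere_iff[OF x(1) h(1) x(2) h(2)] y x(3) by simp
    then show "y \<in> (\<Union>h\<in>G. (\<lambda>c. vertex_of (node_perm h 0) c) ` {c\<in>C. inv g (\<delta> a c (h 0)) \<in> orbit l})"
      using h by blast
  qed
  then show ?thesis
    by (rule finite_subset) (intro finite_UN_I finite_G finite_imageI finite_chamber_sphere[OF x(1) _ x(2)])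
qed

text \<open>Transport the chambers from \<open>a\<close> to \<open>a'\<close> and shift the type
  component by \<open>g' \<circ> inv g\<close>. This matches the chambers over the two spheres, and
  \<open>residue_size\<close> cancels.\<close>

lemma vertex_sphere_card:
  assumes "x \<in> good_vertices" "x' \<in> good_vertices"
  shows "card (vertex_sphere l x) = card (vertex_sphere l x')"
proof -
  obtain g a where x: "g \<in> G" "a \<in> C" "x = vertex_of (node_perm g 0) a" using assms unfolding good_vertices_eq by blast
  obtain g' a' where x': "g' \<in> G" "a' \<in> C" "x' = vertex_of (node_perm g' 0) a'" using assms unfolding good_vertices_eq by blast
  obtain k where k: "bij_betw k C C"
    "\<forall>c\<in>C. \<forall>z. inv g' (\<delta> a' (k c) (g' (inv g z))) = inv g (\<delta> a c z)"
    using chamber_sphere_transport[OF x(1) x'(1) x(2) x'(2)] by blast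
  let ?S = "{(c, h). c \<in> C \<and> h \<in> G \<and> inv g (\<delta> a c (h 0)) \<in> orbit l}"
  let ?S' = "{(c, h). c \<in> C \<and> h \<in> G \<and> inv g' (\<delta> a' c (h 0)) \<in> orbit l}"
  have "bij_betw (\<lambda>(c, h). (k c, g' \<circ> (inv g \<circ> h))) ?S ?S'"
  proof (rule bij_betw_byWitness[where f' = "\<lambda>(c, h). (inv_into C k c, g \<circ> (inv g' \<circ> h))"])
    have ki: "inv_into C k (k c) = c" if "c \<in> C" for c using bij_betw_inv_into_left[OF k(1) that] .
    have ik: "k (inv_into C k c) = c" "inv_into C k c \<in> C" if "c \<in> C" for c
      using bij_betw_inv_into_right[OF k(1) that] bij_betw_apply[OF bij_betw_inv_into[OF k(1)] that] by auto
    have gg: "g \<circ> (inv g' \<circ> (g' \<circ> (inv g \<circ> h))) = h" "g' \<circ> (inv g \<circ> (g \<circ> (inv g' \<circ> h))) = h" for h :: "'a \<Rightarrow> 'a"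
      using x(1) x'(1) by (simp_all add: fun_eq_iff)
    show "\<forall>p\<in>?S. (case case p of (c, h) \<Rightarrow> (k c, g' \<circ> (inv g \<circ> h)) of (c, h) \<Rightarrow> (inv_into C k c, g \<circ> (inv g' \<circ> h))) = p"
      using ki by (auto simp only: gg split: prod.splits)
    show "\<forall>p\<in>?S'. (case case p of (c, h) \<Rightarrow> (inv_into C k c, g \<circ> (inv g' \<circ> h)) of (c, h) \<Rightarrow> (k c, g' \<circ> (inv g \<circ> h))) = p"
      using ik by (auto simp only: gg split: prod.splits)
    show "(\<lambda>(c, h). (k c, g' \<circ> (inv g \<circ> h))) ` ?S \<subseteq> ?S'"
    proof (rule image_subsetI)
      fix p assume "p \<in> ?S"
      then obtain c h where p: "p = (c, h)" "c \<in> C" "h \<in> G" "inv g (\<delta> a c (h 0)) \<in> orbit l" by blast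
      have "inv g' (\<delta> a' (k c) ((g' \<circ> (inv g \<circ> h)) 0)) = inv g (\<delta> a c (h 0))" using k(2) p(2) by simp
      moreover have "g' \<circ> (inv g \<circ> h) \<in> G" by (intro G_comp G_inv x x' p)
      ultimately show "(\<lambda>(c, h). (k c, g' \<circ> (inv g \<circ> h))) p \<in> ?S'"
        using p bij_betw_apply[OF k(1) p(2)] by simp
    qed
    show "(\<lambda>(c, h). (inv_into C k c, g \<circ> (inv g' \<circ> h))) ` ?S' \<subseteq> ?S"
    proof (rule image_subsetI)
      fix p assume "p \<in> ?S'"
      then obtain c h where p: "p = (c, h)" "c \<in> C" "h \<in> G" "inv g' (\<delta> a' c (h 0)) \<in> orbit l" by blast
      have "inv g' (\<delta> a' (k (inv_into C k c)) (g' (inv g ((g \<circ> (inv g' \<circ> h)) 0)))) =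
          inv g (\<delta> a (inv_into C k c) ((g \<circ> (inv g' \<circ> h)) 0))" using k(2) ik(2)[OF p(2)] by blast
      moreover have "g' (inv g ((g \<circ> (inv g' \<circ> h)) 0)) = h 0" using x(1) x'(1) by simp
      ultimately have "inv g (\<delta> a (inv_into C k c) ((g \<circ> (inv g' \<circ> h)) 0)) \<in> orbit l"
        using p(4) ik(1)[OF p(2)] by simp
      moreover have "g \<circ> (inv g' \<circ> h) \<in> G" by (intro G_comp G_inv x x' p)
      ultimately show "(\<lambda>(c, h). (inv_into C k c, g \<circ> (inv g' \<circ> h))) p \<in> ?S"
        using p(1) ik(2)[OF p(2)] by simp
    qed
  qed
  then have "card ?S = card ?S'" by (rule bij_betw_same_card)
  then have "residue_size * card (vertex_sphere l x) = residue_size * card (vertex_sphere l x')"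
    using card_chambers_over[OF vertex_sphere_good finite_vertex_sphere[OF assms(1)], of l]
      card_chambers_over[OF vertex_sphere_good finite_vertex_sphere[OF assms(2)], of l]
      chambers_over_sphere[OF x(1,2), of l] chambers_over_sphere[OF x'(1,2), of l] x(3) x'(3) by simp
  then show ?thesis using residue_size_pos[OF x(2)] by simp
qed

section \<open>Symmetry of the intersection numbers\<close>

definition two_step :: "('a \<Rightarrow> 'a) \<Rightarrow> ('a \<Rightarrow> 'a) \<Rightarrow> 'a \<Rightarrow> 'a \<Rightarrow> 'c \<Rightarrow> 'c \<Rightarrow> ('c \<times> ('a \<Rightarrow> 'a)) set" where
  "two_step g k l m a b = {(c, h). c \<in> C \<and> h \<in> G \<and> inv g (\<delta> a c (h 0)) \<in> orbit l \<and> inv h (\<delta> c b (k 0)) \<in> orbit m}"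

lemma chambers_over_two_step:
  assumes "g \<in> G" "k \<in> G" "a \<in> C" "b \<in> C"
  shows "chambers_over {y \<in> vertex_sphere l (vertex_of (node_perm g 0) a). vertex_of (node_perm k 0) b \<in> vertex_sphere m y}
    = two_step g k l m a b"
  unfolding chambers_over_def two_step_def
  using vertex_sphere_iff[OF assms(1) _ assms(3)] vertex_sphere_iff[OF _ assms(2) _ assms(4)] by auto

text \<open>Reversing all distances and applying the opposition involution exchanges the two steps. The
  pair \<open>(b, a)\<close> is carried to a pair \<open>(a', b')\<close> over the same two vertices, because
  \<open>opp_inv\<close> and inversion together fix every double coset.\<close>

lemma two_step_swap:
  assumes g: "g \<in> G" and k: "k \<in> G" and C: "a \<in> C" "b \<in> C"
  obtains a' b' where "a' \<in> C" "b' \<in> C" "vertex_of (node_perm g 0) a' = vertex_of (node_perm g 0) a"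
    "vertex_of (node_perm k 0) b' = vertex_of (node_perm k 0) b"
    "card (two_step g k l m a b) = card (two_step g k m l a' b')"
proof -
  let ?w = "\<delta> a b" and ?i = opp_inv
  have w: "?w \<in> W" "?w \<in> aff_auts" using dist_in_W[OF C] W_aff_auts by auto
  have iA: "?i \<in> aff_auts" by (rule opp_inv_aff_auts)
  have gA: "g \<in> aff_auts" and kA: "k \<in> aff_auts" using G_aff_auts g k by auto
  define e where "e = inv g \<circ> ?w \<circ> k"
  have eE: "e \<in> W_ext" unfolding e_def
    by (intro W_ext_comp W_ext_inv G_W_ext[OF g] G_W_ext[OF k] W_subset_W_ext[OF w(1)])
  obtain p r where pr: "p \<in> W0" "r \<in> W0" "\<And>x. ?i (inv e (inv ?i x)) = p (e (r x))"
    by (rule opp_inv_double_coset[OF eE]) blast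
  \<comment> \<open>The \<open>W0\<close>-factors of the double coset are conjugated into the
    stabilisers of the vertices of \<open>a\<close> and \<open>b\<close>, so that they can be
    realised by moving the chambers inside their residues.\<close>
  define p' where "p' = g \<circ> p \<circ> inv g"
  define r' where "r' = k \<circ> r \<circ> inv k"
  have p': "p' \<in> W" "p' (fund_vertex (node_perm g 0)) = fund_vertex (node_perm g 0)"
    using W_conj[OF gA W0_W[OF pr(1)]] G_node[OF g, symmetric] W0_fixes[OF pr(1)] g by (simp_all add: p'_def)
  have r': "r' \<in> W" "r' (fund_vertex (node_perm k 0)) = fund_vertex (node_perm k 0)"
    using W_conj[OF kA W0_W[OF pr(2)]] G_node[OF k, symmetric] W0_fixes[OF pr(2)] k by (simp_all add: r'_def)
  obtain a' where a': "a' \<in> C" "vertex_of (node_perm g 0) a' = vertex_of (node_perm g 0) a" "\<delta> a' b = p' \<circ> ?w"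
    using reach_left[OF node_perm_0_in[OF g] p' C] by blast
  obtain b' where b': "b' \<in> C" "vertex_of (node_perm k 0) b' = vertex_of (node_perm k 0) b" "\<delta> a' b' = \<delta> a' b \<circ> r'"
    using reach_right[OF node_perm_0_in[OF k] r' a'(1) C(2)] by blast
  \<comment> \<open>Moving \<open>g\<close> and \<open>inv k\<close> past \<open>opp_inv\<close>
    inverts them, since \<open>opp_inv\<close> inverts \<open>G\<close>; the factor
    \<open>g \<circ> k\<close> collects the result.\<close>
  let ?f = "g \<circ> k \<circ> ?i"
  have fq: "q_preserving ?f"
    by (intro q_preserving_comp q_preserving_G g k q_preserving_opp_inv)
  then have fA: "?f \<in> aff_auts" using alcove_auts_aff by (simp add: q_preserving_def)
  have invf: "inv ?f x = inv ?i (inv k (inv g x))" for x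
  proof -
    have "?f (inv ?i (inv k (inv g x))) = x" using iA g k by simp
    then show ?thesis using aff_auts_inv_f[OF fA] by metis
  qed
  have ginv: "inv g \<in> G" "inv k \<in> G" using G_inv g k by auto
  have ba: "\<delta> b a = inv ?w" by (rule dist_inv[OF C])
  have inve: "inv e y = inv k (inv ?w (g y))" for y
  proof -
    have "e (inv k (inv ?w (g y))) = y" using g k w(2) by (simp add: e_def)
    then show ?thesis using aff_auts_inv_f[OF W_ext_aff_auts[OF eE]] by metis
  qed
  have "\<delta> a' b' = conj_by ?f (\<delta> b a)"
  proof
    fix x
    have "\<delta> a' b' x = g (p (e (r (inv k x))))" unfolding b'(3) a'(3) by (simp add: p'_def r'_def e_def)
    also have "\<dots> = g (?i (inv e (inv ?i (inv k x))))" unfolding pr(3) ..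
    also have "\<dots> = g (?i (inv k (inv ?w (g (inv ?i (inv k x))))))" unfolding inve ..
    also have "\<dots> = g (k (?i (inv ?w (inv ?i (inv g (inv k x))))))"
      unfolding opp_inv_G(3)[OF k] opp_inv_G(2)[OF g] ..
    also have "inv g (inv k x) = inv k (inv g x)" by (rule G_comm_apply[OF ginv])
    also have "g (k (?i (inv ?w (inv ?i (inv k (inv g x)))))) = conj_by ?f (\<delta> b a) x"
      unfolding conj_by_apply invf ba by simp
    finally show "\<delta> a' b' x = conj_by ?f (\<delta> b a) x" .
  qed
  then obtain t where t: "bij_betw t C C"
    "\<forall>c\<in>C. \<delta> a' (t c) = conj_by ?f (\<delta> b c) \<and> \<delta> (t c) b' = conj_by ?f (\<delta> c a)"
    using chamber_transport[OF fq C(2,1) a'(1) b'(1)] by blast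
  \<comment> \<open>The intermediate type is chosen so that conjugation by \<open>?f\<close> acts on
    extended distances as conjugation by \<open>opp_inv\<close> alone. Commutativity of
    \<open>G\<close> makes \<open>y\<close> an involution.\<close>
  define y where "y h = g \<circ> k \<circ> inv h" for h :: "'a \<Rightarrow> 'a"
  have yG: "y h \<in> G" if "h \<in> G" for h unfolding y_def by (intro G_comp G_inv g k that)
  have invy: "inv (y h) x = h (inv k (inv g x))" if h: "h \<in> G" for h x
  proof -
    have "y h (h (inv k (inv g x))) = x" using g k h by (simp add: y_def)
    then show ?thesis using G_inv_f[OF yG[OF h]] by metis
  qed
  have yy: "y (y h) = h" if h: "h \<in> G" for h
  proof
    fix x
    have "y (y h) x = g (k (h (inv k (inv g x))))" using invy[OF h] by (simp add: y_def[of "y h"])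
    also have "\<dots> = g (h (k (inv k (inv g x))))" unfolding G_comm_apply[OF k h] ..
    also have "\<dots> = h (g (k (inv k (inv g x))))" by (rule G_comm_apply[OF g h])
    also have "\<dots> = h x" using g k by simp
    finally show "y (y h) x = h x" .
  qed
  have rev_step: "?i (inv j (\<delta> c d (h 0))) \<in> orbit n \<longleftrightarrow> inv h (\<delta> d c (j 0)) \<in> orbit n"
    if h: "h \<in> G" and j: "j \<in> G" and cd: "c \<in> C" "d \<in> C" for h j c d n
  proof -
    let ?e = "inv h \<circ> \<delta> d c \<circ> j"
    have dW: "\<delta> d c \<in> W" by (rule dist_in_W[OF cd(2,1)])
    have eE: "?e \<in> W_ext" by (intro W_ext_comp W_ext_inv G_W_ext[OF h] G_W_ext[OF j] W_subset_W_ext[OF dW])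
    have "\<delta> c d = inv (\<delta> d c)" by (rule dist_inv[OF cd(2,1)])
    then have "?e (inv j (\<delta> c d (h 0))) = 0" using h j W_aff_auts[OF dW] by simp
    then have "inv ?e 0 = inv j (\<delta> c d (h 0))" using aff_auts_inv_f[OF W_ext_aff_auts[OF eE]] by metis
    then show ?thesis using orbit_opp_inv[OF eE, of n] by simp
  qed
  have mem: "(t c, y h) \<in> two_step g k m l a' b' \<longleftrightarrow> (c, h) \<in> two_step g k l m a b" if c: "c \<in> C" and h: "h \<in> G" for c h
  proof -
    have d1: "\<delta> a' (t c) = conj_by ?f (\<delta> b c)" and d2: "\<delta> (t c) b' = conj_by ?f (\<delta> c a)" using t(2) c by auto
    have "inv ?f (y h 0) = inv ?i (inv h 0)" using g k by (simp add: invf y_def)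
    also have "\<dots> = h 0" using opp_inv_G(2)[OF h, of 0] by (simp add: inv_opp_inv_0)
    finally have "inv g (\<delta> a' (t c) (y h 0)) = k (?i (\<delta> b c (h 0)))"
      unfolding d1 conj_by_apply using g by simp
    also have "\<dots> = ?i (inv k (\<delta> b c (h 0)))" by (rule opp_inv_G(3)[OF k, symmetric])
    finally have 1: "inv g (\<delta> a' (t c) (y h 0)) \<in> orbit m \<longleftrightarrow> inv h (\<delta> c b (k 0)) \<in> orbit m"
      using rev_step[OF h k C(2) c] by simp
    have "inv ?f (k 0) = inv ?i (inv k (inv g (k 0)))" by (rule invf)
    also have "inv g (k 0) = k (inv g 0)" by (rule G_comm_apply[OF ginv(1) k])
    also have "inv ?i (inv k (k (inv g 0))) = g 0" using opp_inv_G(2)[OF g, of 0] k by (simp add: inv_opp_inv_0)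
    finally have fk: "inv ?f (k 0) = g 0" .
    have "inv (y h) (\<delta> (t c) b' (k 0)) = h (inv k (inv g (?f (\<delta> c a (inv ?f (k 0))))))"
      unfolding d2 conj_by_apply invy[OF h] ..
    also have "\<dots> = h (inv k (inv g (?f (\<delta> c a (g 0)))))" unfolding fk ..
    finally have "inv (y h) (\<delta> (t c) b' (k 0)) = h (?i (\<delta> c a (g 0)))"
      using g k by simp
    also have "\<dots> = ?i (inv h (\<delta> c a (g 0)))" by (rule opp_inv_G(3)[OF h, symmetric])
    finally have 2: "inv (y h) (\<delta> (t c) b' (k 0)) \<in> orbit l \<longleftrightarrow> inv g (\<delta> a c (h 0)) \<in> orbit l"
      using rev_step[OF g h c C(1)] by simp
    show ?thesis unfolding two_step_def using 1 2 c h bij_betw_apply[OF t(1) c] yG[OF h] by auto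
  qed
  have "bij_betw (\<lambda>(c, h). (t c, y h)) (two_step g k l m a b) (two_step g k m l a' b')"
  proof (rule bij_betw_byWitness[where f' = "\<lambda>(c, h). (inv_into C t c, y h)"])
    have sub: "\<exists>c h. p = (c, h) \<and> c \<in> C \<and> h \<in> G" if "p \<in> two_step g k l m a b" for p l m a b
      using that by (auto simp: two_step_def)
    have ti: "inv_into C t (t c) = c" if "c \<in> C" for c using bij_betw_inv_into_left[OF t(1) that] .
    have it: "t (inv_into C t c) = c" "inv_into C t c \<in> C" if "c \<in> C" for c
      using bij_betw_inv_into_right[OF t(1) that] bij_betw_apply[OF bij_betw_inv_into[OF t(1)] that] by auto
    show "\<forall>p\<in>two_step g k l m a b. (case case p of (c, h) \<Rightarrow> (t c, y h) of (c, h) \<Rightarrow> (inv_into C t c, y h)) = p"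
      using sub ti yy by fastforce
    show "\<forall>p\<in>two_step g k m l a' b'. (case case p of (c, h) \<Rightarrow> (inv_into C t c, y h) of (c, h) \<Rightarrow> (t c, y h)) = p"
      using sub it yy by fastforce
    show "(\<lambda>(c, h). (t c, y h)) ` two_step g k l m a b \<subseteq> two_step g k m l a' b'"
    proof (rule image_subsetI)
      fix p assume p: "p \<in> two_step g k l m a b"
      obtain c h where "p = (c, h)" "c \<in> C" "h \<in> G" using sub[OF p] by blast
      then show "(\<lambda>(c, h). (t c, y h)) p \<in> two_step g k m l a' b'" using mem p by simp
    qed
    show "(\<lambda>(c, h). (inv_into C t c, y h)) ` two_step g k m l a' b' \<subseteq> two_step g k l m a b"
    proof (rule image_subsetI)
      fix p assume p: "p \<in> two_step g k m l a' b'"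
      obtain c h where ch: "p = (c, h)" "c \<in> C" "h \<in> G" using sub[OF p] by blast
      then have "(t (inv_into C t c), y (y h)) \<in> two_step g k m l a' b'" using p it yy by simp
      then have "(inv_into C t c, y h) \<in> two_step g k l m a b" using mem[OF it(2)[OF ch(2)] yG[OF ch(3)]] by simp
      then show "(\<lambda>(c, h). (inv_into C t c, y h)) p \<in> two_step g k l m a b" using ch by simp
    qed
  qed
  then have "card (two_step g k l m a b) = card (two_step g k m l a' b')" by (rule bij_betw_same_card)
  then show ?thesis using that[OF a'(1) b'(1) a'(2) b'(2)] by blast
qed

text \<open>The new chambers \<open>a'\<close> and \<open>b'\<close> have the same vertices as
  \<open>a\<close> and \<open>b\<close>, so \<open>two_step_swap\<close> compares two counts for the
  same pair of vertices, and \<open>residue_size\<close> cancels.\<close>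

lemma two_step_symmetric:
  assumes x: "x \<in> good_vertices" and z: "z \<in> good_vertices"
  shows "card {y\<in>vertex_sphere l x. z \<in> vertex_sphere m y} = card {y\<in>vertex_sphere m x. z \<in> vertex_sphere l y}"
proof -
  obtain g a where xa: "g \<in> G" "a \<in> C" "x = vertex_of (node_perm g 0) a" using x unfolding good_vertices_eq by blast
  obtain k b where zb: "k \<in> G" "b \<in> C" "z = vertex_of (node_perm k 0) b" using z unfolding good_vertices_eq by blast
  obtain a' b' where ab: "a' \<in> C" "b' \<in> C" "vertex_of (node_perm g 0) a' = vertex_of (node_perm g 0) a"
    "vertex_of (node_perm k 0) b' = vertex_of (node_perm k 0) b"
    "card (two_step g k l m a b) = card (two_step g k m l a' b')"
    using two_step_swap[OF xa(1) zb(1) xa(2) zb(2)] by blast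
  have c: "card (chambers_over {y\<in>vertex_sphere l x. z \<in> vertex_sphere m y}) =
      residue_size * card {y\<in>vertex_sphere l x. z \<in> vertex_sphere m y}" for l m
  proof (rule card_chambers_over)
    show "{y\<in>vertex_sphere l x. z \<in> vertex_sphere m y} \<subseteq> good_vertices" using vertex_sphere_good by blast
    show "finite {y\<in>vertex_sphere l x. z \<in> vertex_sphere m y}"
      by (rule finite_subset[OF _ finite_vertex_sphere[OF x]]) blast
  qed
  have "chambers_over {y\<in>vertex_sphere l x. z \<in> vertex_sphere m y} = two_step g k l m a b"
    unfolding xa(3) zb(3) by (rule chambers_over_two_step[OF xa(1) zb(1) xa(2) zb(2)])
  moreover have "chambers_over {y\<in>vertex_sphere m x. z \<in> vertex_sphere l y} = two_step g k m l a' b'"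
    unfolding xa(3) zb(3) ab(3,4)[symmetric] by (rule chambers_over_two_step[OF xa(1) zb(1) ab(1,2)])
  ultimately have "residue_size * card {y\<in>vertex_sphere l x. z \<in> vertex_sphere m y} =
      residue_size * card {y\<in>vertex_sphere m x. z \<in> vertex_sphere l y}"
    using ab(5) c[of l m] c[of m l] by simp
  then show ?thesis using residue_size_pos[OF xa(2)] by simp
qed

text \<open>The inner denominator is the same at every intermediate vertex by
  \<open>vertex_sphere_card\<close> and leaves the sum; swapping the sums then collects the
  intermediate vertices of each endpoint.\<close>

lemma averaging_comp:
  assumes x: "x \<in> good_vertices" and Z: "finite Z" "\<And>y. y \<in> vertex_sphere l x \<Longrightarrow> vertex_sphere m y \<subseteq> Z"
  shows "averaging l (averaging m f) x =
    (\<Sum>z\<in>Z. of_nat (card {y\<in>vertex_sphere l x. z \<in> vertex_sphere m y}) * f z)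
      / (of_nat (card (vertex_sphere m x)) * of_nat (card (vertex_sphere l x)))"
proof -
  let ?N = "of_nat (card (vertex_sphere m x)) :: complex"
  have fin: "finite (vertex_sphere l x)" by (rule finite_vertex_sphere[OF x])
  have "averaging m f y = (\<Sum>z\<in>{z\<in>Z. z \<in> vertex_sphere m y}. f z) / ?N" if y: "y \<in> vertex_sphere l x" for y
  proof -
    have yg: "y \<in> good_vertices" using y vertex_sphere_good by blast
    have "{z\<in>Z. z \<in> vertex_sphere m y} = vertex_sphere m y" using Z(2)[OF y] by blast
    then show ?thesis using yg vertex_sphere_card[OF yg x, of m] by (simp add: averaging_def)
  qed
  then have "(\<Sum>y\<in>vertex_sphere l x. averaging m f y)
      = (\<Sum>y\<in>vertex_sphere l x. (\<Sum>z\<in>{z\<in>Z. z \<in> vertex_sphere m y}. f z) / ?N)"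
    by (rule sum.cong[OF refl])
  also have "\<dots> = (\<Sum>y\<in>vertex_sphere l x. \<Sum>z\<in>{z\<in>Z. z \<in> vertex_sphere m y}. f z) / ?N"
    by (simp add: sum_divide_distrib)
  also have "(\<Sum>y\<in>vertex_sphere l x. \<Sum>z\<in>{z\<in>Z. z \<in> vertex_sphere m y}. f z)
      = (\<Sum>z\<in>Z. \<Sum>y\<in>{y\<in>vertex_sphere l x. z \<in> vertex_sphere m y}. f z)"
    by (rule sum.swap_restrict[OF fin Z(1)])
  finally show ?thesis using x by (simp add: averaging_def)
qed

lemma averaging_commute: "averaging l (averaging m f) = averaging m (averaging l f)"
proof
  fix x
  show "averaging l (averaging m f) x = averaging m (averaging l f) x"
  proof (cases "x \<in> good_vertices")
    case False
    then show ?thesis by (simp add: averaging_def)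
  next
    case x: True
    \<comment> \<open>The endpoints for both orders of composition, so that both become sums over
      one index set.\<close>
    let ?Z = "(\<Union>y\<in>vertex_sphere l x. vertex_sphere m y) \<union> (\<Union>y\<in>vertex_sphere m x. vertex_sphere l y)"
    have good: "y \<in> good_vertices" if "y \<in> vertex_sphere n w" for y n w using that vertex_sphere_good by blast
    have Z: "finite ?Z" by (intro finite_UnI finite_UN_I finite_vertex_sphere x) (rule good, assumption)+
    have Zg: "z \<in> good_vertices" if "z \<in> ?Z" for z using that good by blast
    have "averaging l (averaging m f) x =
      (\<Sum>z\<in>?Z. of_nat (card {y\<in>vertex_sphere l x. z \<in> vertex_sphere m y}) * f z)
      / (of_nat (card (vertex_sphere m x)) * of_nat (card (vertex_sphere l x)))"
      by (rule averaging_comp[OF x Z]) blast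
    also have "(\<Sum>z\<in>?Z. of_nat (card {y\<in>vertex_sphere l x. z \<in> vertex_sphere m y}) * f z) =
        (\<Sum>z\<in>?Z. of_nat (card {y\<in>vertex_sphere m x. z \<in> vertex_sphere l y}) * f z)"
      by (rule sum.cong[OF refl]) (simp only: two_step_symmetric[OF x Zg])
    also have "\<dots> / (of_nat (card (vertex_sphere m x)) * of_nat (card (vertex_sphere l x)))
        = averaging m (averaging l f) x"
      unfolding mult.commute[of "of_nat (card (vertex_sphere m x))"]
      by (rule averaging_comp[OF x Z, symmetric]) blast
    finally show ?thesis .
  qed
qed

section \<open>Linear combinations of averaging operators\<close>

lemma averaging_linear:
  "averaging l (\<lambda>x. \<Sum>m\<in>F. b m * g m x) x = (\<Sum>m\<in>F. b m * averaging l (g m) x)"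
proof (cases "x \<in> good_vertices")
  case True
  have "(\<Sum>y\<in>vertex_sphere l x. \<Sum>m\<in>F. b m * g m y) = (\<Sum>m\<in>F. b m * (\<Sum>y\<in>vertex_sphere l x. g m y))"
    by (subst sum.swap) (simp add: sum_distrib_left)
  then have "averaging l (\<lambda>x. \<Sum>m\<in>F. b m * g m x) x =
      (\<Sum>m\<in>F. b m * (\<Sum>y\<in>vertex_sphere l x. g m y)) / of_nat (card (vertex_sphere l x))"
    using True by (simp add: averaging_def)
  also have "\<dots> = (\<Sum>m\<in>F. b m * ((\<Sum>y\<in>vertex_sphere l x. g m y) / of_nat (card (vertex_sphere l x))))"
    unfolding sum_divide_distrib[of "\<lambda>m. b m * _ m"] by simp
  also have "\<dots> = (\<Sum>m\<in>F. b m * averaging l (g m) x)" using True by (simp add: averaging_def)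
  finally show ?thesis .
qed (simp add: averaging_def)

lemma averaging_algebra_commute:
  assumes "T \<in> averaging_algebra" "U \<in> averaging_algebra"
  shows "T \<circ> U = U \<circ> T"
proof -
  obtain F and a :: "'a \<Rightarrow> complex" where T: "T = (\<lambda>f x. \<Sum>l\<in>F. a l * averaging l f x)"
    using assms(1) by (auto simp: averaging_algebra_def)
  obtain F' and b :: "'a \<Rightarrow> complex" where U: "U = (\<lambda>f x. \<Sum>l\<in>F'. b l * averaging l f x)"
    using assms(2) by (auto simp: averaging_algebra_def)
  show ?thesis
  proof (intro ext)
    fix f x
    have "(T \<circ> U) f x = (\<Sum>l\<in>F. \<Sum>m\<in>F'. a l * (b m * averaging l (averaging m f) x))"
      by (simp add: T U averaging_linear sum_distrib_left)
    also have "\<dots> = (\<Sum>m\<in>F'. \<Sum>l\<in>F. b m * (a l * averaging m (averaging l f) x))"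
      by (subst sum.swap) (simp only: averaging_commute mult.left_commute)
    also have "\<dots> = (U \<circ> T) f x"
      by (simp add: T U averaging_linear sum_distrib_left)
    finally show "(T \<circ> U) f x = (U \<circ> T) f x" .
  qed
qed

end

theorem theorem5p24:
  fixes R :: "'a::euclidean_space set" and \<alpha> :: "nat \<Rightarrow> 'a"
    and C :: "'c set" and adj :: "nat \<Rightarrow> ('c \<times> 'c) set"
    and \<delta> :: "'c \<Rightarrow> 'c \<Rightarrow> 'a \<Rightarrow> 'a"
  assumes "locally_finite_regular_affine_building R \<alpha> C adj \<delta>"
  shows "\<forall>T\<in>building.averaging_algebra R \<alpha> C adj.
         \<forall>U\<in>building.averaging_algebra R \<alpha> C adj. T \<circ> U = U \<circ> T"
  using locally_finite_regular_affine_building.averaging_algebra_commute[OF assms] by blast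

end
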